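(* Let $a$ be a bounded, almost everywhere differentiable function on $\mathbb{R}^d$. Assume that there exist constants $\sigma>0$ and $J>0$ such that the inequalities $$|a(\xi)|\le J\sigma|\xi|,\qquad |a(\xi)|\le J\frac{1}{\sigma|\xi|},\qquad |\langle\xi,\nabla a(\xi)\rangle|\le J$$ hold for almost every $\xi\in\mathbb{R}^d$. Consider the family of Fourier multiplier operators $\{\mathcal{A}_t\}_{t>0}$ given by $$\widehat{\mathcal{A}_tf}(\xi)=a(t\xi)\widehat f(\xi).$$ Then there exists a constant $C>0$, depending only on $J$ (in particular not on $d$ or $\sigma$), such that $$\|\mathcal{A}_\ast\|_{L^2(\mathbb{R}^d)}\le C\,\|a\|_{L^\infty(\mathbb{R}^d)}^{1/4}.$$
   Context: $\widehat f(\xi)=\int_{\mathbb{R}^d}f(x)e^{-2\pi i x\cdot\xi}\,dx$. The maximal operator is $\mathcal{A}_\ast f(x)=\sup_{t>0}|\mathcal{A}_tf(x)|$, and $\|\mathcal{A}_\ast\|_{L^2(\mathbb{R}^d)}$ is the best constant $C'$ in $\|\sup_{t>0}|\mathcal{A}_tf|\|_{L^2(\mathbb{R}^d)}\le C'\|f\|_{L^2(\mathbb{R}^d)}$.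
   Formalization: As stated the claim fails for merely almost everywhere differentiable a (e.g. step functions with many jumps); it is proved under the added assumption that for almost every ξ the map t ↦ a(tξ) is locally absolutely continuous on (0,∞). *)

theory Defs
  imports "HOL-Analysis.Analysis" "HOL-Probability.Essential_Supremum"
begin

text \<open>
  The constant in the theorem is uniform in the dimension, so the dimension \<open>d\<close> has to be a
  number and not a type.  The space \<open>\<real>^d\<close> is the set of extensional functions
  \<open>{..<d} \<rightarrow>\<^sub>E UNIV\<close>, which is the underlying space of the following measure
  (Lebesgue measure, i.e. the completed \<open>d\<close>-fold product).
\<close>

definition leb :: "nat \<Rightarrow> (nat \<Rightarrow> real) measure" where
  "leb d = completion (Pi\<^sub>M {..<d} (\<lambda>_. lborel))"

definition vnorm :: "nat \<Rightarrow> (nat \<Rightarrow> real) \<Rightarrow> real" where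
  "vnorm d x = L2_set x {..<d}"

definition vinner :: "nat \<Rightarrow> (nat \<Rightarrow> real) \<Rightarrow> (nat \<Rightarrow> real) \<Rightarrow> real" where
  "vinner d x y = (\<Sum>i<d. x i * y i)"

definition vscale :: "nat \<Rightarrow> real \<Rightarrow> (nat \<Rightarrow> real) \<Rightarrow> (nat \<Rightarrow> real)" where
  "vscale d t x = (\<lambda>i\<in>{..<d}. t * x i)"


text \<open>Differential calculus; functions are complex-valued, and derivatives are real-linear.\<close>

definition differentiable_pt :: "nat \<Rightarrow> ((nat \<Rightarrow> real) \<Rightarrow> complex) \<Rightarrow> (nat \<Rightarrow> real) \<Rightarrow> bool" where
  "differentiable_pt d a \<xi> \<longleftrightarrow>
     (\<exists>v :: nat \<Rightarrow> complex. \<forall>\<epsilon>>0. \<exists>\<delta>>0. \<forall>\<eta>\<in>space (leb d).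
        vnorm d (\<lambda>i. \<eta> i - \<xi> i) < \<delta> \<longrightarrow>
        cmod (a \<eta> - a \<xi> - (\<Sum>i<d. (\<eta> i - \<xi> i) *\<^sub>R v i)) \<le> \<epsilon> * vnorm d (\<lambda>i. \<eta> i - \<xi> i))"

definition partial_deriv :: "nat \<Rightarrow> ((nat \<Rightarrow> real) \<Rightarrow> complex) \<Rightarrow> (nat \<Rightarrow> real) \<Rightarrow> complex" where
  "partial_deriv i a \<xi> = vector_derivative (\<lambda>s. a (\<xi>(i := s))) (at (\<xi> i))"

text \<open>The pairing \<open>\<langle>\<xi>, \<nabla>a(\<xi>)\<rangle>\<close>.\<close>

definition radial_deriv :: "nat \<Rightarrow> ((nat \<Rightarrow> real) \<Rightarrow> complex) \<Rightarrow> (nat \<Rightarrow> real) \<Rightarrow> complex" where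
  "radial_deriv d a \<xi> = (\<Sum>i<d. \<xi> i *\<^sub>R partial_deriv i a \<xi>)"

definition abs_continuous_on :: "real \<Rightarrow> real \<Rightarrow> (real \<Rightarrow> complex) \<Rightarrow> bool" where
  "abs_continuous_on r s f \<longleftrightarrow>
     (\<forall>\<epsilon>>0. \<exists>\<delta>>0. \<forall>(n::nat) (x::nat \<Rightarrow> real) (y::nat \<Rightarrow> real).
        (\<forall>k<n. r \<le> x k \<and> x k \<le> y k \<and> y k \<le> s) \<and>
        disjoint_family_on (\<lambda>k. {x k<..<y k}) {..<n} \<and>
        (\<Sum>k<n. y k - x k) < \<delta>
        \<longrightarrow> (\<Sum>k<n. cmod (f (y k) - f (x k))) < \<epsilon>)"

text \<open>
  Pointwise differentiability almost everywhere does not see the singular part of a function: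
  for a bounded step function the gradient vanishes almost everywhere.  The theorem, whose
  hypothesis on \<open>\<langle>\<xi>, \<nabla>a(\<xi>)\<rangle>\<close> is meant to control the variation of \<open>t \<mapsto> a(t\<xi>)\<close>, fails for
  such symbols, already for \<open>d = 1\<close>.  The following condition says that this variation is
  given by the gradient: \<open>t \<mapsto> a(t\<xi>)\<close> is locally absolutely continuous on \<open>(0,\<infinity>)\<close>, for
  almost every \<open>\<xi>\<close>.
\<close>

definition radially_abs_continuous :: "nat \<Rightarrow> ((nat \<Rightarrow> real) \<Rightarrow> complex) \<Rightarrow> bool" where
  "radially_abs_continuous d a \<longleftrightarrow>
     (AE \<xi> in leb d. \<forall>r s. 0 < r \<and> r < s \<longrightarrow> abs_continuous_on r s (\<lambda>t. a (vscale d t \<xi>)))"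


definition L2norm :: "nat \<Rightarrow> ((nat \<Rightarrow> real) \<Rightarrow> ennreal) \<Rightarrow> ennreal" where
  "L2norm d h =
     (let I = (\<integral>\<^sup>+x. (h x)\<^sup>2 \<partial>leb d) in if I = \<infinity> then \<infinity> else ennreal (sqrt (enn2real I)))"

abbreviation L2cnorm :: "nat \<Rightarrow> ((nat \<Rightarrow> real) \<Rightarrow> complex) \<Rightarrow> ennreal" where
  "L2cnorm d f \<equiv> L2norm d (\<lambda>x. ennreal (cmod (f x)))"

definition L2 :: "nat \<Rightarrow> ((nat \<Rightarrow> real) \<Rightarrow> complex) set" where
  "L2 d = {f \<in> borel_measurable (leb d). L2cnorm d f < \<infinity>}"

definition Linfnorm :: "nat \<Rightarrow> ((nat \<Rightarrow> real) \<Rightarrow> complex) \<Rightarrow> ennreal" where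
  "Linfnorm d a = esssup (leb d) (\<lambda>\<xi>. ennreal (cmod (a \<xi>)))"


definition fourier :: "nat \<Rightarrow> ((nat \<Rightarrow> real) \<Rightarrow> complex) \<Rightarrow> (nat \<Rightarrow> real) \<Rightarrow> complex" where
  "fourier d f \<xi> = (LINT x|leb d. f x * exp (- 2 * of_real pi * \<i> * of_real (vinner d x \<xi>)))"

text \<open>The extension of the Fourier integral from \<open>L\<^sup>1 \<inter> L\<^sup>2\<close> to \<open>L\<^sup>2\<close> by continuity; the
  result is determined up to equality almost everywhere.\<close>

definition fourier_L2 :: "nat \<Rightarrow> ((nat \<Rightarrow> real) \<Rightarrow> complex) \<Rightarrow> (nat \<Rightarrow> real) \<Rightarrow> complex" where
  "fourier_L2 d f =
     (SOME F. F \<in> L2 d \<and>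
        (\<exists>u :: nat \<Rightarrow> (nat \<Rightarrow> real) \<Rightarrow> complex.
           (\<forall>n. u n \<in> L2 d \<and> integrable (leb d) (u n)) \<and>
           (\<lambda>n. L2cnorm d (\<lambda>x. u n x - f x)) \<longlonglongrightarrow> 0 \<and>
           (\<lambda>n. L2cnorm d (\<lambda>\<xi>. fourier d (u n) \<xi> - F \<xi>)) \<longlonglongrightarrow> 0))"

definition multiplier_op ::
  "nat \<Rightarrow> ((nat \<Rightarrow> real) \<Rightarrow> complex) \<Rightarrow> ((nat \<Rightarrow> real) \<Rightarrow> complex) \<Rightarrow> (nat \<Rightarrow> real) \<Rightarrow> complex" where
  "multiplier_op d m f =
     (SOME g. g \<in> L2 d \<and> (AE \<xi> in leb d. fourier_L2 d g \<xi> = m \<xi> * fourier_L2 d f \<xi>))"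

text \<open>The operators \<open>\<A>\<^sub>t\<close>.\<close>

definition dilated_op ::
  "nat \<Rightarrow> ((nat \<Rightarrow> real) \<Rightarrow> complex) \<Rightarrow> real \<Rightarrow> ((nat \<Rightarrow> real) \<Rightarrow> complex) \<Rightarrow> (nat \<Rightarrow> real) \<Rightarrow> complex" where
  "dilated_op d a t f = multiplier_op d (\<lambda>\<xi>. a (vscale d t \<xi>)) f"

text \<open>
  Each \<open>\<A>\<^sub>t f\<close> is only defined up to a null set depending on \<open>t\<close>, so that a pointwise supremum over
  the uncountably many \<open>t > 0\<close> would depend on the choice of representatives.  The supremum is
  therefore the one in the lattice of measurable functions modulo null sets (it agrees almost
  everywhere with the supremum over a suitable countable set of \<open>t\<close>, and with the pointwise
  supremum when \<open>\<A>\<^sub>t f(x)\<close> is continuous in \<open>t\<close> for almost every \<open>x\<close>).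
\<close>

definition is_ae_Sup :: "'a measure \<Rightarrow> 'i set \<Rightarrow> ('i \<Rightarrow> 'a \<Rightarrow> ennreal) \<Rightarrow> ('a \<Rightarrow> ennreal) \<Rightarrow> bool" where
  "is_ae_Sup M T g H \<longleftrightarrow>
     H \<in> borel_measurable M \<and>
     (\<forall>t\<in>T. AE x in M. g t x \<le> H x) \<and>
     (\<forall>K\<in>borel_measurable M. (\<forall>t\<in>T. AE x in M. g t x \<le> K x) \<longrightarrow> (AE x in M. H x \<le> K x))"

definition maximal_op ::
  "nat \<Rightarrow> ((nat \<Rightarrow> real) \<Rightarrow> complex) \<Rightarrow> ((nat \<Rightarrow> real) \<Rightarrow> complex) \<Rightarrow> (nat \<Rightarrow> real) \<Rightarrow> ennreal" where
  "maximal_op d a f =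
     (SOME H. is_ae_Sup (leb d) {0<..} (\<lambda>t x. ennreal (cmod (dilated_op d a t f x))) H)"

definition maximal_op_norm :: "nat \<Rightarrow> ((nat \<Rightarrow> real) \<Rightarrow> complex) \<Rightarrow> ennreal" where
  "maximal_op_norm d a =
     Inf {K. \<forall>f\<in>L2 d. L2norm d (maximal_op d a f) \<le> K * L2cnorm d f}"

end

theory Submission
  imports Defs "HOL-Probability.Characteristic_Functions"
begin

text \<open>
  By Plancherel's theorem, multipliers \<open>m\<^sub>k\<close> with \<open>\<Sum>\<^sub>k \<bar>m\<^sub>k\<bar>\<^sup>2 \<le> c\<close> almost everywhere define operators
  whose square function has norm at most \<open>\<surd>c\<close> on \<open>L\<^sup>2\<close>.  Since \<open>t \<mapsto> \<A>\<^sub>t f\<close> is locally Lipschitz into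
  \<open>L\<^sup>2\<close>, the supremum may be restricted to \<open>t = exp (k / 2\<^sup>l)\<close>, and chaining over the levels \<open>l\<close> bounds it
  by the sum over \<open>l\<close> of the square functions of the increments between consecutive points of level \<open>l\<close>.
  Write \<open>A\<close> for the supremum norm of \<open>a\<close> and \<open>exp \<rho> = \<sigma> \<bar>\<xi>\<bar>\<close>.  The multiplier of the \<open>k\<close>-th increment is
  at most \<open>2 A\<close>, at most \<open>2 J / 2\<^sup>l\<close> by the bound on the radial derivative, and at most
  \<open>4 J exp (- \<bar>\<rho> + k / 2\<^sup>l\<bar>)\<close> by the two size bounds.  Interpolating its square between these with
  exponents \<open>1/2\<close>, \<open>5/4\<close> and \<open>1/4\<close> and summing over \<open>k\<close> gives a multiple of \<open>A\<^bsup>1/2\<^esup> 2\<^bsup>- l/4\<^esup>\<close>; this is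
  summable over \<open>l\<close>, and its square root is the source of the power \<open>1/4\<close>.

  Plancherel's theorem is proved on \<open>L\<^sup>1 \<inter> L\<^sup>2\<close>, on the line by Gaussian regularisation and density of
  continuous functions, and in dimension \<open>d\<close> by induction.
\<close>

section \<open>Square-integrable functions\<close>

text \<open>Nothing depends on \<open>d\<close> or \<sigma> because the symbol is only ever
  estimated along single rays: \<xi> enters through \<rho> alone, \<sigma> merely translates \<rho>,
  and the sums over \<open>k\<close> are bounded uniformly in \<rho>. The passage from symbols to
  operators is an isometry and costs no constant.

  The obstacle is that the number of dyadic points per unit of \<open>ln t\<close> grows like
  \<open>2^l\<close>. The radial derivative gives each increment a factor \<open>2^-l\<close>, so
  its square is more than enough to pay for these points, and part of the surplus can be exchanged
  for a power of \<open>A\<close>.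

  A second difficulty lies in the definitions: \<open>fourier_L2\<close>,
  \<open>multiplier_op\<close> and \<open>maximal_op\<close> choose representatives, separately for
  each argument. Existence has to be established before anything can be said of them, and even
  additivity holds only almost everywhere. They are therefore compared through squared L^2 norms,
  which also keeps square roots out of \<open>ennreal\<close>.\<close>

definition sq_norm :: "'a measure \<Rightarrow> ('a \<Rightarrow> complex) \<Rightarrow> ennreal" where
  "sq_norm M f = (\<integral>\<^sup>+x. ennreal ((cmod (f x))\<^sup>2) \<partial>M)"

definition sq_int :: "'a measure \<Rightarrow> ('a \<Rightarrow> complex) set" where
  "sq_int M = {f \<in> borel_measurable M. sq_norm M f < \<infinity>}"

lemma sq_intD[measurable_dest]: "f \<in> sq_int M \<Longrightarrow> f \<in> borel_measurable M"
  by (simp add: sq_int_def)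

lemma sq_int_fin: "f \<in> sq_int M \<Longrightarrow> sq_norm M f < \<infinity>"
  by (simp add: sq_int_def)

lemma sq_norm_cong_AE: "AE x in M. cmod (f x) = cmod (g x) \<Longrightarrow> sq_norm M f = sq_norm M g"
  unfolding sq_norm_def by (rule nn_integral_cong_AE) auto

lemma sq_norm_mono_AE: "AE x in M. cmod (f x) \<le> cmod (g x) \<Longrightarrow> sq_norm M f \<le> sq_norm M g"
  unfolding sq_norm_def by (rule nn_integral_mono_AE) (auto intro!: ennreal_leI power_mono)

lemma sq_norm_scale: 
  assumes [measurable]: "f \<in> borel_measurable M"
  shows "sq_norm M (\<lambda>x. c * f x) = ennreal ((cmod c)\<^sup>2) * sq_norm M f"
  unfolding sq_norm_def by (subst nn_integral_cmult[symmetric]) (auto simp: norm_mult power_mult_distrib ennreal_mult)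

lemma sq_norm_uminus: "sq_norm M (\<lambda>x. - f x) = sq_norm M f"
  by (simp add: sq_norm_def)

lemma sq_norm_minus_commute: "sq_norm M (\<lambda>x. f x - g x) = sq_norm M (\<lambda>x. g x - f x)"
  by (simp add: sq_norm_def norm_minus_commute)

lemma sq_norm_cnj: "sq_norm M (\<lambda>x. cnj (f x)) = sq_norm M f"
  by (simp add: sq_norm_def)

text \<open>Squares of norms are not subadditive; Young's inequality 2|a||b| \<le> c|a|^2 + |b|^2/c
  takes the place of the triangle inequality.\<close>

lemma sq_norm_add_le:
  assumes [measurable]: "f \<in> borel_measurable M" "g \<in> borel_measurable M" and c: "c > 0"
  shows "sq_norm M (\<lambda>x. f x + g x) \<le> ennreal (1 + c) * sq_norm M f + ennreal (1 + 1 / c) * sq_norm M g"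
proof -
  have *: "(cmod (a + b))\<^sup>2 \<le> (1 + c) * (cmod a)\<^sup>2 + (1 + 1/c) * (cmod b)\<^sup>2" for a b
  proof -
    have "(cmod (a + b))\<^sup>2 \<le> (cmod a + cmod b)\<^sup>2"
      by (intro power_mono norm_triangle_ineq) auto
    also have "\<dots> = (cmod a)\<^sup>2 + (cmod b)\<^sup>2 + 2 * cmod a * cmod b"
      by (simp add: power2_sum)
    also have "2 * cmod a * cmod b \<le> c * (cmod a)\<^sup>2 + (1/c) * (cmod b)\<^sup>2"
    proof -
      have "0 \<le> (c * cmod a - cmod b)\<^sup>2 / c" using c by simp
      also have "\<dots> = c * (cmod a)\<^sup>2 + (1/c) * (cmod b)\<^sup>2 - 2 * cmod a * cmod b"
        using c by (simp add: field_simps power2_eq_square)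
      finally show ?thesis by simp
    qed
    finally show ?thesis by (simp add: algebra_simps)
  qed
  have "sq_norm M (\<lambda>x. f x + g x) \<le> (\<integral>\<^sup>+x. ennreal (1 + c) * ennreal ((cmod (f x))\<^sup>2) + ennreal (1 + 1/c) * ennreal ((cmod (g x))\<^sup>2) \<partial>M)"
    unfolding sq_norm_def using c *
    by (intro nn_integral_mono) (simp add: ennreal_mult[symmetric] ennreal_plus[symmetric] del: ennreal_plus)
  also have "\<dots> = ennreal (1 + c) * sq_norm M f + ennreal (1 + 1 / c) * sq_norm M g"
    unfolding sq_norm_def by (simp add: nn_integral_add nn_integral_cmult)
  finally show ?thesis .
qed

lemma sq_norm_add_le2:
  assumes "f \<in> borel_measurable M" "g \<in> borel_measurable M"
  shows "sq_norm M (\<lambda>x. f x + g x) \<le> 2 * sq_norm M f + 2 * sq_norm M g"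
  using sq_norm_add_le[OF assms, of 1] by simp

lemma sq_norm_diff_le2:
  assumes "f \<in> borel_measurable M" "g \<in> borel_measurable M"
  shows "sq_norm M (\<lambda>x. f x - g x) \<le> 2 * sq_norm M f + 2 * sq_norm M g"
  using sq_norm_add_le2[of f M "\<lambda>x. - g x"] assms by (simp add: sq_norm_uminus)

lemma two_quarters_le:
  assumes "x \<le> ennreal (e/4)" "y \<le> ennreal (e/4)" "0 \<le> e"
  shows "2 * x + 2 * y \<le> ennreal e"
proof -
  have "2 * x + 2 * y \<le> ennreal 2 * ennreal (e/4) + ennreal 2 * ennreal (e/4)"
    using assms by (intro add_mono mult_mono) auto
  also have "\<dots> = ennreal e"
    using assms(3) by (simp only: ennreal_mult[symmetric] ennreal_plus[symmetric]) (simp flip: ennreal_mult ennreal_plus)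
  finally show ?thesis .
qed

lemma sq_int_add: "f \<in> sq_int M \<Longrightarrow> g \<in> sq_int M \<Longrightarrow> (\<lambda>x. f x + g x) \<in> sq_int M"
  using sq_norm_add_le2[of f M g] unfolding sq_int_def
  by (auto simp: ennreal_mult_less_top ennreal_add_eq_top less_top[symmetric] top_unique ennreal_mult_eq_top_iff)

lemma sq_int_uminus: "f \<in> sq_int M \<Longrightarrow> (\<lambda>x. - f x) \<in> sq_int M"
  unfolding sq_int_def by (auto simp: sq_norm_uminus)

lemma sq_int_diff: "f \<in> sq_int M \<Longrightarrow> g \<in> sq_int M \<Longrightarrow> (\<lambda>x. f x - g x) \<in> sq_int M"
  using sq_int_add[OF _ sq_int_uminus, of f M g] by simp

lemma borel_measurable_cnj[measurable (raw)]:
  "f \<in> borel_measurable M \<Longrightarrow> (\<lambda>x. cnj (f x)) \<in> borel_measurable M"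
  by (rule borel_measurable_continuous_on[of cnj]) (auto intro: continuous_intros)

lemma sq_int_cnj: "f \<in> sq_int M \<Longrightarrow> (\<lambda>x. cnj (f x)) \<in> sq_int M"
  unfolding sq_int_def by (auto simp: sq_norm_cnj)

lemma sq_int_cmult: "f \<in> sq_int M \<Longrightarrow> (\<lambda>x. c * f x) \<in> sq_int M"
  unfolding sq_int_def by (auto simp: sq_norm_scale ennreal_mult_less_top)

lemma sq_int_bounded_mult:
  assumes f: "f \<in> sq_int M" and m[measurable]: "m \<in> borel_measurable M" and b: "AE x in M. cmod (m x) \<le> B"
  shows "(\<lambda>x. m x * f x) \<in> sq_int M"
proof -
  note f[measurable]
  have "sq_norm M (\<lambda>x. m x * f x) \<le> sq_norm M (\<lambda>x. complex_of_real \<bar>B\<bar> * f x)"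
    by (rule sq_norm_mono_AE, use b in eventually_elim) (auto simp: norm_mult intro!: mult_right_mono)
  also have "\<dots> < \<infinity>" using sq_int_fin[OF f] by (simp add: sq_norm_scale ennreal_mult_less_top)
  finally show ?thesis by (simp add: sq_int_def)
qed

lemma sq_int_mult_integrable:
  assumes f: "f \<in> sq_int M" and g: "g \<in> sq_int M"
  shows "integrable M (\<lambda>x. f x * g x)"
proof -
  note f[measurable] g[measurable]
  have "(\<integral>\<^sup>+x. ennreal (norm (f x * g x)) \<partial>M) \<le> (\<integral>\<^sup>+x. ennreal ((cmod (f x))\<^sup>2) + ennreal ((cmod (g x))\<^sup>2) \<partial>M)"
  proof (intro nn_integral_mono)
    fix x
    have "0 \<le> (cmod (f x) - cmod (g x))\<^sup>2" by simp
    then have "2 * (cmod (f x) * cmod (g x)) \<le> (cmod (f x))\<^sup>2 + (cmod (g x))\<^sup>2"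
      by (simp add: power2_diff)
    moreover have "0 \<le> cmod (f x) * cmod (g x)" by simp
    ultimately have "cmod (f x) * cmod (g x) \<le> (cmod (f x))\<^sup>2 + (cmod (g x))\<^sup>2" by linarith
    then show "ennreal (norm (f x * g x)) \<le> ennreal ((cmod (f x))\<^sup>2) + ennreal ((cmod (g x))\<^sup>2)"
      by (simp add: norm_mult ennreal_plus[symmetric] del: ennreal_plus)
  qed
  also have "\<dots> = sq_norm M f + sq_norm M g" by (simp add: nn_integral_add sq_norm_def)
  also have "\<dots> < \<infinity>" using sq_int_fin[OF f] sq_int_fin[OF g] by (simp add: less_top)
  finally show ?thesis by (simp add: integrable_iff_bounded)
qed

lemma sq_int_Cauchy_Schwarz:
  assumes f: "f \<in> sq_int M" and g: "g \<in> sq_int M"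
  shows "ennreal ((cmod (\<integral>x. f x * g x \<partial>M))\<^sup>2) \<le> sq_norm M f * sq_norm M g"
proof -
  note f[measurable] g[measurable]
  have "ennreal (cmod (\<integral>x. f x * g x \<partial>M)) \<le> (\<integral>\<^sup>+x. ennreal (norm (f x * g x)) \<partial>M)"
    by (rule integral_norm_bound_ennreal[OF sq_int_mult_integrable[OF f g]])
  also have "\<dots> = (\<integral>\<^sup>+x. ennreal (cmod (f x)) * ennreal (cmod (g x)) \<partial>M)"
    by (simp add: norm_mult ennreal_mult)
  finally have "(ennreal (cmod (\<integral>x. f x * g x \<partial>M)))\<^sup>2 \<le> (\<integral>\<^sup>+x. ennreal (cmod (f x)) * ennreal (cmod (g x)) \<partial>M)\<^sup>2"
    by (intro power_mono) auto
  also have "\<dots> \<le> (\<integral>\<^sup>+x. (ennreal (cmod (f x)))\<^sup>2 \<partial>M) * (\<integral>\<^sup>+x. (ennreal (cmod (g x)))\<^sup>2 \<partial>M)"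
    by (rule Cauchy_Schwarz_nn_integral) auto
  finally show ?thesis by (simp add: sq_norm_def ennreal_power)
qed

lemma sq_norm_eq_0D:
  assumes [measurable]: "f \<in> borel_measurable M" and "sq_norm M f = 0"
  shows "AE x in M. f x = 0"
proof -
  have "AE x in M. ennreal ((cmod (f x))\<^sup>2) = 0"
    using assms(2) unfolding sq_norm_def by (subst (asm) nn_integral_0_iff_AE) auto
  then show ?thesis by eventually_elim (auto simp: ennreal_eq_0_iff)
qed

lemma sq_int_integral_self:
  assumes f: "f \<in> sq_int M"
  shows "(\<integral>x. f x * cnj (f x) \<partial>M) = of_real (enn2real (sq_norm M f))"
proof -
  note f[measurable]
  have "(\<integral>x. f x * cnj (f x) \<partial>M) = (\<integral>x. complex_of_real ((cmod (f x))\<^sup>2) \<partial>M)"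
    by (simp only: complex_norm_square)
  also have "\<dots> = of_real (\<integral>x. (cmod (f x))\<^sup>2 \<partial>M)" by (rule integral_complex_of_real)
  also have "(\<integral>x. (cmod (f x))\<^sup>2 \<partial>M) = enn2real (sq_norm M f)"
    unfolding sq_norm_def by (rule integral_eq_nn_integral) auto
  finally show ?thesis .
qed

section \<open>Convergence and completeness in L^2\<close>

lemma sq_norm_tendsto_0_diff:
  assumes u: "\<And>n. u n \<in> sq_int M" and v: "\<And>n. v n \<in> sq_int M" and f: "f \<in> sq_int M" and g: "g \<in> sq_int M"
    and "(\<lambda>n. sq_norm M (\<lambda>x. u n x - f x)) \<longlonglongrightarrow> 0" "(\<lambda>n. sq_norm M (\<lambda>x. v n x - g x)) \<longlonglongrightarrow> 0"
  shows "(\<lambda>n. sq_norm M (\<lambda>x. (u n x - v n x) - (f x - g x))) \<longlonglongrightarrow> 0"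
proof (rule tendsto_sandwich[OF _ _ tendsto_const])
  have "sq_norm M (\<lambda>x. (u n x - v n x) - (f x - g x)) \<le> 2 * sq_norm M (\<lambda>x. u n x - f x) + 2 * sq_norm M (\<lambda>x. v n x - g x)" for n
    using sq_norm_diff_le2[OF sq_intD[OF sq_int_diff[OF u[of n] f]] sq_intD[OF sq_int_diff[OF v[of n] g]]]
    by (simp add: algebra_simps)
  then show "\<forall>\<^sub>F n in sequentially. sq_norm M (\<lambda>x. (u n x - v n x) - (f x - g x)) \<le> 2 * sq_norm M (\<lambda>x. u n x - f x) + 2 * sq_norm M (\<lambda>x. v n x - g x)"
    by simp
  have "(\<lambda>n. 2 * sq_norm M (\<lambda>x. u n x - f x) + 2 * sq_norm M (\<lambda>x. v n x - g x)) \<longlonglongrightarrow> 2 * 0 + 2 * 0"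
    by (intro tendsto_add ennreal_tendsto_cmult assms) auto
  then show "(\<lambda>n. 2 * sq_norm M (\<lambda>x. u n x - f x) + 2 * sq_norm M (\<lambda>x. v n x - g x)) \<longlonglongrightarrow> 0" by simp
qed simp

text \<open>In u v - f g = (u - f) v + (v - g) f each product pairs a factor that tends to 0 with
  one that stays bounded, so Cauchy-Schwarz applies.\<close>

lemma integral_mult_tendsto:
  assumes u: "\<And>n. u n \<in> sq_int M" and v: "\<And>n. v n \<in> sq_int M" and f: "f \<in> sq_int M" and g: "g \<in> sq_int M"
    and uf: "(\<lambda>n. sq_norm M (\<lambda>x. u n x - f x)) \<longlonglongrightarrow> 0" and vg: "(\<lambda>n. sq_norm M (\<lambda>x. v n x - g x)) \<longlonglongrightarrow> 0"
  shows "(\<lambda>n. \<integral>x. u n x * v n x \<partial>M) \<longlonglongrightarrow> (\<integral>x. f x * g x \<partial>M)"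
proof -
  note [simp] = sq_int_diff u v f g
  have z: "(\<lambda>n. \<integral>x. p n x * q n x \<partial>M) \<longlonglongrightarrow> 0"
    if p: "\<And>n. p n \<in> sq_int M" and q: "\<And>n. q n \<in> sq_int M" 
     and p0: "(\<lambda>n. sq_norm M (p n)) \<longlonglongrightarrow> 0" and qK: "\<forall>\<^sub>F n in sequentially. sq_norm M (q n) \<le> K" and K: "K < \<infinity>" for p q K
  proof -
    have "(\<lambda>n. ennreal ((cmod (\<integral>x. p n x * q n x \<partial>M))\<^sup>2)) \<longlonglongrightarrow> ennreal 0"
    proof (rule tendsto_sandwich[OF _ _ tendsto_const])
      show "\<forall>\<^sub>F n in sequentially. ennreal ((cmod (\<integral>x. p n x * q n x \<partial>M))\<^sup>2) \<le> K * sq_norm M (p n)"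
        using qK
      proof eventually_elim
        case (elim n)
        have "ennreal ((cmod (\<integral>x. p n x * q n x \<partial>M))\<^sup>2) \<le> sq_norm M (p n) * sq_norm M (q n)"
          by (rule sq_int_Cauchy_Schwarz[OF p q])
        also have "\<dots> \<le> K * sq_norm M (p n)" using elim by (subst mult.commute) (intro mult_right_mono, auto)
        finally show ?case .
      qed
      have "(\<lambda>n. K * sq_norm M (p n)) \<longlonglongrightarrow> K * 0" by (intro ennreal_tendsto_cmult p0 ) (use K in auto)
      then show "(\<lambda>n. K * sq_norm M (p n)) \<longlonglongrightarrow> ennreal 0" by simp
    qed simp
    then have "(\<lambda>n. (cmod (\<integral>x. p n x * q n x \<partial>M))\<^sup>2) \<longlonglongrightarrow> 0"
      by (subst (asm) tendsto_ennreal_iff) auto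
    then have "(\<lambda>n. sqrt ((cmod (\<integral>x. p n x * q n x \<partial>M))\<^sup>2)) \<longlonglongrightarrow> sqrt 0" by (rule tendsto_real_sqrt)
    then show ?thesis by (simp add: tendsto_norm_zero_iff)
  qed
  have ev: "\<forall>\<^sub>F n in sequentially. sq_norm M (v n) \<le> 2 * 1 + 2 * sq_norm M g"
  proof -
    have "\<forall>\<^sub>F n in sequentially. sq_norm M (\<lambda>x. v n x - g x) < 1" using vg by (rule order_tendstoD) simp
    then show ?thesis
    proof eventually_elim
      case (elim n)
      have "sq_norm M (v n) \<le> 2 * sq_norm M (\<lambda>x. v n x - g x) + 2 * sq_norm M g"
        using sq_norm_add_le2[of "\<lambda>x. v n x - g x" M g] by (simp add: sq_intD)
      also have "\<dots> \<le> 2 * 1 + 2 * sq_norm M g" using elim by (intro add_mono mult_left_mono) auto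
      finally show ?case .
    qed
  qed
  have 1: "(\<lambda>n. \<integral>x. (u n x - f x) * v n x \<partial>M) \<longlonglongrightarrow> 0"
    by (rule z[OF _ _ uf ev]) (use sq_int_fin[OF g] in \<open>auto simp: ennreal_mult_less_top\<close>)
  have 2: "(\<lambda>n. \<integral>x. (v n x - g x) * f x \<partial>M) \<longlonglongrightarrow> 0"
    by (rule z[OF _ _ vg, of _ "sq_norm M f"]) (use sq_int_fin[OF f] in auto)
  have "(\<integral>x. u n x * v n x \<partial>M) = (\<integral>x. (u n x - f x) * v n x \<partial>M) + (\<integral>x. (v n x - g x) * f x \<partial>M) + (\<integral>x. f x * g x \<partial>M)" for n
  proof -
    have "(\<integral>x. (u n x - f x) * v n x \<partial>M) + (\<integral>x. (v n x - g x) * f x \<partial>M) + (\<integral>x. f x * g x \<partial>M)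
      = (\<integral>x. ((u n x - f x) * v n x + (v n x - g x) * f x) + f x * g x \<partial>M)"
      by (simp add: sq_int_mult_integrable)
    then show ?thesis by (simp add: algebra_simps)
  qed
  then show ?thesis using tendsto_add[OF tendsto_add[OF 1 2] tendsto_const[of "\<integral>x. f x * g x \<partial>M"]] by simp
qed

text \<open>The squared norm is the pairing of a function with its conjugate, so this is a case of
  the convergence of pairings.\<close>

lemma sq_norm_tendsto:
  assumes u: "\<And>n. u n \<in> sq_int M" and f: "f \<in> sq_int M"
    and uf: "(\<lambda>n. sq_norm M (\<lambda>x. u n x - f x)) \<longlonglongrightarrow> 0"
  shows "(\<lambda>n. sq_norm M (u n)) \<longlonglongrightarrow> sq_norm M f"
proof -
  have c: "(\<lambda>n. sq_norm M (\<lambda>x. cnj (u n x) - cnj (f x))) \<longlonglongrightarrow> 0"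
    using uf by (simp add: sq_norm_def flip: complex_cnj_diff)
  have "(\<lambda>n. \<integral>x. u n x * cnj (u n x) \<partial>M) \<longlonglongrightarrow> (\<integral>x. f x * cnj (f x) \<partial>M)"
    by (rule integral_mult_tendsto[OF u sq_int_cnj[OF u] f sq_int_cnj[OF f] uf c])
  then have "(\<lambda>n. enn2real (sq_norm M (u n))) \<longlonglongrightarrow> enn2real (sq_norm M f)"
    by (simp add: sq_int_integral_self u f tendsto_of_real_iff)
  then have "(\<lambda>n. ennreal (enn2real (sq_norm M (u n)))) \<longlonglongrightarrow> ennreal (enn2real (sq_norm M f))"
    by (rule tendsto_ennrealI)
  moreover have "ennreal (enn2real (sq_norm M h)) = sq_norm M h" if "h \<in> sq_int M" for h
    using sq_int_fin[OF that] by (simp add: ennreal_enn2real)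
  ultimately show ?thesis by (simp only: u f)
qed

text \<open>Riesz-Fischer: a rapidly convergent subsequence converges almost everywhere, and Fatou's
  lemma along it bounds the distance of the full sequence to that limit.\<close>

lemma sq_int_complete:
  assumes u: "\<And>n. u n \<in> sq_int M"
    and cau: "\<And>e. e > 0 \<Longrightarrow> \<exists>N. \<forall>m\<ge>N. \<forall>n\<ge>N. sq_norm M (\<lambda>x. u m x - u n x) \<le> ennreal e"
  shows "\<exists>F\<in>sq_int M. (\<lambda>n. sq_norm M (\<lambda>x. u n x - F x)) \<longlonglongrightarrow> 0"
proof -
  note u[measurable]
  have "\<exists>r. \<forall>k. (\<forall>m\<ge>r k. \<forall>n\<ge>r k. sq_norm M (\<lambda>x. u m x - u n x) \<le> ennreal ((1/4)^k)) \<and> r (Suc k) > r k"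
  proof (intro dependent_nat_choice)
    show "\<exists>x. \<forall>m\<ge>x. \<forall>n\<ge>x. sq_norm M (\<lambda>xa. u m xa - u n xa) \<le> ennreal ((1 / 4) ^ 0)"
      by (rule cau) simp
    fix x k
    obtain N where N: "\<forall>m\<ge>N. \<forall>n\<ge>N. sq_norm M (\<lambda>x. u m x - u n x) \<le> ennreal ((1/4)^Suc k)"
      using cau[of "(1/4)^Suc k"] by auto
    show "\<exists>y. (\<forall>m\<ge>y. \<forall>n\<ge>y. sq_norm M (\<lambda>x. u m x - u n x) \<le> ennreal ((1 / 4) ^ Suc k)) \<and> x < y"
      by (rule exI[of _ "max N (Suc x)"]) (use N in auto)
  qed
  then obtain r where r: "\<And>k m n. m \<ge> r k \<Longrightarrow> n \<ge> r k \<Longrightarrow> sq_norm M (\<lambda>x. u m x - u n x) \<le> ennreal ((1/4)^k)"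
    and rS: "\<And>k. r (Suc k) > r k" by blast
  have rm: "strict_mono r" using rS by (simp add: strict_mono_Suc_iff)
  \<comment> \<open>The squared norm of \<open>D k\<close> is at most \<open>4^-k\<close>. The
    weight \<open>2^k\<close> used below leaves a convergent series, and it is what yields absolute
    convergence of the sum of the \<open>D k x\<close>.\<close>
  define D where "D k x = u (r (Suc k)) x - u (r k) x" for k x
  have [measurable]: "D k \<in> borel_measurable M" for k unfolding D_def by measurable
  have "(\<integral>\<^sup>+x. (\<Sum>k. ennreal (2^k * (cmod (D k x))\<^sup>2)) \<partial>M) = (\<Sum>k. \<integral>\<^sup>+x. ennreal (2^k * (cmod (D k x))\<^sup>2) \<partial>M)"
    by (rule nn_integral_suminf) auto
  also have "\<dots> \<le> (\<Sum>k. ennreal ((1/2)^k))"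
  proof (rule suminf_le)
    fix k
    have "(\<integral>\<^sup>+x. ennreal (2^k * (cmod (D k x))\<^sup>2) \<partial>M) = ennreal (2^k) * sq_norm M (D k)"
      by (simp add: ennreal_mult sq_norm_def nn_integral_cmult)
    also have "\<dots> \<le> ennreal (2^k) * ennreal ((1/4)^k)"
      unfolding D_def using r[of k "r (Suc k)" "r k"] rS[of k] by (intro mult_left_mono) auto
    also have "\<dots> = ennreal ((1/2)^k)" by (simp add: ennreal_mult[symmetric] power_mult_distrib[symmetric])
    finally show "(\<integral>\<^sup>+x. ennreal (2^k * (cmod (D k x))\<^sup>2) \<partial>M) \<le> ennreal ((1/2)^k)" .
  qed auto
  also have "\<dots> = ennreal (\<Sum>k. (1/2)^k)" by (rule suminf_ennreal2) auto
  finally have "(\<integral>\<^sup>+x. (\<Sum>k. ennreal (2^k * (cmod (D k x))\<^sup>2)) \<partial>M) \<noteq> \<infinity>" by (auto simp: top_unique)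
  then have "AE x in M. (\<Sum>k. ennreal (2^k * (cmod (D k x))\<^sup>2)) \<noteq> \<infinity>"
    by (rule nn_integral_noteq_infinite[rotated]) auto
  then have ae: "AE x in M. convergent (\<lambda>k. u (r k) x)"
  proof eventually_elim
    case (elim x)
    have s1: "summable (\<lambda>k. 2^k * (cmod (D k x))\<^sup>2)"
      by (rule summable_suminf_not_top) (use elim in auto)
    have "summable (\<lambda>k. D k x)"
    proof (rule summable_comparison_test')
      show "summable (\<lambda>k. 2^k * (cmod (D k x))\<^sup>2 + (1/2)^k)"
        by (intro summable_add s1 summable_geometric) auto
      fix k :: nat
      \<comment> \<open>Either |D| \<le> 2^-k, or 1 \<le> 2^k |D| and multiplication by |D| gives
        the other term.\<close>
      show "norm (D k x) \<le> 2^k * (cmod (D k x))\<^sup>2 + (1/2)^k"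
      proof (cases "cmod (D k x) \<le> (1/2)^k")
        case False
        then have "1 \<le> 2^k * cmod (D k x)" by (simp add: power_divide field_simps)
        then have "cmod (D k x) * 1 \<le> cmod (D k x) * (2^k * cmod (D k x))" by (intro mult_left_mono) auto
        then have "cmod (D k x) \<le> 2^k * (cmod (D k x))\<^sup>2" by (simp add: power2_eq_square mult_ac)
        then show ?thesis by (simp add: add_increasing2)
      qed (simp add: add_increasing)
    qed
    then have "convergent (\<lambda>n. \<Sum>k<n. D k x)" by (simp add: summable_iff_convergent)
    moreover have "(\<Sum>k<n. D k x) = u (r n) x - u (r 0) x" for n
      unfolding D_def by (rule sum_lessThan_telescope)
    ultimately have "convergent (\<lambda>n. u (r n) x - u (r 0) x)" by simp
    then have "convergent (\<lambda>n. (u (r n) x - u (r 0) x) + u (r 0) x)" by (intro convergent_add convergent_const)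
    then show ?case by simp
  qed
  define F where "F x = lim (\<lambda>k. u (r k) x)" for x
  have [measurable]: "F \<in> borel_measurable M" unfolding F_def by measurable
  have lim: "AE x in M. (\<lambda>k. u (r k) x) \<longlonglongrightarrow> F x"
    using ae by eventually_elim (simp add: F_def convergent_LIMSEQ_iff)
  have bd: "sq_norm M (\<lambda>x. u n x - F x) \<le> ennreal ((1/4)^K)" if n: "n \<ge> r K" for n K
  proof -
    have "sq_norm M (\<lambda>x. u n x - F x) \<le> (\<integral>\<^sup>+x. liminf (\<lambda>k. ennreal ((cmod (u n x - u (r k) x))\<^sup>2)) \<partial>M)"
      unfolding sq_norm_def
    proof (rule nn_integral_mono_AE, use lim in eventually_elim)
      case (elim x)
      have "(\<lambda>k. ennreal ((cmod (u n x - u (r k) x))\<^sup>2)) \<longlonglongrightarrow> ennreal ((cmod (u n x - F x))\<^sup>2)"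
        by (intro tendsto_ennrealI tendsto_power tendsto_norm tendsto_diff tendsto_const elim)
      from lim_imp_Liminf[OF sequentially_bot this] show ?case by simp
    qed
    also have "\<dots> \<le> liminf (\<lambda>k. sq_norm M (\<lambda>x. u n x - u (r k) x))"
      unfolding sq_norm_def by (rule nn_integral_liminf) auto
    also have "\<dots> \<le> ennreal ((1/4)^K)"
    proof -
      have "\<forall>\<^sub>F k in sequentially. sq_norm M (\<lambda>x. u n x - u (r k) x) \<le> ennreal ((1/4)^K)"
        using eventually_ge_at_top[of K]
        by eventually_elim (use r n strict_mono_less_eq[OF rm] in auto)
      then have "liminf (\<lambda>k. sq_norm M (\<lambda>x. u n x - u (r k) x)) \<le> liminf (\<lambda>k::nat. ennreal ((1/4)^K))"
        by (rule Liminf_mono)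
      then show ?thesis by (simp add: Liminf_const)
    qed
    finally show ?thesis .
  qed
  have F: "F \<in> sq_int M"
  proof -
    have "sq_norm M (\<lambda>x. u (r 0) x - F x) < \<infinity>" using bd[of 0 "r 0"] by (auto simp: less_top[symmetric] top_unique)
    then have "(\<lambda>x. u (r 0) x - F x) \<in> sq_int M" by (simp add: sq_int_def)
    from sq_int_diff[OF u[of "r 0"] this] show ?thesis by simp
  qed
  moreover have "(\<lambda>n. sq_norm M (\<lambda>x. u n x - F x)) \<longlonglongrightarrow> 0"
  proof (rule order_tendstoI)
    fix e :: ennreal assume e: "e > 0"
    have "(\<lambda>K. ennreal ((1/4)^K)) \<longlonglongrightarrow> ennreal 0" by (intro tendsto_ennrealI LIMSEQ_power_zero) auto
    then have "\<forall>\<^sub>F K in sequentially. ennreal ((1/4)^K) < e" by (rule order_tendstoD) (use e in simp)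
    then obtain K where K: "ennreal ((1/4)^K) < e" by (auto simp: eventually_sequentially)
    show "\<forall>\<^sub>F n in sequentially. sq_norm M (\<lambda>x. u n x - F x) < e"
      using eventually_ge_at_top[of "r K"] by eventually_elim (use bd K in \<open>auto intro: le_less_trans\<close>)
  qed simp
  ultimately show ?thesis by blast
qed

text \<open>Cutting off to sets of finite measure works because their indicators are square
  integrable, and a product of two square integrable functions is integrable.\<close>

lemma (in sigma_finite_measure) sq_int_dense_integrable:
  assumes f: "f \<in> sq_int M"
  shows "\<exists>u. (\<forall>n. u n \<in> sq_int M \<and> integrable M (u n)) \<and> (\<lambda>n. sq_norm M (\<lambda>x. u n x - f x)) \<longlonglongrightarrow> 0"
proof -
  note f[measurable]
  obtain A :: "nat \<Rightarrow> 'a set" where A: "range A \<subseteq> sets M" "(\<Union>i. A i) = space M" "\<And>i. emeasure M (A i) \<noteq> \<infinity>" "incseq A"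
    using sigma_finite_incseq by blast
  have [measurable]: "A i \<in> sets M" for i using A(1) by auto
  define u where "u n x = indicator (A n) x * f x" for n x
  have [measurable]: "u n \<in> borel_measurable M" for n unfolding u_def by measurable
  have i: "(indicator (A n) :: _ \<Rightarrow> complex) \<in> sq_int M" for n
  proof -
    have "sq_norm M (indicator (A n)) = (\<integral>\<^sup>+x. indicator (A n) x \<partial>M)"
      unfolding sq_norm_def by (intro nn_integral_cong) (auto simp: indicator_def)
    then show ?thesis using A(3)[of n] by (simp add: sq_int_def less_top)
  qed
  have u: "u n \<in> sq_int M" for n unfolding u_def
    by (rule sq_int_bounded_mult[OF f, of _ 1]) (auto simp: indicator_def)
  have ui: "integrable M (u n)" for n unfolding u_def by (rule sq_int_mult_integrable[OF i f])
  have "(\<lambda>n. \<integral>\<^sup>+x. ennreal ((cmod (u n x - f x))\<^sup>2) \<partial>M) \<longlonglongrightarrow> (\<integral>\<^sup>+x. 0 \<partial>M)"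
  proof (rule nn_integral_dominated_convergence[where w="\<lambda>x. ennreal ((cmod (f x))\<^sup>2)"])
    show "(\<integral>\<^sup>+x. ennreal ((cmod (f x))\<^sup>2) \<partial>M) < \<infinity>" using sq_int_fin[OF f] by (simp add: sq_norm_def)
    show "AE x in M. (\<lambda>n. ennreal ((cmod (u n x - f x))\<^sup>2)) \<longlonglongrightarrow> 0"
    proof (rule AE_I2)
      fix x assume "x \<in> space M"
      then obtain N where N: "x \<in> A N" using A(2) by auto
      show "(\<lambda>n. ennreal ((cmod (u n x - f x))\<^sup>2)) \<longlonglongrightarrow> 0"
        by (rule tendsto_eventually, rule eventually_sequentiallyI[of N])
           (use N incseqD[OF A(4)] in \<open>auto simp: u_def indicator_def\<close>)
    qed
    show "AE x in M. ennreal ((cmod (u n x - f x))\<^sup>2) \<le> ennreal ((cmod (f x))\<^sup>2)" for n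
      by (auto simp: u_def indicator_def)
  qed auto
  then have "(\<lambda>n. sq_norm M (\<lambda>x. u n x - f x)) \<longlonglongrightarrow> 0" by (simp add: sq_norm_def)
  then show ?thesis using u ui by blast
qed

section \<open>The Plancherel theorem on the real line\<close>

definition character :: "real \<Rightarrow> complex" where
  "character t = exp (- 2 * of_real pi * \<i> * of_real t)"

lemma norm_character[simp]: "cmod (character t) = 1"
  by (simp add: character_def norm_exp_eq_Re)

lemma character_add: "character (s + t) = character s * character t"
  by (simp add: character_def exp_add[symmetric] algebra_simps)

lemma character_0[simp]: "character 0 = 1"
  by (simp add: character_def)

lemma cnj_character: "cnj (character t) = character (- t)"
  by (simp add: character_def exp_cnj)

lemma continuous_on_character[continuous_intros]: "continuous_on S f \<Longrightarrow> continuous_on S (\<lambda>x. character (f x))"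
  unfolding character_def by (intro continuous_intros)

lemma measurable_character[measurable]: "character \<in> borel_measurable borel"
  by (intro borel_measurable_continuous_onI continuous_intros)

lemma character_iexp: "character t = iexp (- 2 * pi * t)"
  by (simp add: character_def mult_ac)

lemma integrable_bounded_mult:
  fixes f g :: "'a \<Rightarrow> complex"
  assumes "integrable M f" "g \<in> borel_measurable M" "\<And>x. cmod (g x) \<le> B"
  shows "integrable M (\<lambda>x. f x * g x)"
proof (rule Bochner_Integration.integrable_bound[of M "\<lambda>x. of_real B * f x"])
  show "AE x in M. norm (f x * g x) \<le> norm (complex_of_real B * f x)"
  proof (rule AE_I2)
    fix x
    have "cmod (g x) \<le> \<bar>B\<bar>" using assms(3)[of x] by linarith
    then show "norm (f x * g x) \<le> norm (complex_of_real B * f x)"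
      by (simp add: norm_mult mult_left_mono mult.commute[of "\<bar>B\<bar>"])
  qed
qed (use assms in auto)

text \<open>If \<open>f\<close> is not integrable, its Bochner integral is 0 by convention and the
  bound is trivial.\<close>

lemma norm_integral_le_nn_integral:
  fixes f :: "'a \<Rightarrow> 'b :: {banach, second_countable_topology}"
  shows "ennreal (norm (\<integral>x. f x \<partial>M)) \<le> (\<integral>\<^sup>+x. ennreal (norm (f x)) \<partial>M)"
  by (cases "integrable M f") (auto intro: integral_norm_bound_ennreal simp: not_integrable_integral_eq)

section \<open>Gaussian regularisation on the line\<close>

definition gauss :: "real \<Rightarrow> real \<Rightarrow> real" where
  "gauss \<delta> \<xi> = exp (- (2 * pi * \<delta> * \<xi>)\<^sup>2 / 2)"

lemma gauss_measurable[measurable]: "gauss \<delta> \<in> borel_measurable borel"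
  unfolding gauss_def by measurable

lemma gauss_bounds: "0 \<le> gauss \<delta> \<xi>" "gauss \<delta> \<xi> \<le> 1"
  by (auto simp: gauss_def)

lemma gauss_std: "\<delta> > 0 \<Longrightarrow> gauss \<delta> \<xi> = sqrt (2 * pi) * std_normal_density (2 * pi * \<delta> * \<xi>)"
  by (simp add: gauss_def std_normal_density_def)

lemma gauss_integrable: assumes d: "\<delta> > 0" shows "integrable lborel (gauss \<delta>)"
proof -
  have "integrable lborel (\<lambda>x. std_normal_density (0 + (2 * pi * \<delta>) * x))"
    by (rule lborel_integrable_real_affine) (use d in auto)
  then have "integrable lborel (\<lambda>x. sqrt (2 * pi) * std_normal_density (2 * pi * \<delta> * x))" by simp
  then show ?thesis using gauss_std[OF d] by (simp cong: Bochner_Integration.integrable_cong)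
qed

text \<open>The factor \<open>2 * pi * \<delta>\<close> in \<open>gauss\<close> is made for this:
  the substitution \<open>s = 2 * pi * \<delta> * \<xi>\<close> produces the characteristic function
  of the standard normal law at \<open>- z / \<delta>\<close>, and the transform is exactly a
  probability density of standard deviation \<delta>, an approximate identity as \<delta> tends to
  0.\<close>

lemma gauss_fourier:
  assumes d: "\<delta> > 0"
  shows "(\<integral>\<xi>. of_real (gauss \<delta> \<xi>) * character (z * \<xi>) \<partial>lborel) = of_real (normal_density 0 \<delta> z)"
proof -
  define f where "f s = std_normal_density s *\<^sub>R iexp (- z / \<delta> * s)" for s
  have "(\<integral>s. f s \<partial>lborel) = char std_normal_distribution (- z / \<delta>)"
    unfolding char_def f_def
    by (subst integral_density) auto
  also have "\<dots> = of_real (exp (- (z / \<delta>)\<^sup>2 / 2))"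
    by (simp add: char_std_normal_distribution power2_eq_square)
  finally have 1: "(\<integral>s. f s \<partial>lborel) = of_real (exp (- (z / \<delta>)\<^sup>2 / 2))" .
  have 2: "(\<integral>s. f s \<partial>lborel) = \<bar>2 * pi * \<delta>\<bar> *\<^sub>R (\<integral>s. f (0 + (2 * pi * \<delta>) * s) \<partial>lborel)"
    by (rule lborel_integral_real_affine) (use d in auto)
  have 3: "of_real (gauss \<delta> \<xi>) * character (z * \<xi>) = of_real (sqrt (2 * pi)) * f (0 + (2 * pi * \<delta>) * \<xi>)" for \<xi>
    using d by (simp add: f_def gauss_std character_iexp scaleR_conv_of_real mult_ac)
  have "(\<integral>\<xi>. of_real (gauss \<delta> \<xi>) * character (z * \<xi>) \<partial>lborel) = of_real (sqrt (2 * pi)) * (\<integral>s. f (0 + (2 * pi * \<delta>) * s) \<partial>lborel)"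
    unfolding 3 by simp
  also have "(\<integral>s. f (0 + (2 * pi * \<delta>) * s) \<partial>lborel) = of_real (exp (- (z / \<delta>)\<^sup>2 / 2) / (2 * pi * \<delta>))"
    using 1 2 d by (simp add: scaleR_conv_of_real field_simps)
  also have "of_real (sqrt (2 * pi)) * \<dots> = of_real (sqrt (2 * pi) * (exp (- (z / \<delta>)\<^sup>2 / 2) / (2 * pi * \<delta>)))"
    by (simp only: of_real_mult)
  also have "sqrt (2 * pi) * (exp (- (z / \<delta>)\<^sup>2 / 2) / (2 * pi * \<delta>)) = normal_density 0 \<delta> z"
  proof -
    have "sqrt (2 * pi) * sqrt (2 * pi) = 2 * pi" by simp
    then have *: "2 * pi * \<delta> = sqrt (2 * pi) * (sqrt (2 * pi) * \<delta>)" by simp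
    have "sqrt (2 * pi * \<delta>\<^sup>2) = sqrt (2 * pi) * \<delta>" using d by (simp add: real_sqrt_mult)
    moreover have "- (z / \<delta>)\<^sup>2 / 2 = - z\<^sup>2 / (2 * \<delta>\<^sup>2)" by (simp add: power_divide)
    ultimately show ?thesis unfolding normal_density_def * using d by simp
  qed
  finally show ?thesis .
qed

definition fourier1 :: "(real \<Rightarrow> complex) \<Rightarrow> real \<Rightarrow> complex" where
  "fourier1 u \<xi> = (\<integral>x. u x * character (x * \<xi>) \<partial>lborel)"

lemma fourier1_measurable[measurable]:
  assumes [measurable]: "u \<in> borel_measurable lborel"
  shows "fourier1 u \<in> borel_measurable borel"
  unfolding fourier1_def[abs_def] by measurable

lemma fourier1_bound: "cmod (fourier1 u \<xi>) \<le> (\<integral>x. cmod (u x) \<partial>lborel)"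
  unfolding fourier1_def by (rule order_trans[OF integral_norm_bound]) (simp add: norm_mult)

lemma integrable_character: "integrable lborel u \<Longrightarrow> integrable lborel (\<lambda>x. u x * character (x * \<xi>))"
  by (rule integrable_bounded_mult[where B=1]) auto

lemma fourier1_diff: "integrable lborel u \<Longrightarrow> integrable lborel v \<Longrightarrow> fourier1 (\<lambda>x. u x - v x) \<xi> = fourier1 u \<xi> - fourier1 v \<xi>"
  unfolding fourier1_def
  by (subst Bochner_Integration.integral_diff[symmetric]) (auto intro!: integrable_character simp: algebra_simps)

text \<open>Domination by a tensor product of integrable functions justifies the exchanges of
  integrals in \<open>fourier1_gauss_identity\<close>.\<close>

lemma integrable_pair_bound:
  fixes F :: "real \<times> real \<Rightarrow> complex"
  assumes g: "integrable lborel g" and u: "integrable lborel u" and F: "F \<in> borel_measurable (lborel \<Otimes>\<^sub>M lborel)"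
    and b: "\<And>x y. cmod (F (x, y)) \<le> cmod (g x) * cmod (u y :: complex)"
  shows "integrable (lborel \<Otimes>\<^sub>M lborel) F"
proof (rule Bochner_Integration.integrable_bound[of _ "\<lambda>(x,y). g x * u y"])
  have [measurable]: "g \<in> borel_measurable borel" "u \<in> borel_measurable borel" using g u by auto
  show "integrable (lborel \<Otimes>\<^sub>M lborel) (\<lambda>(x, y). g x * u y)"
  proof (rule lborel_pair.Fubini_integrable)
    show "integrable lborel (\<lambda>x. \<integral>y. norm (case (x, y) of (x, y) \<Rightarrow> g x * u y) \<partial>lborel)"
      using g u by (simp add: norm_mult integrable_norm)
    show "AE x in lborel. integrable lborel (\<lambda>y. case (x, y) of (x, y) \<Rightarrow> g x * u y)"
      using u by simp
  qed measurable
qed (use b F in \<open>auto simp: norm_mult\<close>)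

text \<open>The convolution of the conjugate of \<open>u\<close> with the centred normal density of
  standard deviation \<delta>.\<close>

abbreviation gauss_conv :: "(real \<Rightarrow> complex) \<Rightarrow> real \<Rightarrow> real \<Rightarrow> complex" where
  "gauss_conv u \<delta> x \<equiv> \<integral>y. cnj (u y) * of_real (normal_density 0 \<delta> (x - y)) \<partial>lborel"

text \<open>The Gaussian makes all integrals absolutely convergent, so the two factors
  \<open>fourier1 u\<close> can be unfolded one after the other, each with one exchange of
  integrals. The integral in \<xi> that remains is \<open>gauss_fourier\<close> at
  \<open>x - y\<close>.\<close>

lemma fourier1_gauss_identity:
  assumes u: "integrable lborel u" and d: "\<delta> > 0"
  shows "(\<integral>\<xi>. of_real (gauss \<delta> \<xi>) * (fourier1 u \<xi> * cnj (fourier1 u \<xi>)) \<partial>lborel)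
       = (\<integral>x. u x * gauss_conv u \<delta> x \<partial>lborel)"
proof -
  have um[measurable]: "u \<in> borel_measurable borel" using u by auto
  define K where "K = (\<integral>x. cmod (u x) \<partial>lborel)"
  have K: "cmod (fourier1 u \<xi>) \<le> K" for \<xi> unfolding K_def by (rule fourier1_bound)
  have gi: "integrable lborel (\<lambda>\<xi>. complex_of_real (gauss \<delta> \<xi>))" using gauss_integrable[OF d] by auto
  have cu: "integrable lborel (\<lambda>x. cnj (u x))" using u by simp
  have "(\<integral>\<xi>. of_real (gauss \<delta> \<xi>) * (fourier1 u \<xi> * cnj (fourier1 u \<xi>)) \<partial>lborel)
      = (\<integral>\<xi>. (\<integral>x. of_real (gauss \<delta> \<xi>) * cnj (fourier1 u \<xi>) * (u x * character (x * \<xi>)) \<partial>lborel) \<partial>lborel)"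
    by (subst integral_mult_right_zero) (simp add: fourier1_def mult_ac)
  also have "\<dots> = (\<integral>x. (\<integral>\<xi>. of_real (gauss \<delta> \<xi>) * cnj (fourier1 u \<xi>) * (u x * character (x * \<xi>)) \<partial>lborel) \<partial>lborel)"
  proof (rule lborel_pair.Fubini_integral)
    show "integrable (lborel \<Otimes>\<^sub>M lborel) (\<lambda>(x, y). of_real (gauss \<delta> y) * cnj (fourier1 u y) * (u x * character (x * y)))"
    proof (rule integrable_pair_bound)
      show "integrable lborel u" by fact
      show "integrable lborel (\<lambda>\<xi>. of_real K * complex_of_real (gauss \<delta> \<xi>))" using gi by simp
      fix x y
      have "cmod (of_real (gauss \<delta> y) * cnj (fourier1 u y) * (u x * character (x * y))) = cmod (fourier1 u y) * (gauss \<delta> y * cmod (u x))"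
        by (simp add: norm_mult gauss_bounds mult_ac)
      also have "\<dots> \<le> K * (gauss \<delta> y * cmod (u x))"
        by (intro mult_right_mono K) (simp add: gauss_bounds)
      also have "\<dots> \<le> \<bar>K\<bar> * (gauss \<delta> y * cmod (u x))"
        by (intro mult_right_mono) (auto simp add: gauss_bounds)
      finally show "cmod (case (x, y) of (x, y) \<Rightarrow> of_real (gauss \<delta> y) * cnj (fourier1 u y) * (u x * character (x * y))) \<le> cmod (u x) * cmod (of_real K * complex_of_real (gauss \<delta> y))"
        by (simp add: norm_mult gauss_bounds mult_ac)
    qed measurable
  qed
  also have "\<dots> = (\<integral>x. u x * gauss_conv u \<delta> x \<partial>lborel)"
  proof (rule Bochner_Integration.integral_cong[OF refl])
    fix x
    have "(\<integral>\<xi>. of_real (gauss \<delta> \<xi>) * cnj (fourier1 u \<xi>) * (u x * character (x * \<xi>)) \<partial>lborel)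
        = u x * (\<integral>\<xi>. (of_real (gauss \<delta> \<xi>) * character (x * \<xi>)) * cnj (fourier1 u \<xi>) \<partial>lborel)"
      by (subst integral_mult_right_zero[symmetric]) (simp add: mult_ac)
    also have "(\<integral>\<xi>. (of_real (gauss \<delta> \<xi>) * character (x * \<xi>)) * cnj (fourier1 u \<xi>) \<partial>lborel)
        = (\<integral>\<xi>. (\<integral>y. (of_real (gauss \<delta> \<xi>) * character (x * \<xi>)) * (cnj (u y) * character (- (y * \<xi>))) \<partial>lborel) \<partial>lborel)"
      by (subst integral_mult_right_zero)
         (simp add: fourier1_def cnj_character flip: Bochner_Integration.integral_cnj)
    also have "\<dots> = (\<integral>y. (\<integral>\<xi>. (of_real (gauss \<delta> \<xi>) * character (x * \<xi>)) * (cnj (u y) * character (- (y * \<xi>))) \<partial>lborel) \<partial>lborel)"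
    proof (rule lborel_pair.Fubini_integral, rule integrable_pair_bound[OF cu gi])
      show "cmod (case (y, \<xi>) of (y, \<xi>) \<Rightarrow> complex_of_real (gauss \<delta> \<xi>) * character (x * \<xi>) * (cnj (u y) * character (- (y * \<xi>)))) \<le> cmod (cnj (u y)) * cmod (complex_of_real (gauss \<delta> \<xi>))" for y \<xi>
        by (simp add: norm_mult)
    qed measurable
    also have "\<dots> = gauss_conv u \<delta> x"
    proof (rule Bochner_Integration.integral_cong[OF refl])
      fix y
      have "(of_real (gauss \<delta> \<xi>) * character (x * \<xi>)) * (cnj (u y) * character (- (y * \<xi>))) = cnj (u y) * (of_real (gauss \<delta> \<xi>) * character ((x - y) * \<xi>))" for \<xi>
        using character_add[of "x * \<xi>" "- (y * \<xi>)"] by (simp add: algebra_simps)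
      then show "(\<integral>\<xi>. (of_real (gauss \<delta> \<xi>) * character (x * \<xi>)) * (cnj (u y) * character (- (y * \<xi>))) \<partial>lborel) = cnj (u y) * of_real (normal_density 0 \<delta> (x - y))"
        by (simp only: integral_mult_right_zero gauss_fourier[OF d])
    qed
    finally show "(\<integral>\<xi>. of_real (gauss \<delta> \<xi>) * cnj (fourier1 u \<xi>) * (u x * character (x * \<xi>)) \<partial>lborel)
       = u x * gauss_conv u \<delta> x" .
  qed
  finally show ?thesis .
qed

lemma normal_density_shift: "normal_density 0 \<delta> (x - y) = normal_density x \<delta> y"
  by (simp add: normal_density_def power2_commute)

lemma nn_integral_normal_density: "\<delta> > 0 \<Longrightarrow> (\<integral>\<^sup>+y. ennreal (normal_density x \<delta> y) \<partial>lborel) = 1"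
  by (subst nn_integral_eq_integral) auto

text \<open>Schur's test: the kernel \<open>normal_density 0 \<delta> (x - y)\<close> has mass 1 in
  each variable, so |u x| |u y| \<le> (|u x|^2 + |u y|^2) / 2 gives the bound with constant
  1.\<close>

lemma gauss_form_le:
  assumes u: "integrable lborel u" and u2: "u \<in> sq_int lborel" and d: "\<delta> > 0"
  shows "ennreal (cmod (\<integral>x. u x * gauss_conv u \<delta> x \<partial>lborel)) \<le> sq_norm lborel u"
proof -
  have um[measurable]: "u \<in> borel_measurable borel" using u by auto
  let ?N = "normal_density 0 \<delta>"
  define a where "a x = (\<integral>\<^sup>+y. ennreal ((cmod (u x))\<^sup>2 / 2) * ennreal (?N (x - y)) \<partial>lborel)" for x
  define b where "b x = (\<integral>\<^sup>+y. ennreal ((cmod (u y))\<^sup>2 / 2) * ennreal (?N (x - y)) \<partial>lborel)" for x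
  have [measurable]: "a \<in> borel_measurable borel" "b \<in> borel_measurable borel"
    unfolding a_def b_def by measurable
  have pt: "ennreal (cmod (u x * (\<integral>y. cnj (u y) * of_real (?N (x - y)) \<partial>lborel))) \<le> a x + b x" for x
  proof -
    have "ennreal (cmod (u x * (\<integral>y. cnj (u y) * of_real (?N (x - y)) \<partial>lborel)))
       = ennreal (cmod (\<integral>y. u x * (cnj (u y) * of_real (?N (x - y))) \<partial>lborel))" by simp
    also have "\<dots> \<le> (\<integral>\<^sup>+y. ennreal (cmod (u x * (cnj (u y) * of_real (?N (x - y))))) \<partial>lborel)"
      by (rule norm_integral_le_nn_integral)

    also have "\<dots> \<le> (\<integral>\<^sup>+y. ennreal ((cmod (u x))\<^sup>2 / 2) * ennreal (?N (x - y)) + ennreal ((cmod (u y))\<^sup>2 / 2) * ennreal (?N (x - y)) \<partial>lborel)"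
    proof (intro nn_integral_mono)
      fix y
      have "0 \<le> (cmod (u x) - cmod (u y))\<^sup>2" by simp
      then have "cmod (u x) * cmod (u y) \<le> (cmod (u x))\<^sup>2 / 2 + (cmod (u y))\<^sup>2 / 2"
        by (simp add: power2_diff)
      then have "cmod (u x) * cmod (u y) * ?N (x - y) \<le> ((cmod (u x))\<^sup>2 / 2 + (cmod (u y))\<^sup>2 / 2) * ?N (x - y)"
        by (intro mult_right_mono) auto
      then show "ennreal (cmod (u x * (cnj (u y) * of_real (?N (x - y))))) \<le> ennreal ((cmod (u x))\<^sup>2 / 2) * ennreal (?N (x - y)) + ennreal ((cmod (u y))\<^sup>2 / 2) * ennreal (?N (x - y))"
        by (simp add: norm_mult ennreal_mult[symmetric] ennreal_plus[symmetric] distrib_right mult.assoc del: ennreal_plus)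
    qed
    also have "\<dots> = a x + b x" unfolding a_def b_def by (rule nn_integral_add) auto
    finally show ?thesis .
  qed
  have half: "(\<integral>\<^sup>+x. ennreal ((cmod (u x))\<^sup>2 / 2) \<partial>lborel) = ennreal (1/2) * sq_norm lborel u"
  proof -
    have "ennreal ((cmod (u x))\<^sup>2 / 2) = ennreal (1/2) * ennreal ((cmod (u x))\<^sup>2)" for x
      by (subst ennreal_mult[symmetric]) auto
    then show ?thesis unfolding sq_norm_def by (simp only:) (rule nn_integral_cmult, measurable)
  qed
  have ia: "(\<integral>\<^sup>+x. a x \<partial>lborel) = ennreal (1/2) * sq_norm lborel u"
    unfolding a_def by (simp add: nn_integral_cmult normal_density_shift nn_integral_normal_density[OF d] half)
  have "(\<integral>\<^sup>+x. b x \<partial>lborel) = (\<integral>\<^sup>+y. (\<integral>\<^sup>+x. ennreal ((cmod (u y))\<^sup>2 / 2) * ennreal (?N (x - y)) \<partial>lborel) \<partial>lborel)"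
    unfolding b_def by (rule lborel_pair.Fubini') measurable
  also have "\<dots> = ennreal (1/2) * sq_norm lborel u"
  proof -
    have "?N (x - y) = normal_density y \<delta> x" for x y by (simp add: normal_density_def)
    then show ?thesis by (simp add: nn_integral_cmult nn_integral_normal_density[OF d] half)
  qed
  finally have ib: "(\<integral>\<^sup>+x. b x \<partial>lborel) = ennreal (1/2) * sq_norm lborel u" .
  let ?f = "\<lambda>x. u x * (\<integral>y. cnj (u y) * of_real (?N (x - y)) \<partial>lborel)"
  have "ennreal (cmod (\<integral>x. ?f x \<partial>lborel)) \<le> (\<integral>\<^sup>+x. ennreal (cmod (?f x)) \<partial>lborel)"
    by (rule norm_integral_le_nn_integral)
  also have "\<dots> \<le> (\<integral>\<^sup>+x. a x + b x \<partial>lborel)" by (intro nn_integral_mono pt)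
  also have "\<dots> = ennreal (1/2) * sq_norm lborel u + ennreal (1/2) * sq_norm lborel u"
    by (subst nn_integral_add) (auto simp: ia ib)
  also have "\<dots> = (ennreal (1/2) + ennreal (1/2)) * sq_norm lborel u" by (simp only: distrib_right)
  also have "ennreal (1/2) + ennreal (1/2) = 1" by (subst ennreal_plus[symmetric]) auto
  finally show ?thesis by simp
qed

lemma fourier1_gauss_integral:
  assumes u: "integrable lborel u" and d: "\<delta> > 0"
  shows "(\<integral>\<^sup>+\<xi>. ennreal (gauss \<delta> \<xi> * (cmod (fourier1 u \<xi>))\<^sup>2) \<partial>lborel)
     = ennreal (cmod (\<integral>\<xi>. of_real (gauss \<delta> \<xi>) * (fourier1 u \<xi> * cnj (fourier1 u \<xi>)) \<partial>lborel))"
proof -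
  have um[measurable]: "u \<in> borel_measurable borel" using u by auto
  define K where "K = (\<integral>x. cmod (u x) \<partial>lborel)"
  have K: "cmod (fourier1 u \<xi>) \<le> K" for \<xi> unfolding K_def by (rule fourier1_bound)
  have i: "integrable lborel (\<lambda>\<xi>. gauss \<delta> \<xi> * (cmod (fourier1 u \<xi>))\<^sup>2)"
  proof (rule Bochner_Integration.integrable_bound)
    show "integrable lborel (\<lambda>\<xi>. K\<^sup>2 * gauss \<delta> \<xi>)" using gauss_integrable[OF d] by simp
    show "AE \<xi> in lborel. norm (gauss \<delta> \<xi> * (cmod (fourier1 u \<xi>))\<^sup>2) \<le> norm (K\<^sup>2 * gauss \<delta> \<xi>)"
      by (rule AE_I2) (simp add: gauss_bounds abs_mult mult.commute[of _ "gauss \<delta> _"] mult_left_mono power_mono K)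
  qed measurable
  have "(\<integral>\<xi>. of_real (gauss \<delta> \<xi>) * (fourier1 u \<xi> * cnj (fourier1 u \<xi>)) \<partial>lborel) = (\<integral>\<xi>. complex_of_real (gauss \<delta> \<xi> * (cmod (fourier1 u \<xi>))\<^sup>2) \<partial>lborel)"
    by (simp only: of_real_mult complex_norm_square)
  also have "\<dots> = of_real (\<integral>\<xi>. gauss \<delta> \<xi> * (cmod (fourier1 u \<xi>))\<^sup>2 \<partial>lborel)" by (rule integral_complex_of_real)
  finally show ?thesis
    using i by (subst nn_integral_eq_integral) (auto simp: gauss_bounds)
qed

lemma gauss_tendsto_1: "(\<lambda>n. gauss (inverse (real (Suc n))) \<xi>) \<longlonglongrightarrow> 1"
proof -
  have "(\<lambda>n. exp (- (2 * pi * inverse (real (Suc n)) * \<xi>)\<^sup>2 / 2)) \<longlonglongrightarrow> exp (- (2 * pi * 0 * \<xi>)\<^sup>2 / 2)"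
    by (intro tendsto_intros LIMSEQ_inverse_real_of_nat) auto
  then show ?thesis by (simp add: gauss_def)
qed

text \<open>Fatou's lemma as \<delta> tends to 0. It yields only an inequality; for equality the
  Gaussian form has to converge, which is shown next for bounded continuous
  \<open>u\<close>.\<close>

lemma fourier1_contraction:
  assumes u: "integrable lborel u" and u2: "u \<in> sq_int lborel"
  shows "sq_norm lborel (fourier1 u) \<le> sq_norm lborel u"
proof -
  have um[measurable]: "u \<in> borel_measurable borel" using u by auto
  let ?d = "\<lambda>n. inverse (real (Suc n))"
  have "sq_norm lborel (fourier1 u) = (\<integral>\<^sup>+\<xi>. liminf (\<lambda>n. ennreal (gauss (?d n) \<xi> * (cmod (fourier1 u \<xi>))\<^sup>2)) \<partial>lborel)"
    unfolding sq_norm_def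
  proof (rule nn_integral_cong)
    fix \<xi>
    have "(\<lambda>n. ennreal (gauss (?d n) \<xi> * (cmod (fourier1 u \<xi>))\<^sup>2)) \<longlonglongrightarrow> ennreal (1 * (cmod (fourier1 u \<xi>))\<^sup>2)"
      by (intro tendsto_ennrealI tendsto_mult gauss_tendsto_1 tendsto_const)
    from lim_imp_Liminf[OF sequentially_bot this]
    show "ennreal ((cmod (fourier1 u \<xi>))\<^sup>2) = liminf (\<lambda>n. ennreal (gauss (?d n) \<xi> * (cmod (fourier1 u \<xi>))\<^sup>2))" by simp
  qed
  also have "\<dots> \<le> liminf (\<lambda>n. \<integral>\<^sup>+\<xi>. ennreal (gauss (?d n) \<xi> * (cmod (fourier1 u \<xi>))\<^sup>2) \<partial>lborel)"
    by (rule nn_integral_liminf) measurable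
  also have "\<dots> \<le> liminf (\<lambda>n::nat. sq_norm lborel u)"
    by (intro Liminf_mono always_eventually allI)
       (simp only: fourier1_gauss_integral[OF u] fourier1_gauss_identity[OF u] gauss_form_le[OF u u2] positive_imp_inverse_positive of_nat_0_less_iff zero_less_Suc)
  finally show ?thesis by (simp add: Liminf_const)
qed

text \<open>Substituting \<open>y = x - \<delta> * s\<close> moves \<delta> from the density into
  the argument of \<open>u\<close>: an average of translates against a fixed density. Continuity
  then gives pointwise convergence and \<open>B\<close> the domination, in the inner integral and
  again in the outer one.\<close>

lemma gauss_form_tendsto:
  assumes u: "integrable lborel u" and c: "continuous_on UNIV u" and b: "\<And>x. cmod (u x) \<le> B"
  shows "(\<lambda>n. \<integral>x. u x * gauss_conv u (inverse (real (Suc n))) x \<partial>lborel)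
    \<longlonglongrightarrow> (\<integral>x. u x * cnj (u x) \<partial>lborel)"
proof -
  have um[measurable]: "u \<in> borel_measurable borel" using u by auto
  have B: "0 \<le> B" using b[of 0] norm_ge_zero order_trans by blast
  let ?d = "\<lambda>n. inverse (real (Suc n))"
  have sub: "gauss_conv u \<delta> x = (\<integral>s. cnj (u (x - \<delta> * s)) * of_real (std_normal_density s) \<partial>lborel)"
    if d: "\<delta> > 0" for x \<delta>
  proof -
    have "gauss_conv u \<delta> x
      = \<bar>-\<delta>\<bar> *\<^sub>R (\<integral>s. cnj (u (x + (-\<delta>) * s)) * of_real (normal_density 0 \<delta> (x - (x + (-\<delta>) * s))) \<partial>lborel)"
      by (rule lborel_integral_real_affine) (use d in auto)
    also have "\<dots> = (\<integral>s. \<delta> *\<^sub>R (cnj (u (x - \<delta> * s)) * of_real (normal_density 0 \<delta> (\<delta> * s))) \<partial>lborel)"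
      using d by simp
    also have "\<dots> = (\<integral>s. cnj (u (x - \<delta> * s)) * of_real (std_normal_density s) \<partial>lborel)"
    proof (rule Bochner_Integration.integral_cong[OF refl])
      fix s
      have "\<delta> * normal_density 0 \<delta> (\<delta> * s) = std_normal_density s"
        using d by (simp add: normal_density_def real_sqrt_mult power_mult_distrib)
      then have "complex_of_real \<delta> * of_real (normal_density 0 \<delta> (\<delta> * s)) = of_real (std_normal_density s)"
        by (simp only: of_real_mult[symmetric])
      then show "\<delta> *\<^sub>R (cnj (u (x - \<delta> * s)) * of_real (normal_density 0 \<delta> (\<delta> * s))) = cnj (u (x - \<delta> * s)) * of_real (std_normal_density s)"
        by (simp add: scaleR_conv_of_real mult_ac)
    qed
    finally show ?thesis .
  qed
  define G where "G n x = (\<integral>s. cnj (u (x - ?d n * s)) * of_real (std_normal_density s) \<partial>lborel)" for n x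
  have [measurable]: "G n \<in> borel_measurable borel" for n unfolding G_def[abs_def] by measurable
  have bi: "integrable lborel (\<lambda>s. B * std_normal_density s)" by simp
  have sb: "norm (cnj (u z) * of_real (std_normal_density s)) \<le> B * std_normal_density s" for z s
    by (simp add: norm_mult mult_right_mono b)
  have Gb: "cmod (G n x) \<le> B" for n x
  proof -
    have "cmod (G n x) \<le> (\<integral>s. B * std_normal_density s \<partial>lborel)"
      unfolding G_def by (rule Bochner_Integration.integral_norm_bound_integral[OF _ bi sb])
        (rule Bochner_Integration.integrable_bound[OF bi], measurable, use sb B in \<open>auto simp: abs_mult\<close>)
    then show ?thesis by simp
  qed
  have Gl: "(\<lambda>n. G n x) \<longlonglongrightarrow> cnj (u x)" for x
  proof -
    have "(\<lambda>n. G n x) \<longlonglongrightarrow> (\<integral>s. cnj (u x) * of_real (std_normal_density s) \<partial>lborel)"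
      unfolding G_def
    proof (rule integral_dominated_convergence[OF _ _ bi])
      show "AE s in lborel. (\<lambda>n. cnj (u (x - ?d n * s)) * of_real (std_normal_density s)) \<longlonglongrightarrow> cnj (u x) * of_real (std_normal_density s)"
      proof (rule AE_I2)
        fix s
        have l: "(\<lambda>n. x - ?d n * s) \<longlonglongrightarrow> x - 0 * s"
          by (intro tendsto_intros LIMSEQ_inverse_real_of_nat)
        have "isCont u x" using c by (simp add: continuous_on_eq_continuous_at)
        from isCont_tendsto_compose[OF this] l have "(\<lambda>n. u (x - ?d n * s)) \<longlonglongrightarrow> u x" by simp
        then show "(\<lambda>n. cnj (u (x - ?d n * s)) * of_real (std_normal_density s)) \<longlonglongrightarrow> cnj (u x) * of_real (std_normal_density s)"
          by (intro tendsto_intros)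
      qed
    qed (use sb in auto)
    also have "(\<integral>s. cnj (u x) * of_real (std_normal_density s) \<partial>lborel) = cnj (u x)"
      by simp
    finally show ?thesis .
  qed
  have "(\<lambda>n. \<integral>x. u x * G n x \<partial>lborel) \<longlonglongrightarrow> (\<integral>x. u x * cnj (u x) \<partial>lborel)"
  proof (rule integral_dominated_convergence[where w="\<lambda>x. B * cmod (u x)"])
    show "integrable lborel (\<lambda>x. B * cmod (u x))" using u by simp
    show "AE x in lborel. (\<lambda>n. u x * G n x) \<longlonglongrightarrow> u x * cnj (u x)"
      by (intro AE_I2 tendsto_mult tendsto_const Gl)
    show "AE x in lborel. norm (u x * G n x) \<le> B * cmod (u x)" for n
      by (simp add: norm_mult mult.commute[of B] mult_left_mono Gb)
  qed measurable
  moreover have "gauss_conv u (?d n) x = G n x" for n x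
    unfolding G_def by (rule sub) simp
  ultimately show ?thesis by simp
qed

text \<open>For the inequality opposite to the contraction: since the Gaussian is at most 1, each
  regularised integral is below the full norm of the transform, and these integrals converge to the
  norm of \<open>u\<close>.\<close>

lemma fourier1_isometry_cont:
  assumes u: "integrable lborel u" and u2: "u \<in> sq_int lborel" and c: "continuous_on UNIV u" and b: "\<And>x. cmod (u x) \<le> B"
  shows "sq_norm lborel (fourier1 u) = sq_norm lborel u"
proof (rule antisym[OF fourier1_contraction[OF u u2]])
  let ?d = "\<lambda>n. inverse (real (Suc n))"
  let ?I = "\<lambda>n. \<integral>x. u x * gauss_conv u (?d n) x \<partial>lborel"
  have "(\<lambda>n. ennreal (cmod (?I n))) \<longlonglongrightarrow> ennreal (cmod (\<integral>x. u x * cnj (u x) \<partial>lborel))"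
    by (intro tendsto_ennrealI tendsto_norm gauss_form_tendsto[OF u c b])
  also have "ennreal (cmod (\<integral>x. u x * cnj (u x) \<partial>lborel)) = sq_norm lborel u"
    using sq_int_fin[OF u2] by (simp add: sq_int_integral_self[OF u2] ennreal_enn2real)
  finally have l: "(\<lambda>n. ennreal (cmod (?I n))) \<longlonglongrightarrow> sq_norm lborel u" .
  have "ennreal (cmod (?I n)) \<le> sq_norm lborel (fourier1 u)" for n
  proof -
    have "ennreal (cmod (?I n)) = (\<integral>\<^sup>+\<xi>. ennreal (gauss (?d n) \<xi> * (cmod (fourier1 u \<xi>))\<^sup>2) \<partial>lborel)"
      by (subst fourier1_gauss_integral[OF u]) (simp_all only: fourier1_gauss_identity[OF u] positive_imp_inverse_positive of_nat_0_less_iff zero_less_Suc)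
    also have "\<dots> \<le> sq_norm lborel (fourier1 u)"
      unfolding sq_norm_def by (intro nn_integral_mono ennreal_leI mult_left_le_one_le) (auto simp: gauss_bounds)
    finally show ?thesis .
  qed
  then show "sq_norm lborel u \<le> sq_norm lborel (fourier1 u)" by (intro LIMSEQ_le_const2[OF l]) auto
qed

section \<open>Density of bounded continuous functions in L^2 of the line\<close>

definition bcont :: "(real \<Rightarrow> complex) set" where
  "bcont = {w \<in> sq_int lborel. integrable lborel w \<and> continuous_on UNIV w \<and> (\<exists>B. \<forall>x. cmod (w x) \<le> B)}"

text \<open>The closure of \<open>bcont\<close>, treated as a class of functions: it contains the
  indicators of sets of finite measure and is stable under sums, multiples and L^2 limits, so it
  exhausts L^2.\<close>

definition bcont_approx :: "(real \<Rightarrow> complex) \<Rightarrow> bool" where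
  "bcont_approx f \<longleftrightarrow> f \<in> sq_int lborel \<and> (\<forall>e>0. \<exists>w\<in>bcont. sq_norm lborel (\<lambda>x. f x - w x) \<le> ennreal e)"

lemma bcont_approx_add:
  assumes f: "bcont_approx f" and g: "bcont_approx g"
  shows "bcont_approx (\<lambda>x. f x + g x)"
  unfolding bcont_approx_def
proof (intro conjI allI impI)
  have fs: "f \<in> sq_int lborel" "g \<in> sq_int lborel" using f g by (auto simp: bcont_approx_def)
  then show "(\<lambda>x. f x + g x) \<in> sq_int lborel" by (rule sq_int_add)
  fix e :: real assume e: "e > 0"
  then have e4: "e / 4 > 0" by simp
  obtain v where v: "v \<in> bcont" "sq_norm lborel (\<lambda>x. f x - v x) \<le> ennreal (e/4)"
    using f e4 unfolding bcont_approx_def by blast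
  obtain w where w: "w \<in> bcont" "sq_norm lborel (\<lambda>x. g x - w x) \<le> ennreal (e/4)"
    using g e4 unfolding bcont_approx_def by blast
  obtain B1 B2 where B: "\<And>x. cmod (v x) \<le> B1" "\<And>x. cmod (w x) \<le> B2" using v(1) w(1) by (auto simp: bcont_def)
  have "cmod (v x + w x) \<le> B1 + B2" for x using norm_triangle_mono[OF B] by blast
  then have vw: "(\<lambda>x. v x + w x) \<in> bcont" using v(1) w(1) unfolding bcont_def
    by (auto intro: sq_int_add continuous_intros)
  have m: "(\<lambda>x. f x - v x) \<in> borel_measurable lborel" "(\<lambda>x. g x - w x) \<in> borel_measurable lborel"
    using fs v(1) w(1) by (auto simp: sq_int_def bcont_def)
  have "sq_norm lborel (\<lambda>x. (f x + g x) - (v x + w x)) \<le> 2 * sq_norm lborel (\<lambda>x. f x - v x) + 2 * sq_norm lborel (\<lambda>x. g x - w x)"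
    using sq_norm_add_le2[OF m] by (simp add: algebra_simps)
  also have "\<dots> \<le> ennreal e" using e by (intro two_quarters_le v w) simp
  finally show "\<exists>w\<in>bcont. sq_norm lborel (\<lambda>x. f x + g x - w x) \<le> ennreal e" by (rule bexI[OF _ vw])
qed

lemma bcont_approx_0: "bcont_approx (\<lambda>x. 0)"
  unfolding bcont_approx_def
proof (intro conjI allI impI)
  have 0: "(\<lambda>x. 0) \<in> bcont" by (auto simp: bcont_def sq_int_def sq_norm_def)
  show "(\<lambda>x. 0) \<in> sq_int lborel" by (simp add: sq_int_def sq_norm_def)
  show "\<exists>w\<in>bcont. sq_norm lborel (\<lambda>x. 0 - w x) \<le> ennreal e" for e
    by (rule bexI[OF _ 0]) (simp add: sq_norm_def)
qed

lemma bcont_approx_cmult: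
  assumes f: "bcont_approx f"
  shows "bcont_approx (\<lambda>x. c * f x)"
proof (cases "c = 0")
  case False
  show ?thesis unfolding bcont_approx_def
  proof (intro conjI allI impI)
    have fs: "f \<in> sq_int lborel" using f by (auto simp: bcont_approx_def)
    then show "(\<lambda>x. c * f x) \<in> sq_int lborel" by (rule sq_int_cmult)
    fix e :: real assume e: "e > 0"
    then have e4: "e / (cmod c)\<^sup>2 > 0" using False by simp
    obtain v where v: "v \<in> bcont" "sq_norm lborel (\<lambda>x. f x - v x) \<le> ennreal (e / (cmod c)\<^sup>2)"
      using f e4 unfolding bcont_approx_def by blast
    obtain B1 where B: "\<And>x. cmod (v x) \<le> B1" using v(1) by (auto simp: bcont_def)
    have "cmod (c * v x) \<le> cmod c * B1" for x by (simp add: norm_mult B mult_left_mono)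
    then have cv: "(\<lambda>x. c * v x) \<in> bcont" using v(1) unfolding bcont_def
      by (auto intro: sq_int_cmult continuous_intros)
    have [measurable]: "(\<lambda>x. f x - v x) \<in> borel_measurable lborel"
      using fs v(1) by (auto simp: sq_int_def bcont_def)
    have "sq_norm lborel (\<lambda>x. c * f x - c * v x) = ennreal ((cmod c)\<^sup>2) * sq_norm lborel (\<lambda>x. f x - v x)"
      by (subst sq_norm_scale[symmetric]) (auto simp: right_diff_distrib)
    also have "\<dots> \<le> ennreal ((cmod c)\<^sup>2) * ennreal (e / (cmod c)\<^sup>2)" by (intro mult_left_mono v) auto
    also have "\<dots> = ennreal e" using e False by (simp add: ennreal_mult[symmetric])
    finally show "\<exists>w\<in>bcont. sq_norm lborel (\<lambda>x. c * f x - w x) \<le> ennreal e" by (rule bexI[OF _ cv])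
  qed
qed (use bcont_approx_0 in simp)

lemma bcont_approx_limit:
  assumes f: "f \<in> sq_int lborel" and u: "\<And>n. bcont_approx (u n)" and l: "(\<lambda>n. sq_norm lborel (\<lambda>x. u n x - f x)) \<longlonglongrightarrow> 0"
  shows "bcont_approx f"
  unfolding bcont_approx_def
proof (intro conjI allI impI f)
  fix e :: real assume e: "e > 0"
  then have e4: "e / 4 > 0" by simp
  have "\<forall>\<^sub>F n in sequentially. sq_norm lborel (\<lambda>x. u n x - f x) < ennreal (e/4)"
    using l by (rule order_tendstoD) (use e in auto)
  then obtain n where n: "sq_norm lborel (\<lambda>x. u n x - f x) < ennreal (e/4)" by (auto simp: eventually_sequentially)
  obtain v where v: "v \<in> bcont" "sq_norm lborel (\<lambda>x. u n x - v x) \<le> ennreal (e/4)"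
    using u[of n] e4 unfolding bcont_approx_def by blast
  have m: "(\<lambda>x. f x - u n x) \<in> borel_measurable lborel" "(\<lambda>x. u n x - v x) \<in> borel_measurable lborel"
    using f u[of n] v(1) by (auto simp: sq_int_def bcont_def bcont_approx_def)
  have "sq_norm lborel (\<lambda>x. f x - v x) \<le> 2 * sq_norm lborel (\<lambda>x. f x - u n x) + 2 * sq_norm lborel (\<lambda>x. u n x - v x)"
    using sq_norm_add_le2[OF m] by simp
  also have "\<dots> \<le> ennreal e"
    using n e by (intro two_quarters_le v) (auto simp: sq_norm_minus_commute[of _ f])
  finally show "\<exists>w\<in>bcont. sq_norm lborel (\<lambda>x. f x - w x) \<le> ennreal e" using v by blast
qed

text \<open>For a closed \<open>T\<close> and an open \<open>U\<close> with
  \<open>T \<subseteq> A \<subseteq> U\<close>, a Urysohn function differs from the indicator of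
  \<open>A\<close> only on \<open>(A - T) \<union> (U - A)\<close>, by at most 1, and regularity of
  Lebesgue measure makes that set small.\<close>

lemma bcont_approx_indicator:
  assumes A: "A \<in> sets borel" and fin: "emeasure lborel A < \<infinity>"
  shows "bcont_approx (indicator A)"
  unfolding bcont_approx_def
proof (intro conjI allI impI)
  have sq: "sq_norm lborel (indicator S) = emeasure lborel S" if "S \<in> sets borel" for S :: "real set"
  proof -
    have "sq_norm lborel (indicator S) = (\<integral>\<^sup>+x. indicator S x \<partial>lborel)"
      unfolding sq_norm_def by (intro nn_integral_cong) (auto simp: indicator_def)
    then show ?thesis using that by simp
  qed
  show iA: "indicator A \<in> sq_int lborel" using A fin by (simp add: sq_int_def sq)
  fix e :: real assume e: "e > 0"
  have A': "A \<in> sets lebesgue" using A by auto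
  have e2: "e / 2 > 0" using e by simp
  obtain T where T: "closed T" "T \<subseteq> A" "A - T \<in> lmeasurable" "emeasure lebesgue (A - T) < ennreal (e/2)"
    by (rule sets_lebesgue_inner_closed[OF A' e2])
  obtain U where U: "open U" "A \<subseteq> U" "U - A \<in> lmeasurable" "emeasure lebesgue (U - A) < ennreal (e/2)"
    by (rule sets_lebesgue_outer_open[OF A' e2])
  have [measurable]: "T \<in> sets borel" "U \<in> sets borel" "A \<in> sets borel" using T U A by auto
  have T3: "emeasure lborel (A - T) < ennreal (e/2)" and U3: "emeasure lborel (U - A) < ennreal (e/2)"
    using T(4) U(4) by simp_all
  have "closed (- U)" using U(1) by (simp add: closed_Compl)
  moreover have "T \<inter> - U = {}" using T(2) U(2) by auto
  ultimately obtain h :: "real \<Rightarrow> real" where h: "continuous_on UNIV h" "\<And>x. h x \<in> closed_segment 1 0"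
     "\<And>x. x \<in> T \<Longrightarrow> h x = 1" "\<And>x. x \<in> - U \<Longrightarrow> h x = 0"
    using Urysohn[OF T(1), of "- U" "1::real" "0::real"] by metis
  have h01: "0 \<le> h x" "h x \<le> 1" for x using h(2)[of x] by (auto simp: closed_segment_eq_real_ivl)
  have [measurable]: "h \<in> borel_measurable borel" using h(1) by (rule borel_measurable_continuous_onI)
  have Ufin: "emeasure lborel U < \<infinity>"
  proof -
    have "emeasure lborel U \<le> emeasure lborel (A \<union> (U - A))" by (intro emeasure_mono) auto
    also have "\<dots> \<le> emeasure lborel A + emeasure lborel (U - A)" by (intro emeasure_subadditive) auto
    also have "\<dots> < \<infinity>" using fin U3 by (simp add: less_top) (metis ennreal_less_top order_less_trans top.not_eq_extremum)
    finally show ?thesis .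
  qed
  define w where "w x = complex_of_real (h x)" for x
  have wU: "cmod (w x) \<le> indicator U x" for x using h01[of x] h(4)[of x] by (cases "x \<in> U") (auto simp: w_def)
  have [measurable]: "w \<in> borel_measurable borel" unfolding w_def[abs_def] by measurable
  have "w \<in> bcont" unfolding bcont_def
  proof (intro CollectI conjI)
    have "sq_norm lborel w \<le> sq_norm lborel (indicator U)"
    proof (rule sq_norm_mono_AE, rule AE_I2)
      show "cmod (w x) \<le> cmod (indicator U x)" for x
        using wU[of x] by (auto simp: indicator_def split: if_splits)
    qed
    then show "w \<in> sq_int lborel" using Ufin by (simp add: sq_int_def sq)
    show "integrable lborel w"
      by (rule Bochner_Integration.integrable_bound[of _ "indicator U :: real \<Rightarrow> real"])
         (use Ufin wU in auto)
    show "continuous_on UNIV w" unfolding w_def[abs_def] using h(1) by (intro continuous_intros)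
    have "\<forall>x. cmod (w x) \<le> 1" using h01 by (simp add: w_def)
    then show "\<exists>B. \<forall>x. cmod (w x) \<le> B" by blast
  qed
  moreover have "sq_norm lborel (\<lambda>x. indicator A x - w x) \<le> ennreal e"
  proof -
    have "sq_norm lborel (\<lambda>x. indicator A x - w x) \<le> sq_norm lborel (indicator ((A - T) \<union> (U - A)))"
    proof (rule sq_norm_mono_AE, rule AE_I2)
      fix x
      have "indicator A x - w x = complex_of_real (indicator A x - h x)"
        by (cases "x \<in> A") (simp_all add: w_def)
      then have "cmod (indicator A x - w x) = \<bar>indicator A x - h x\<bar>"
        by (simp only: norm_of_real)
      also have "\<dots> \<le> cmod (indicator ((A - T) \<union> (U - A)) x)"
        using h01[of x] h(3,4)[of x] T(2) U(2) by (auto simp: indicator_def)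
      finally show "cmod (indicator A x - w x) \<le> cmod (indicator ((A - T) \<union> (U - A)) x)" .
    qed
    also have "\<dots> = emeasure lborel ((A - T) \<union> (U - A))" by (rule sq) auto
    also have "\<dots> \<le> emeasure lborel (A - T) + emeasure lborel (U - A)" by (intro emeasure_subadditive) auto
    also have "\<dots> \<le> ennreal (e/2) + ennreal (e/2)" using T3 U3 by (intro add_mono) auto
    also have "\<dots> = ennreal e" using e by (simp flip: ennreal_plus)
    finally show ?thesis .
  qed
  ultimately show "\<exists>w\<in>bcont. sq_norm lborel (\<lambda>x. indicator A x - w x) \<le> ennreal e" by blast
qed

lemma bcont_approx_simple:
  assumes s: "simple_function lborel s" and s2: "s \<in> sq_int lborel"
  shows "bcont_approx s"
proof -
  have [measurable]: "s \<in> borel_measurable borel" using s2 by (auto simp: sq_int_def)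
  have fin: "finite (range s)" using simple_functionD(1)[OF s] by simp
  have sum: "bcont_approx (\<lambda>x. \<Sum>y\<in>I. y * indicator (s -` {y}) x)" if "finite I" for I
    using that
  proof induction
    case (insert y I)
    have "bcont_approx (\<lambda>x. y * indicator (s -` {y}) x)"
    proof (cases "y = 0")
      case False
      have m: "s -` {y} \<in> sets borel" using measurable_sets_borel[of s borel "{y}"] by simp
      \<comment> \<open>Chebyshev: the level set of a nonzero value has finite measure because
        \<open>s\<close> is square integrable.\<close>
      have "ennreal ((cmod y)\<^sup>2) * emeasure lborel (s -` {y}) = (\<integral>\<^sup>+x. ennreal ((cmod y)\<^sup>2) * indicator (s -` {y}) x \<partial>lborel)"
        using m by (simp add: nn_integral_cmult_indicator)
      also have "\<dots> \<le> sq_norm lborel s"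
        unfolding sq_norm_def by (intro nn_integral_mono) (auto simp: indicator_def)
      also have "\<dots> < \<infinity>" by (rule sq_int_fin[OF s2])
      finally have "emeasure lborel (s -` {y}) < \<infinity>" using False
        by (auto simp: ennreal_mult_less_top)
      then show ?thesis by (intro bcont_approx_cmult bcont_approx_indicator m)
    qed (use bcont_approx_0 in simp)
    from bcont_approx_add[OF this insert.IH] show ?case unfolding sum.insert[OF insert.hyps] .
  qed (use bcont_approx_0 in simp)
  have "s x = (\<Sum>y\<in>range s. y * indicator (s -` {y}) x)" for x
  proof -
    have "(\<Sum>y\<in>range s. y * indicator (s -` {y}) x) = (\<Sum>y\<in>range s. if y = s x then y else 0)"
      by (intro sum.cong) (auto simp: indicator_def)
    then show ?thesis using fin by (simp add: sum.delta)
  qed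
  then have "s = (\<lambda>x. \<Sum>y\<in>range s. y * indicator (s -` {y}) x)" by (rule ext)
  with sum[OF fin] show ?thesis by simp
qed

lemma bcont_approx_sq_int:
  assumes f: "f \<in> sq_int lborel"
  shows "bcont_approx f"
proof -
  have [measurable]: "f \<in> borel_measurable borel" using f by (auto simp: sq_int_def)
  obtain s where s: "\<And>i. simple_function lborel (s i)" "\<And>x. (\<lambda>i. s i x) \<longlonglongrightarrow> f x" "\<And>i x. dist (s i x) 0 \<le> 2 * dist (f x) 0"
    using borel_measurable_implies_sequence_metric[of f lborel 0] sq_intD[OF f] by (auto simp: space_borel)
  have [measurable]: "s i \<in> borel_measurable borel" for i
    using borel_measurable_simple_function[OF s(1)[of i]] by simp
  have sb: "cmod (s i x) \<le> 2 * cmod (f x)" for i x using s(3)[of i x] by simp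
  have sq: "s i \<in> sq_int lborel" for i
  proof -
    have "sq_norm lborel (s i) \<le> sq_norm lborel (\<lambda>x. 2 * f x)"
      by (rule sq_norm_mono_AE, rule AE_I2) (simp add: norm_mult sb)
    also have "\<dots> < \<infinity>" by (rule sq_int_fin[OF sq_int_cmult[OF f]])
    finally show ?thesis by (simp add: sq_int_def)
  qed
  have "(\<lambda>n. \<integral>\<^sup>+x. ennreal ((cmod (s n x - f x))\<^sup>2) \<partial>lborel) \<longlonglongrightarrow> (\<integral>\<^sup>+x. 0 \<partial>(lborel :: real measure))"
  \<comment> \<open>The approximants satisfy |s n x| \<le> 2 |f x|, whence the 3.\<close>
  proof (rule nn_integral_dominated_convergence[where w="\<lambda>x. ennreal ((cmod (3 * f x))\<^sup>2)"])
    show "(\<integral>\<^sup>+x. ennreal ((cmod (3 * f x))\<^sup>2) \<partial>lborel) < \<infinity>"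
      using sq_int_fin[OF sq_int_cmult[OF f, of 3]] by (simp add: sq_norm_def)
    show "AE x in lborel. (\<lambda>n. ennreal ((cmod (s n x - f x))\<^sup>2)) \<longlonglongrightarrow> 0"
    proof (rule AE_I2)
      fix x
      have "(\<lambda>n. ennreal ((cmod (s n x - f x))\<^sup>2)) \<longlonglongrightarrow> ennreal ((cmod (f x - f x))\<^sup>2)"
        by (intro tendsto_ennrealI tendsto_power tendsto_norm tendsto_diff tendsto_const s)
      then show "(\<lambda>n. ennreal ((cmod (s n x - f x))\<^sup>2)) \<longlonglongrightarrow> 0" by simp
    qed
    show "AE x in lborel. ennreal ((cmod (s n x - f x))\<^sup>2) \<le> ennreal ((cmod (3 * f x))\<^sup>2)" for n
    proof (intro AE_I2 ennreal_leI power_mono)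
      fix x
      have "cmod (s n x - f x) \<le> cmod (s n x) + cmod (f x)" by (rule norm_triangle_ineq4)
      also have "\<dots> \<le> cmod (3 * f x)" using sb[of n x] by (simp add: norm_mult)
      finally show "cmod (s n x - f x) \<le> cmod (3 * f x)" .
    qed simp
  qed auto
  then have "(\<lambda>n. sq_norm lborel (\<lambda>x. s n x - f x)) \<longlonglongrightarrow> 0" by (simp add: sq_norm_def)
  from bcont_approx_limit[OF f bcont_approx_simple[OF s(1) sq] this] show ?thesis .
qed

text \<open>The contraction property, applied to \<open>w n - u\<close>, carries the approximation
  of \<open>u\<close> over to the transforms, so the equality known for \<open>w n\<close> passes to
  the limit on both sides.\<close>

theorem Plancherel_real:
  assumes u: "integrable lborel u" and u2: "u \<in> sq_int lborel"
  shows "sq_norm lborel (fourier1 u) = sq_norm lborel u"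
proof -
  have "\<forall>n. \<exists>w\<in>bcont. sq_norm lborel (\<lambda>x. u x - w x) \<le> ennreal (inverse (real (Suc n)))"
    using bcont_approx_sq_int[OF u2] by (simp add: bcont_approx_def)
  then obtain w where w: "\<And>n. w n \<in> bcont" and wl: "\<And>n. sq_norm lborel (\<lambda>x. u x - w n x) \<le> ennreal (inverse (real (Suc n)))"
    by metis
  have w1: "integrable lborel (w n)" "w n \<in> sq_int lborel" for n using w[of n] by (auto simp: bcont_def)
  have "(\<lambda>n. ennreal (inverse (real (Suc n)))) \<longlonglongrightarrow> ennreal 0"
    by (intro tendsto_ennrealI LIMSEQ_inverse_real_of_nat)
  then have z: "(\<lambda>n. ennreal (inverse (real (Suc n)))) \<longlonglongrightarrow> 0" by simp
  have wu: "sq_norm lborel (\<lambda>x. w n x - u x) \<le> ennreal (inverse (real (Suc n)))" for n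
    using wl[of n] by (simp add: sq_norm_minus_commute)
  have l1: "(\<lambda>n. sq_norm lborel (\<lambda>x. w n x - u x)) \<longlonglongrightarrow> 0"
    by (rule tendsto_sandwich[OF _ _ tendsto_const z]) (use wu in auto)
  have fu: "fourier1 v \<in> sq_int lborel" if "integrable lborel v" "v \<in> sq_int lborel" for v
    using fourier1_contraction[OF that] sq_int_fin[OF that(2)] fourier1_measurable[OF sq_intD[OF that(2)]]
    by (auto simp: sq_int_def)
  have "sq_norm lborel (\<lambda>\<xi>. fourier1 (w n) \<xi> - fourier1 u \<xi>) \<le> ennreal (inverse (real (Suc n)))" for n
  proof -
    have "(\<lambda>\<xi>. fourier1 (w n) \<xi> - fourier1 u \<xi>) = fourier1 (\<lambda>x. w n x - u x)"
      by (rule ext) (simp add: fourier1_diff w1 u)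
    then show ?thesis using fourier1_contraction[of "\<lambda>x. w n x - u x"] wu[of n] w1[of n] u u2
      by (auto intro: order_trans sq_int_diff)
  qed
  then have l2: "(\<lambda>n. sq_norm lborel (\<lambda>\<xi>. fourier1 (w n) \<xi> - fourier1 u \<xi>)) \<longlonglongrightarrow> 0"
    by (intro tendsto_sandwich[OF _ _ tendsto_const z]) auto
  have "(\<lambda>n. sq_norm lborel (w n)) \<longlonglongrightarrow> sq_norm lborel u" by (rule sq_norm_tendsto[OF w1(2) u2 l1])
  moreover have "(\<lambda>n. sq_norm lborel (fourier1 (w n))) \<longlonglongrightarrow> sq_norm lborel (fourier1 u)"
    by (rule sq_norm_tendsto[OF fu[OF w1] fu[OF u u2] l2])
  moreover have "sq_norm lborel (fourier1 (w n)) = sq_norm lborel (w n)" for n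
    using w[of n] unfolding bcont_def by (auto intro: fourier1_isometry_cont)
  ultimately show ?thesis by (auto intro: LIMSEQ_unique)
qed

section \<open>The Plancherel theorem in dimension \<open>d\<close>\<close>

abbreviation PM :: "nat \<Rightarrow> (nat \<Rightarrow> real) measure" where
  "PM d \<equiv> Pi\<^sub>M {..<d} (\<lambda>_. lborel)"

interpretation lborels: product_sigma_finite "\<lambda>_::nat. lborel :: real measure"
  by standard

lemma sigma_finite_PM: "sigma_finite_measure (PM d)"
  by (rule lborels.sigma_finite) simp

lemma PM_Suc: "PM (Suc d) = Pi\<^sub>M (insert d {..<d}) (\<lambda>_. lborel)"
  by (simp add: lessThan_Suc)

lemma vinner_measurable[measurable (raw)]:
  assumes "f \<in> measurable N (PM d)" "g \<in> measurable N (PM d)"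
  shows "(\<lambda>z. vinner d (f z) (g z)) \<in> borel_measurable N"
  unfolding vinner_def
proof (rule borel_measurable_sum)
  fix i assume i: "i \<in> {..<d}"
  have "(\<lambda>z. f z i) \<in> borel_measurable N" "(\<lambda>z. g z i) \<in> borel_measurable N"
    using measurable_compose[OF assms(1) measurable_component_singleton[OF i]]
      measurable_compose[OF assms(2) measurable_component_singleton[OF i]] by simp_all
  then show "(\<lambda>z. f z i * g z i) \<in> borel_measurable N" by simp
qed

lemma vinner_measurable_left[measurable (raw)]:
  assumes "f \<in> measurable N (PM d)"
  shows "(\<lambda>z. vinner d (f z) \<xi>) \<in> borel_measurable N"
  unfolding vinner_def
proof (rule borel_measurable_sum)
  fix i assume i: "i \<in> {..<d}"
  have "(\<lambda>z. f z i) \<in> borel_measurable N"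
    using measurable_compose[OF assms(1) measurable_component_singleton[OF i]] by simp
  then show "(\<lambda>z. f z i * \<xi> i) \<in> borel_measurable N" by simp
qed

lemma vinner_commute: "vinner d x y = vinner d y x"
  by (simp add: vinner_def mult.commute)

lemma vinner_Suc_upd: "vinner (Suc d) (x(d := y)) \<zeta> = vinner d x \<zeta> + y * \<zeta> d"
  by (simp add: vinner_def)

definition fourier_PM :: "nat \<Rightarrow> ((nat \<Rightarrow> real) \<Rightarrow> complex) \<Rightarrow> (nat \<Rightarrow> real) \<Rightarrow> complex" where
  "fourier_PM d u \<xi> = (\<integral>x. u x * character (vinner d x \<xi>) \<partial>PM d)"

lemma fourier_PM_upd: "fourier_PM d u (\<xi>(d := \<eta>)) = fourier_PM d u \<xi>"
  by (simp add: fourier_PM_def vinner_def)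

lemma fourier_PM_measurable[measurable]:
  assumes [measurable]: "u \<in> borel_measurable (PM d)"
  shows "fourier_PM d u \<in> borel_measurable (PM d)"
proof -
  interpret sigma_finite_measure "PM d" by (rule sigma_finite_PM)
  show ?thesis unfolding fourier_PM_def[abs_def] by measurable
qed

text \<open>Transform the last variable on each slice first, then the remaining \<open>d\<close> variables.\<close>

lemma Plancherel_PM_Suc:
  assumes IH: "\<And>u. integrable (PM d) u \<Longrightarrow> u \<in> sq_int (PM d) \<Longrightarrow> sq_norm (PM d) (fourier_PM d u) = sq_norm (PM d) u"
    and u: "integrable (PM (Suc d)) u" and u2: "u \<in> sq_int (PM (Suc d))"
  shows "sq_norm (PM (Suc d)) (fourier_PM (Suc d) u) = sq_norm (PM (Suc d)) u"
proof -
  interpret P: sigma_finite_measure "PM d" by (rule sigma_finite_PM)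
  interpret PL: pair_sigma_finite "PM d" "lborel :: real measure" ..
  have um[measurable]: "u \<in> borel_measurable (PM (Suc d))" using u by auto
  have up[measurable (raw)]: "(\<lambda>z. u ((f z)(d := g z))) \<in> borel_measurable N"
    if "f \<in> measurable N (PM d)" "g \<in> borel_measurable N" for f g and N :: "'z measure"
  proof -
    have "(\<lambda>z. (f z)(d := g z)) \<in> measurable N (PM (Suc d))"
      by (rule measurable_fun_upd[where J="{..<d}"]) (use that in auto)
    from measurable_compose[OF this um] show ?thesis .
  qed
  have ins: "(\<integral>\<^sup>+z. F z \<partial>PM (Suc d)) = (\<integral>\<^sup>+x. (\<integral>\<^sup>+y. F (x(d := y)) \<partial>lborel) \<partial>PM d)"
    if "F \<in> borel_measurable (PM (Suc d))" for F
    using lborels.product_nn_integral_insert[of "{..<d}" d F] that by (simp add: PM_Suc)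
  have insr: "(\<integral>\<^sup>+z. F z \<partial>PM (Suc d)) = (\<integral>\<^sup>+y. (\<integral>\<^sup>+x. F (x(d := y)) \<partial>PM d) \<partial>lborel)"
    if "F \<in> borel_measurable (PM (Suc d))" for F
    using lborels.product_nn_integral_insert_rev[of "{..<d}" d F] that by (simp add: PM_Suc)
  define h where "h x \<eta> = fourier1 (\<lambda>y. u (x(d := y))) \<eta>" for x \<eta>
  have hm[measurable (raw)]: "(\<lambda>z. h (f z) (g z)) \<in> borel_measurable N"
    if [measurable]: "f \<in> measurable N (PM d)" "g \<in> borel_measurable N" for f g and N :: "'z measure"
    unfolding h_def fourier1_def by measurable
  have fin1: "(\<integral>\<^sup>+x. (\<integral>\<^sup>+y. ennreal (cmod (u (x(d := y)))) \<partial>lborel) \<partial>PM d) < \<infinity>"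
    using u by (subst ins[symmetric]) (auto simp: integrable_iff_bounded)
  have fin2: "(\<integral>\<^sup>+x. (\<integral>\<^sup>+y. ennreal ((cmod (u (x(d := y))))\<^sup>2) \<partial>lborel) \<partial>PM d) = sq_norm (PM (Suc d)) u"
    unfolding sq_norm_def by (subst ins[symmetric]) auto
  have ae1: "AE x in PM d. integrable lborel (\<lambda>y. u (x(d := y)))"
  proof -
    have "AE x in PM d. (\<integral>\<^sup>+y. ennreal (cmod (u (x(d := y)))) \<partial>lborel) \<noteq> \<infinity>"
      using fin1 by (intro nn_integral_noteq_infinite) auto
    then show ?thesis
      using AE_space by eventually_elim (auto simp: integrable_iff_bounded less_top)
  qed
  have ae2: "AE x in PM d. (\<lambda>y. u (x(d := y))) \<in> sq_int lborel"
  proof -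
    have "AE x in PM d. (\<integral>\<^sup>+y. ennreal ((cmod (u (x(d := y))))\<^sup>2) \<partial>lborel) \<noteq> \<infinity>"
      using fin2 sq_int_fin[OF u2] by (intro nn_integral_noteq_infinite) auto
    then show ?thesis
      using AE_space by eventually_elim (auto simp: sq_int_def sq_norm_def less_top)
  qed
  have hsq: "(\<integral>\<^sup>+\<eta>. (\<integral>\<^sup>+x. ennreal ((cmod (h x \<eta>))\<^sup>2) \<partial>PM d) \<partial>lborel) = sq_norm (PM (Suc d)) u"
  proof -
    have "(\<integral>\<^sup>+\<eta>. (\<integral>\<^sup>+x. ennreal ((cmod (h x \<eta>))\<^sup>2) \<partial>PM d) \<partial>lborel) = (\<integral>\<^sup>+x. (\<integral>\<^sup>+\<eta>. ennreal ((cmod (h x \<eta>))\<^sup>2) \<partial>lborel) \<partial>PM d)"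
      by (rule PL.Fubini') measurable
    also have "\<dots> = (\<integral>\<^sup>+x. (\<integral>\<^sup>+y. ennreal ((cmod (u (x(d := y))))\<^sup>2) \<partial>lborel) \<partial>PM d)"
    proof (rule nn_integral_cong_AE, use ae1 ae2 in eventually_elim)
      case (elim x)
      from Plancherel_real[OF this] show ?case by (simp add: sq_norm_def h_def)
    qed
    finally show ?thesis by (simp add: fin2)
  qed
  \<comment> \<open>This holds for every \<eta>, because |h x \<eta>| is at most the integral of |u|
    over the slice at \<open>x\<close>, which is free of \<eta>. Square integrability is obtained
    only for almost every \<eta>, from \<open>hsq\<close>; under the outer integral that is
    enough.\<close>
  have hi: "integrable (PM d) (\<lambda>x. h x \<eta>)" for \<eta>
    unfolding integrable_iff_bounded
  proof
    show "(\<lambda>x. h x \<eta>) \<in> borel_measurable (PM d)" by measurable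
    have "(\<integral>\<^sup>+x. ennreal (cmod (h x \<eta>)) \<partial>PM d) \<le> (\<integral>\<^sup>+x. (\<integral>\<^sup>+y. ennreal (cmod (u (x(d := y)))) \<partial>lborel) \<partial>PM d)"
    proof (rule nn_integral_mono)
      fix x
      show "ennreal (cmod (h x \<eta>)) \<le> (\<integral>\<^sup>+y. ennreal (cmod (u (x(d := y)))) \<partial>lborel)"
        unfolding h_def fourier1_def by (rule order_trans[OF norm_integral_le_nn_integral]) (simp add: norm_mult)
    qed
    also note fin1
    finally show "(\<integral>\<^sup>+x. ennreal (norm (h x \<eta>)) \<partial>PM d) < \<infinity>" .
  qed
  have hs: "AE \<eta> in lborel. (\<lambda>x. h x \<eta>) \<in> sq_int (PM d)"
  proof -
    have "AE \<eta> in lborel. (\<integral>\<^sup>+x. ennreal ((cmod (h x \<eta>))\<^sup>2) \<partial>PM d) \<noteq> \<infinity>"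
      using hsq sq_int_fin[OF u2] by (intro nn_integral_noteq_infinite) auto
    then show ?thesis by eventually_elim (auto simp: sq_int_def sq_norm_def less_top)
  qed
  have split: "fourier_PM (Suc d) u \<zeta> = fourier_PM d (\<lambda>x. h x (\<zeta> d)) \<zeta>" for \<zeta>
  proof -
    have "integrable (PM (Suc d)) (\<lambda>z. u z * character (vinner (Suc d) z \<zeta>))"
      by (rule integrable_bounded_mult[OF u, where B=1]) auto
    then have "fourier_PM (Suc d) u \<zeta> = (\<integral>x. (\<integral>y. u (x(d := y)) * character (vinner (Suc d) (x(d := y)) \<zeta>) \<partial>lborel) \<partial>PM d)"
      unfolding fourier_PM_def using lborels.product_integral_insert[of "{..<d}" d "\<lambda>z. u z * character (vinner (Suc d) z \<zeta>)"]
      by (simp add: PM_Suc)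
    also have "\<dots> = (\<integral>x. (\<integral>y. character (vinner d x \<zeta>) * (u (x(d := y)) * character (y * \<zeta> d)) \<partial>lborel) \<partial>PM d)"
      by (simp add: vinner_Suc_upd character_add mult_ac)
    also have "\<dots> = (\<integral>x. character (vinner d x \<zeta>) * h x (\<zeta> d) \<partial>PM d)"
      by (simp only: integral_mult_right_zero h_def fourier1_def)
    finally show ?thesis by (simp add: fourier_PM_def mult.commute)
  qed
  have "sq_norm (PM (Suc d)) (fourier_PM (Suc d) u) = (\<integral>\<^sup>+\<eta>. (\<integral>\<^sup>+\<xi>. ennreal ((cmod (fourier_PM (Suc d) u (\<xi>(d := \<eta>))))\<^sup>2) \<partial>PM d) \<partial>lborel)"
    unfolding sq_norm_def by (rule insr) measurable
  also have "\<dots> = (\<integral>\<^sup>+\<eta>. sq_norm (PM d) (fourier_PM d (\<lambda>x. h x \<eta>)) \<partial>lborel)"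
    unfolding split by (simp add: fourier_PM_upd sq_norm_def)
  also have "\<dots> = (\<integral>\<^sup>+\<eta>. sq_norm (PM d) (\<lambda>x. h x \<eta>) \<partial>lborel)"
    by (rule nn_integral_cong_AE, use hs in eventually_elim) (rule IH[OF hi])
  also have "\<dots> = sq_norm (PM (Suc d)) u" using hsq by (simp add: sq_norm_def)
  finally show ?thesis .
qed

theorem Plancherel_PM:
  assumes "integrable (PM d) u" "u \<in> sq_int (PM d)"
  shows "sq_norm (PM d) (fourier_PM d u) = sq_norm (PM d) u"
  using assms
proof (induction d arbitrary: u)
  case 0
  \<comment> \<open>In dimension 0 the measure is a unit mass at the everywhere undefined function
    and the character is 1.\<close>
  have "fourier_PM 0 u \<xi> = u (\<lambda>k. undefined)" for \<xi>
    by (simp add: fourier_PM_def vinner_def PiM_empty lebesgue_integral_count_space_finite)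
  then show ?case by (simp add: sq_norm_def PiM_empty nn_integral_count_space_finite)
next
  case (Suc d)
  then show ?case by (rule Plancherel_PM_Suc)
qed

text \<open>Fubini's theorem and the symmetry of the kernel
  \<open>character (vinner d x \<xi>)\<close> in its two variables.\<close>

lemma fourier_PM_multiplication:
  assumes u: "integrable (PM d) u" and v: "integrable (PM d) v"
  shows "(\<integral>\<xi>. fourier_PM d u \<xi> * v \<xi> \<partial>PM d) = (\<integral>x. u x * fourier_PM d v x \<partial>PM d)"
proof -
  interpret P: sigma_finite_measure "PM d" by (rule sigma_finite_PM)
  interpret PP: pair_sigma_finite "PM d" "PM d" ..
  have [measurable]: "u \<in> borel_measurable (PM d)" "v \<in> borel_measurable (PM d)" using u v by auto
  have i: "integrable (PM d \<Otimes>\<^sub>M PM d) (\<lambda>(x, \<xi>). u x * v \<xi> * character (vinner d x \<xi>))"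
  proof (rule Bochner_Integration.integrable_bound)
    show "integrable (PM d \<Otimes>\<^sub>M PM d) (\<lambda>(x, y). u x * v y)"
    proof (rule PP.Fubini_integrable)
      show "integrable (PM d) (\<lambda>x. \<integral>y. norm (case (x, y) of (x, y) \<Rightarrow> u x * v y) \<partial>PM d)"
        using u v by (simp add: norm_mult integrable_norm)
      show "AE x in PM d. integrable (PM d) (\<lambda>y. case (x, y) of (x, y) \<Rightarrow> u x * v y)"
        using v by simp
    qed measurable
  qed (auto simp: norm_mult)
  have "(\<integral>\<xi>. fourier_PM d u \<xi> * v \<xi> \<partial>PM d) = (\<integral>\<xi>. (\<integral>x. u x * v \<xi> * character (vinner d x \<xi>) \<partial>PM d) \<partial>PM d)"
  proof (rule Bochner_Integration.integral_cong[OF refl])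
    fix \<xi>
    have "(\<integral>x. u x * v \<xi> * character (vinner d x \<xi>) \<partial>PM d) = (\<integral>x. v \<xi> * (u x * character (vinner d x \<xi>)) \<partial>PM d)"
      by (simp add: mult_ac)
    then show "fourier_PM d u \<xi> * v \<xi> = (\<integral>x. u x * v \<xi> * character (vinner d x \<xi>) \<partial>PM d)"
      by (simp add: fourier_PM_def mult.commute)
  qed
  also have "\<dots> = (\<integral>x. (\<integral>\<xi>. u x * v \<xi> * character (vinner d x \<xi>) \<partial>PM d) \<partial>PM d)"
    by (rule PP.Fubini_integral[OF i])
  also have "\<dots> = (\<integral>x. u x * fourier_PM d v x \<partial>PM d)"
    by (simp add: fourier_PM_def mult.assoc vinner_commute[of d _ "_"])
  finally show ?thesis .
qed

section \<open>The Fourier transform on \<open>L\<^sup>2\<close> and multiplier operators\<close>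

lemma AE_leb_iff: "(AE x in leb d. P x) \<longleftrightarrow> (AE x in PM d. P x)"
  unfolding leb_def by (rule AE_completion_iff)

lemma sq_norm_leb: "sq_norm (leb d) f = sq_norm (PM d) f"
  by (simp add: sq_norm_def leb_def nn_integral_completion)

lemma measurable_lebI[measurable (raw)]: "f \<in> borel_measurable (PM d) \<Longrightarrow> f \<in> borel_measurable (leb d)"
  unfolding leb_def by (rule measurable_completion)

lemma sigma_finite_leb: "sigma_finite_measure (leb d)"
proof
  interpret sigma_finite_measure "PM d" by (rule sigma_finite_PM)
  obtain A :: "nat \<Rightarrow> (nat \<Rightarrow> real) set" where A: "range A \<subseteq> sets (PM d)" "(\<Union>i. A i) = space (PM d)" "\<And>i. emeasure (PM d) (A i) \<noteq> \<infinity>"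
    using sigma_finite by blast
  have "emeasure (leb d) (A i) \<noteq> \<infinity>" for i using A(1) A(3)[of i] by (auto simp: leb_def)
  moreover have "range A \<subseteq> sets (leb d)" using A(1) by (auto simp: leb_def)
  moreover have "(\<Union>i. A i) = space (leb d)" using A(2) by (simp add: leb_def)
  ultimately show "\<exists>A. countable A \<and> A \<subseteq> sets (leb d) \<and> \<Union>A = space (leb d) \<and> (\<forall>a\<in>A. emeasure (leb d) a \<noteq> \<infinity>)"
    by (intro exI[of _ "range A"]) auto
qed

lemma vinner_measurable_leb[measurable]: "(\<lambda>x. vinner d x \<xi>) \<in> borel_measurable (leb d)"
  by (rule measurable_lebI) measurable

text \<open>The measure \<open>leb d\<close> is a completion, whereas Fubini's theorem and the
  product lemmas are applied to \<open>PM d\<close>; a Borel representative is the bridge between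
  the two.\<close>

lemma leb_ex_borel_measurable:
  fixes f :: "(nat \<Rightarrow> real) \<Rightarrow> complex"
  assumes [measurable]: "f \<in> borel_measurable (leb d)"
  shows "\<exists>g\<in>borel_measurable (PM d). AE x in PM d. f x = g x"
proof -
  have r: "(\<lambda>x. Re (f x)) \<in> borel_measurable (completion (PM d))" "(\<lambda>x. Im (f x)) \<in> borel_measurable (completion (PM d))"
    unfolding leb_def[symmetric] by measurable
  obtain p where p: "p \<in> borel_measurable (PM d)" "AE x in PM d. Re (f x) = p x"
    using completion_ex_borel_measurable_real[OF r(1)] by auto
  obtain q where q: "q \<in> borel_measurable (PM d)" "AE x in PM d. Im (f x) = q x"
    using completion_ex_borel_measurable_real[OF r(2)] by auto
  note [measurable] = p(1) q(1)
  have "(\<lambda>x. Complex (p x) (q x)) \<in> borel_measurable (PM d)"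
    by (simp add: borel_measurable_complex_iff)
  then show ?thesis
  proof (rule bexI[rotated])
    show "AE x in PM d. f x = Complex (p x) (q x)"
      using p(2) q(2) by eventually_elim (simp add: complex_eq_iff)
  qed
qed

text \<open>A change on a null set leaves the Fourier integral unchanged at every frequency, so the
  transforms agree everywhere and the results for \<open>PM d\<close> carry over to
  \<open>leb d\<close>.\<close>

lemma fourier_representative:
  assumes u: "integrable (leb d) u" and u2: "u \<in> sq_int (leb d)"
  obtains g where "integrable (PM d) g" "g \<in> sq_int (PM d)" "AE x in leb d. u x = g x" "fourier d u = fourier_PM d g"
proof -
  have um[measurable]: "u \<in> borel_measurable (leb d)" using u by auto
  obtain g where g[measurable]: "g \<in> borel_measurable (PM d)" and ae: "AE x in PM d. u x = g x"
    using leb_ex_borel_measurable[OF um] by blast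
  have ael: "AE x in leb d. u x = g x" using ae by (simp add: AE_leb_iff)
  have "integrable (leb d) g"
    by (rule iffD1[OF integrable_cong_AE u]) (use ael in auto)
  then have gi: "integrable (PM d) g" unfolding leb_def by (simp add: integrable_completion)
  have "sq_norm (leb d) g = sq_norm (leb d) u" by (rule sq_norm_cong_AE) (use ael in auto)
  then have g2: "g \<in> sq_int (PM d)" using sq_int_fin[OF u2] by (simp add: sq_int_def sq_norm_leb)
  have "fourier d u \<xi> = fourier_PM d g \<xi>" for \<xi>
  proof -
    have "fourier d u \<xi> = (\<integral>x. u x * character (vinner d x \<xi>) \<partial>leb d)" by (simp add: fourier_def character_def)
    also have "\<dots> = (\<integral>x. g x * character (vinner d x \<xi>) \<partial>leb d)"
      by (rule integral_cong_AE) (use ael in auto)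
    also have "\<dots> = fourier_PM d g \<xi>" unfolding leb_def fourier_PM_def by (rule integral_completion) measurable
    finally show ?thesis .
  qed
  then show ?thesis using that[OF gi g2 ael] by blast
qed

lemma fourier_isometry:
  assumes u: "integrable (leb d) u" and u2: "u \<in> sq_int (leb d)"
  shows "sq_norm (leb d) (fourier d u) = sq_norm (leb d) u" "fourier d u \<in> sq_int (leb d)"
proof -
  obtain g where g: "integrable (PM d) g" "g \<in> sq_int (PM d)" "AE x in leb d. u x = g x" "fourier d u = fourier_PM d g"
    using fourier_representative[OF u u2] .
  have "sq_norm (leb d) u = sq_norm (leb d) g" by (rule sq_norm_cong_AE) (use g in auto)
  then show 1: "sq_norm (leb d) (fourier d u) = sq_norm (leb d) u"
    using Plancherel_PM[OF g(1,2)] g(4) by (simp add: sq_norm_leb)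
  have "fourier d u \<in> borel_measurable (leb d)"
    unfolding g(4) by (intro measurable_lebI fourier_PM_measurable sq_intD[OF g(2)])
  then show "fourier d u \<in> sq_int (leb d)"
    using sq_int_fin[OF u2] by (simp add: sq_int_def 1)
qed

lemma fourier_diff:
  assumes "integrable (leb d) u" "integrable (leb d) v"
  shows "fourier d (\<lambda>x. u x - v x) \<xi> = fourier d u \<xi> - fourier d v \<xi>"
proof -
  have i: "integrable (leb d) (\<lambda>x. w x * exp (- 2 * of_real pi * \<i> * of_real (vinner d x \<xi>)))" if "integrable (leb d) w" for w
    unfolding character_def[symmetric] by (rule integrable_bounded_mult[OF that, where B=1]) auto
  show ?thesis unfolding fourier_def
    by (subst Bochner_Integration.integral_diff[symmetric, OF i i]) (use assms in \<open>auto simp: left_diff_distrib\<close>)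
qed

lemma fourier_multiplication:
  assumes u: "integrable (leb d) u" "u \<in> sq_int (leb d)" and v: "integrable (leb d) v" "v \<in> sq_int (leb d)"
  shows "(\<integral>\<xi>. fourier d u \<xi> * v \<xi> \<partial>leb d) = (\<integral>x. u x * fourier d v x \<partial>leb d)"
proof -
  obtain g where g: "integrable (PM d) g" "g \<in> sq_int (PM d)" "AE x in leb d. u x = g x" "fourier d u = fourier_PM d g"
    using fourier_representative[OF u] .
  obtain h where h: "integrable (PM d) h" "h \<in> sq_int (PM d)" "AE x in leb d. v x = h x" "fourier d v = fourier_PM d h"
    using fourier_representative[OF v] .
  have [measurable]: "u \<in> borel_measurable (leb d)" "v \<in> borel_measurable (leb d)" using u v by auto
  have [measurable]: "g \<in> borel_measurable (PM d)" "h \<in> borel_measurable (PM d)" using g h by auto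
  have "(\<integral>\<xi>. fourier d u \<xi> * v \<xi> \<partial>leb d) = (\<integral>\<xi>. fourier_PM d g \<xi> * h \<xi> \<partial>leb d)"
    unfolding g(4) by (rule integral_cong_AE) (use h(3) in auto)
  also have "\<dots> = (\<integral>\<xi>. fourier_PM d g \<xi> * h \<xi> \<partial>PM d)" unfolding leb_def by (rule integral_completion) measurable
  also have "\<dots> = (\<integral>x. g x * fourier_PM d h x \<partial>PM d)" by (rule fourier_PM_multiplication[OF g(1) h(1)])
  also have "\<dots> = (\<integral>x. g x * fourier_PM d h x \<partial>leb d)" unfolding leb_def by (rule integral_completion[symmetric]) measurable
  also have "\<dots> = (\<integral>x. u x * fourier d v x \<partial>leb d)"
    unfolding h(4) by (rule integral_cong_AE) (use g(3) in auto)
  finally show ?thesis .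
qed

section \<open>Comparison of \<open>L2norm\<close> with \<open>sq_norm\<close>\<close>

lemma L2norm_sq: "(L2norm d h)\<^sup>2 = (\<integral>\<^sup>+x. (h x)\<^sup>2 \<partial>leb d)"
proof (cases "(\<integral>\<^sup>+x. (h x)\<^sup>2 \<partial>leb d) = \<infinity>")
  case True
  then show ?thesis by (simp add: L2norm_def power2_eq_square ennreal_top_mult)
next
  case False
  then have "(\<integral>\<^sup>+x. (h x)\<^sup>2 \<partial>leb d) < top" by (simp add: less_top)
  then show ?thesis using False by (simp add: L2norm_def Let_def ennreal_power ennreal_enn2real)
qed

lemma L2cnorm_sq: "(L2cnorm d f)\<^sup>2 = sq_norm (leb d) f"
  unfolding L2norm_sq sq_norm_def by (simp add: ennreal_power)

lemma ennreal_sq_le_iff: "(x :: ennreal)\<^sup>2 \<le> y\<^sup>2 \<longleftrightarrow> x \<le> y"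
proof
  show "x\<^sup>2 \<le> y\<^sup>2" if "x \<le> y" using that by (intro power_mono) auto
  show "x \<le> y" if le: "x\<^sup>2 \<le> y\<^sup>2"
  proof (rule ccontr)
    assume "\<not> x \<le> y"
    then have lt: "y < x" by simp
    then have "y < top" using order_less_le_trans top_greatest by blast
    then obtain b where b: "y = ennreal b" "b \<ge> 0" by (cases y) auto
    \<comment> \<open>A real number above \<open>b\<close> and at most \<open>x\<close>, so that the
      squares can be compared among reals even when \<open>x\<close> is infinite.\<close>
    obtain c where c: "b < c" "ennreal c \<le> x"
    proof (cases x)
      case (real r) then show ?thesis using lt b by (intro that[of r]) (auto simp: ennreal_less_iff)
    next
      case top then show ?thesis by (intro that[of "b + 1"]) auto
    qed
    have "ennreal (c\<^sup>2) \<le> x\<^sup>2" using c b power_mono[OF c(2), of 2] by (simp add: ennreal_power)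
    also have "\<dots> \<le> ennreal (b\<^sup>2)" using le b by (simp add: ennreal_power)
    finally have "c\<^sup>2 \<le> b\<^sup>2" by simp
    moreover have "b\<^sup>2 < c\<^sup>2" using c b by (intro power_strict_mono) auto
    ultimately show False by simp
  qed
qed

lemma L2_eq_sq_int: "L2 d = sq_int (leb d)"
proof -
  have "L2cnorm d f < \<infinity> \<longleftrightarrow> sq_norm (leb d) f < \<infinity>" for f
    unfolding L2cnorm_sq[symmetric] by (cases "L2cnorm d f") (auto simp: power2_eq_square ennreal_mult_less_top)
  then show ?thesis by (auto simp: L2_def sq_int_def)
qed

lemma L2cnorm_tendsto_0_iff:
  "(\<lambda>n. L2cnorm d (u n)) \<longlonglongrightarrow> 0 \<longleftrightarrow> (\<lambda>n. sq_norm (leb d) (u n)) \<longlonglongrightarrow> 0"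
proof
  assume l: "(\<lambda>n. L2cnorm d (u n)) \<longlonglongrightarrow> 0"
  show "(\<lambda>n. sq_norm (leb d) (u n)) \<longlonglongrightarrow> 0"
  proof (rule tendsto_sandwich[OF _ _ tendsto_const l])
    have "\<forall>\<^sub>F n in sequentially. L2cnorm d (u n) < 1" using l by (rule order_tendstoD) simp
    then show "\<forall>\<^sub>F n in sequentially. sq_norm (leb d) (u n) \<le> L2cnorm d (u n)"
    proof eventually_elim
      case (elim n)
      then have "L2cnorm d (u n) * L2cnorm d (u n) \<le> 1 * L2cnorm d (u n)" by (intro mult_right_mono) auto
      then show ?case unfolding L2cnorm_sq[symmetric] by (simp add: power2_eq_square)
    qed
  qed simp
next
  assume l: "(\<lambda>n. sq_norm (leb d) (u n)) \<longlonglongrightarrow> 0"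
  show "(\<lambda>n. L2cnorm d (u n)) \<longlonglongrightarrow> 0"
  proof (rule order_tendstoI)
    fix e :: ennreal assume e: "e > 0"
    then have "0 < e\<^sup>2" by (simp add: power2_eq_square ennreal_zero_less_mult_iff)
    with l have "\<forall>\<^sub>F n in sequentially. sq_norm (leb d) (u n) < e\<^sup>2" by (rule order_tendstoD)
    then show "\<forall>\<^sub>F n in sequentially. L2cnorm d (u n) < e"
    proof eventually_elim
      case (elim n)
      then show ?case unfolding L2cnorm_sq[symmetric] using ennreal_sq_le_iff[of e "L2cnorm d (u n)"] by (simp add: not_le[symmetric])
    qed
  qed simp
qed

text \<open>The property by which \<open>fourier_L2\<close> is chosen, rewritten with
  \<open>sq_norm\<close>. It is the only access to the chosen function, and different
  \<open>f\<close> come with unrelated approximating sequences.\<close>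

definition fourier_approx :: "nat \<Rightarrow> (nat \<Rightarrow> (nat \<Rightarrow> real) \<Rightarrow> complex) \<Rightarrow> ((nat \<Rightarrow> real) \<Rightarrow> complex) \<Rightarrow> bool" where
  "fourier_approx d u f \<longleftrightarrow> (\<forall>n. integrable (leb d) (u n) \<and> u n \<in> sq_int (leb d)) \<and>
     (\<lambda>n. sq_norm (leb d) (\<lambda>x. u n x - f x)) \<longlonglongrightarrow> 0 \<and>
     (\<lambda>n. sq_norm (leb d) (\<lambda>\<xi>. fourier d (u n) \<xi> - fourier_L2 d f \<xi>)) \<longlonglongrightarrow> 0"

lemma fourier_approxD:
  assumes "fourier_approx d u f"
  shows "integrable (leb d) (u n)" "u n \<in> sq_int (leb d)"
    "(\<lambda>n. sq_norm (leb d) (\<lambda>x. u n x - f x)) \<longlonglongrightarrow> 0"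
    "(\<lambda>n. sq_norm (leb d) (\<lambda>\<xi>. fourier d (u n) \<xi> - fourier_L2 d f \<xi>)) \<longlonglongrightarrow> 0"
  using assms by (simp_all add: fourier_approx_def)

text \<open>The choice is legitimate: approximations exist by density, their transforms form a
  Cauchy sequence because \<open>fourier\<close> is isometric on differences, and completeness
  supplies the limit.\<close>

lemma fourier_L2_spec:
  assumes f: "f \<in> sq_int (leb d)"
  shows "fourier_L2 d f \<in> sq_int (leb d)"
    and "\<exists>u. fourier_approx d u f"
proof -
  interpret sigma_finite_measure "leb d" by (rule sigma_finite_leb)
  let ?P = "\<lambda>F. F \<in> L2 d \<and> (\<exists>u. (\<forall>n. u n \<in> L2 d \<and> integrable (leb d) (u n)) \<and>
         (\<lambda>n. L2cnorm d (\<lambda>x. u n x - f x)) \<longlonglongrightarrow> 0 \<and>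
         (\<lambda>n. L2cnorm d (\<lambda>\<xi>. fourier d (u n) \<xi> - F \<xi>)) \<longlonglongrightarrow> 0)"
  obtain u where u: "\<And>n. u n \<in> sq_int (leb d)" "\<And>n. integrable (leb d) (u n)"
    and l: "(\<lambda>n. sq_norm (leb d) (\<lambda>x. u n x - f x)) \<longlonglongrightarrow> 0"
    using sq_int_dense_integrable[OF f] by blast
  have "\<exists>F\<in>sq_int (leb d). (\<lambda>n. sq_norm (leb d) (\<lambda>\<xi>. fourier d (u n) \<xi> - F \<xi>)) \<longlonglongrightarrow> 0"
  proof (rule sq_int_complete)
    show "fourier d (u n) \<in> sq_int (leb d)" for n by (rule fourier_isometry(2)[OF u(2,1)])
    fix e :: real assume e: "e > 0"
    have "\<forall>\<^sub>F n in sequentially. sq_norm (leb d) (\<lambda>x. u n x - f x) < ennreal (e/4)"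
      using l by (rule order_tendstoD) (use e in auto)
    then obtain N where N: "\<And>n. n \<ge> N \<Longrightarrow> sq_norm (leb d) (\<lambda>x. u n x - f x) < ennreal (e/4)"
      by (auto simp: eventually_sequentially)
    have "sq_norm (leb d) (\<lambda>\<xi>. fourier d (u m) \<xi> - fourier d (u n) \<xi>) \<le> ennreal e" if "m \<ge> N" "n \<ge> N" for m n
    proof -
      have "sq_norm (leb d) (\<lambda>\<xi>. fourier d (u m) \<xi> - fourier d (u n) \<xi>) = sq_norm (leb d) (\<lambda>x. u m x - u n x)"
        unfolding fourier_diff[OF u(2) u(2), symmetric] by (rule fourier_isometry) (use u in \<open>auto intro: sq_int_diff\<close>)
      also have "\<dots> \<le> 2 * sq_norm (leb d) (\<lambda>x. u m x - f x) + 2 * sq_norm (leb d) (\<lambda>x. u n x - f x)"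
        using sq_norm_diff_le2[OF sq_intD[OF sq_int_diff[OF u(1)[of m] f]] sq_intD[OF sq_int_diff[OF u(1)[of n] f]]] by simp
      also have "\<dots> \<le> ennreal e"
        using N[OF that(1)] N[OF that(2)] e by (intro two_quarters_le) auto
      finally show ?thesis .
    qed
    then show "\<exists>N. \<forall>m\<ge>N. \<forall>n\<ge>N. sq_norm (leb d) (\<lambda>\<xi>. fourier d (u m) \<xi> - fourier d (u n) \<xi>) \<le> ennreal e" by blast
  qed
  then obtain F where F: "F \<in> sq_int (leb d)" "(\<lambda>n. sq_norm (leb d) (\<lambda>\<xi>. fourier d (u n) \<xi> - F \<xi>)) \<longlonglongrightarrow> 0" by blast
  have "?P F" unfolding L2_eq_sq_int L2cnorm_tendsto_0_iff using F u l by auto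
  then have "?P (fourier_L2 d f)" unfolding fourier_L2_def by (rule someI[of ?P])
  then show "fourier_L2 d f \<in> sq_int (leb d)"
    "\<exists>u. fourier_approx d u f"
    unfolding L2_eq_sq_int L2cnorm_tendsto_0_iff fourier_approx_def by blast+
qed

lemma fourier_L2_isometry:
  assumes f: "f \<in> sq_int (leb d)"
  shows "sq_norm (leb d) (fourier_L2 d f) = sq_norm (leb d) f"
proof -
  obtain u where uA: "fourier_approx d u f"
    using fourier_L2_spec(2)[OF f] by blast
  note u = fourier_approxD[OF uA]
  have "(\<lambda>n. sq_norm (leb d) (u n)) \<longlonglongrightarrow> sq_norm (leb d) f" by (rule sq_norm_tendsto[OF u(2) f u(3)])
  moreover have "(\<lambda>n. sq_norm (leb d) (fourier d (u n))) \<longlonglongrightarrow> sq_norm (leb d) (fourier_L2 d f)"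
    by (rule sq_norm_tendsto[OF fourier_isometry(2)[OF u(1,2)] fourier_L2_spec(1)[OF f] u(4)])
  ultimately show ?thesis using fourier_isometry(1)[OF u(1,2)] by (auto intro: LIMSEQ_unique)
qed

text \<open>The three transforms are limits along unrelated sequences. The combination
  \<open>w n - (u n - v n)\<close> tends to 0, so its transform does too by isometry; but the norms
  of these transforms also converge to the norm of the defect of additivity.\<close>

lemma fourier_L2_diff:
  assumes f: "f \<in> sq_int (leb d)" and g: "g \<in> sq_int (leb d)"
  shows "AE \<xi> in leb d. fourier_L2 d (\<lambda>x. f x - g x) \<xi> = fourier_L2 d f \<xi> - fourier_L2 d g \<xi>"
proof -
  let ?M = "leb d" and ?h = "\<lambda>x. f x - g x"
  have h: "?h \<in> sq_int ?M" using f g by (rule sq_int_diff)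
  obtain u where uA: "fourier_approx d u f"
    using fourier_L2_spec(2)[OF f] by blast
  note u = fourier_approxD[OF uA]
  obtain v where vA: "fourier_approx d v g"
    using fourier_L2_spec(2)[OF g] by blast
  note v = fourier_approxD[OF vA]
  obtain w where wA: "fourier_approx d w ?h"
    using fourier_L2_spec(2)[OF h] by blast
  note w = fourier_approxD[OF wA]
  note sq = sq_int_diff u(2) v(2) w(2) f g h fourier_isometry(2)[OF u(1,2)] fourier_isometry(2)[OF v(1,2)] fourier_isometry(2)[OF w(1,2)]
     fourier_L2_spec(1)[OF f] fourier_L2_spec(1)[OF g] fourier_L2_spec(1)[OF h]
  let ?z = "\<lambda>n x. w n x - (u n x - v n x)"
  have "(\<lambda>n. sq_norm ?M (\<lambda>x. (w n x - (u n x - v n x)) - (?h x - (f x - g x)))) \<longlonglongrightarrow> 0"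
    by (intro sq_norm_tendsto_0_diff u(3,4) v(3,4) w(3,4) sq)
  then have z0: "(\<lambda>n. sq_norm ?M (?z n)) \<longlonglongrightarrow> 0" by simp
  have "(\<lambda>n. sq_norm ?M (\<lambda>\<xi>. (fourier d (w n) \<xi> - (fourier d (u n) \<xi> - fourier d (v n) \<xi>)) - (fourier_L2 d ?h \<xi> - (fourier_L2 d f \<xi> - fourier_L2 d g \<xi>)))) \<longlonglongrightarrow> 0"
    by (intro sq_norm_tendsto_0_diff u(3,4) v(3,4) w(3,4) sq)
  then have "(\<lambda>n. sq_norm ?M (\<lambda>\<xi>. fourier d (w n) \<xi> - (fourier d (u n) \<xi> - fourier d (v n) \<xi>))) \<longlonglongrightarrow> sq_norm ?M (\<lambda>\<xi>. fourier_L2 d ?h \<xi> - (fourier_L2 d f \<xi> - fourier_L2 d g \<xi>))"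
    by (intro sq_norm_tendsto sq)
  moreover have "sq_norm ?M (\<lambda>\<xi>. fourier d (w n) \<xi> - (fourier d (u n) \<xi> - fourier d (v n) \<xi>)) = sq_norm ?M (?z n)" for n
  proof -
    have "(\<lambda>\<xi>. fourier d (w n) \<xi> - (fourier d (u n) \<xi> - fourier d (v n) \<xi>)) = fourier d (?z n)"
      by (rule ext) (simp add: fourier_diff u(1) v(1) w(1))
    then show ?thesis by (simp only:) (intro fourier_isometry(1) sq Bochner_Integration.integrable_diff u(1) v(1) w(1))
  qed
  ultimately have "sq_norm ?M (\<lambda>\<xi>. fourier_L2 d ?h \<xi> - (fourier_L2 d f \<xi> - fourier_L2 d g \<xi>)) = 0"
    using z0 by (auto intro: LIMSEQ_unique)
  from sq_norm_eq_0D[OF sq_intD this] have "AE \<xi> in ?M. fourier_L2 d ?h \<xi> - (fourier_L2 d f \<xi> - fourier_L2 d g \<xi>) = 0"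
    by (simp add: sq)
  then show ?thesis by simp
qed

lemma fourier_L2_multiplication:
  assumes f: "f \<in> sq_int (leb d)" and g: "g \<in> sq_int (leb d)"
  shows "(\<integral>\<xi>. fourier_L2 d f \<xi> * g \<xi> \<partial>leb d) = (\<integral>x. f x * fourier_L2 d g x \<partial>leb d)"
proof -
  let ?M = "leb d"
  obtain u where uA: "fourier_approx d u f"
    using fourier_L2_spec(2)[OF f] by blast
  note u = fourier_approxD[OF uA]
  obtain v where vA: "fourier_approx d v g"
    using fourier_L2_spec(2)[OF g] by blast
  note v = fourier_approxD[OF vA]
  have "(\<lambda>n. \<integral>\<xi>. fourier d (u n) \<xi> * v n \<xi> \<partial>?M) \<longlonglongrightarrow> (\<integral>\<xi>. fourier_L2 d f \<xi> * g \<xi> \<partial>?M)"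
    by (rule integral_mult_tendsto[OF fourier_isometry(2)[OF u(1,2)] v(2) fourier_L2_spec(1)[OF f] g u(4) v(3)])
  moreover have "(\<lambda>n. \<integral>x. u n x * fourier d (v n) x \<partial>?M) \<longlonglongrightarrow> (\<integral>x. f x * fourier_L2 d g x \<partial>?M)"
    by (rule integral_mult_tendsto[OF u(2) fourier_isometry(2)[OF v(1,2)] f fourier_L2_spec(1)[OF g] u(3) v(4)])
  ultimately show ?thesis using fourier_multiplication[OF u(1,2) v(1,2)] by (auto intro: LIMSEQ_unique)
qed

text \<open>
  The Fourier transform \<open>F\<close> is an isometry which is symmetric for the bilinear pairing, so
  \<open>h \<mapsto> cnj (F (cnj h))\<close> is its adjoint and is itself an isometry.  Hence both compositions are the
  identity; no inversion formula is needed.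
\<close>

lemma fourier_L2_surj:
  assumes h: "h \<in> sq_int (leb d)"
  shows "\<exists>g\<in>sq_int (leb d). AE \<xi> in leb d. fourier_L2 d g \<xi> = h \<xi>"
proof -
  let ?M = "leb d"
  let ?k = "\<lambda>\<xi>. cnj (h \<xi>)"
  define g where "g x = cnj (fourier_L2 d ?k x)" for x
  have k: "?k \<in> sq_int ?M" by (rule sq_int_cnj[OF h])
  have g: "g \<in> sq_int ?M" unfolding g_def by (rule sq_int_cnj[OF fourier_L2_spec(1)[OF k]])
  let ?G = "fourier_L2 d g"
  have G: "?G \<in> sq_int ?M" by (rule fourier_L2_spec(1)[OF g])
  have ng: "sq_norm ?M g = sq_norm ?M h"
    unfolding g_def using fourier_L2_isometry[OF k] by (simp add: sq_norm_cnj)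
  have nG: "sq_norm ?M ?G = sq_norm ?M h" using fourier_L2_isometry[OF g] ng by simp
  \<comment> \<open>All four pairings among \<open>?G\<close> and \<open>h\<close> turn out to equal
    the same number \<open>S\<close> (for \<open>c2\<close> it matters that \<open>S\<close> is
    real), so the squared norm of \<open>?G - h\<close> is
    \<open>(S - S) - (S - S) = 0\<close>.\<close>
  define S where "S = complex_of_real (enn2real (sq_norm ?M h))"
  have "(\<integral>\<xi>. ?G \<xi> * cnj (h \<xi>) \<partial>?M) = (\<integral>x. g x * fourier_L2 d ?k x \<partial>?M)"
    by (rule fourier_L2_multiplication[OF g k])
  also have "\<dots> = (\<integral>x. g x * cnj (g x) \<partial>?M)" by (simp add: g_def)
  also have "\<dots> = S" by (simp add: sq_int_integral_self[OF g] ng S_def)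
  finally have c1: "(\<integral>\<xi>. ?G \<xi> * cnj (h \<xi>) \<partial>?M) = S" .
  have "(\<integral>\<xi>. cnj (?G \<xi> * cnj (h \<xi>)) \<partial>?M) = cnj S" unfolding c1[symmetric] by (rule Bochner_Integration.integral_cnj)
  then have c2: "(\<integral>\<xi>. h \<xi> * cnj (?G \<xi>) \<partial>?M) = S" by (simp add: S_def mult.commute)
  have c3: "(\<integral>\<xi>. ?G \<xi> * cnj (?G \<xi>) \<partial>?M) = S" by (simp add: sq_int_integral_self[OF G] nG S_def)
  have c4: "(\<integral>\<xi>. h \<xi> * cnj (h \<xi>) \<partial>?M) = S" by (simp add: sq_int_integral_self[OF h] S_def)
  note i = sq_int_mult_integrable[OF G sq_int_cnj[OF G]] sq_int_mult_integrable[OF G sq_int_cnj[OF h]]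
    sq_int_mult_integrable[OF h sq_int_cnj[OF G]] sq_int_mult_integrable[OF h sq_int_cnj[OF h]]
  let ?D = "\<lambda>\<xi>. ?G \<xi> - h \<xi>"
  have D: "?D \<in> sq_int ?M" by (rule sq_int_diff[OF G h])
  have "(\<integral>\<xi>. ?D \<xi> * cnj (?D \<xi>) \<partial>?M) = (\<integral>\<xi>. (?G \<xi> * cnj (?G \<xi>) - ?G \<xi> * cnj (h \<xi>)) - (h \<xi> * cnj (?G \<xi>) - h \<xi> * cnj (h \<xi>)) \<partial>?M)"
    by (simp add: algebra_simps)
  also have "\<dots> = (S - S) - (S - S)"
    unfolding Bochner_Integration.integral_diff[OF Bochner_Integration.integrable_diff[OF i(1,2)] Bochner_Integration.integrable_diff[OF i(3,4)]]
      Bochner_Integration.integral_diff[OF i(1,2)] Bochner_Integration.integral_diff[OF i(3,4)] c1 c2 c3 c4 ..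
  finally have "complex_of_real (enn2real (sq_norm ?M ?D)) = 0" unfolding sq_int_integral_self[OF D] by simp
  then have "enn2real (sq_norm ?M ?D) = 0" by (simp only: of_real_eq_0_iff)
  then have "sq_norm ?M ?D = 0" using sq_int_fin[OF D] by (auto simp: enn2real_eq_0_iff)
  from sq_norm_eq_0D[OF sq_intD[OF D] this] have "AE \<xi> in ?M. ?G \<xi> = h \<xi>" by simp
  then show ?thesis using g by blast
qed

section \<open>Multiplier operators\<close>

lemma multiplier_op_spec:
  assumes f: "f \<in> sq_int (leb d)" and m: "m \<in> borel_measurable (leb d)" and b: "AE \<xi> in leb d. cmod (m \<xi>) \<le> B"
  shows "multiplier_op d m f \<in> sq_int (leb d)"
    and "AE \<xi> in leb d. fourier_L2 d (multiplier_op d m f) \<xi> = m \<xi> * fourier_L2 d f \<xi>"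
proof -
  let ?P = "\<lambda>g. g \<in> L2 d \<and> (AE \<xi> in leb d. fourier_L2 d g \<xi> = m \<xi> * fourier_L2 d f \<xi>)"
  have "(\<lambda>\<xi>. m \<xi> * fourier_L2 d f \<xi>) \<in> sq_int (leb d)"
    by (rule sq_int_bounded_mult[OF fourier_L2_spec(1)[OF f] m b])
  \<comment> \<open>Surjectivity of the transform provides a witness for the choice in
    \<open>multiplier_op\<close>.\<close>
  from fourier_L2_surj[OF this] obtain g where "?P g" unfolding L2_eq_sq_int by blast
  then have "?P (multiplier_op d m f)" unfolding multiplier_op_def by (rule someI[of ?P])
  then show "multiplier_op d m f \<in> sq_int (leb d)"
    "AE \<xi> in leb d. fourier_L2 d (multiplier_op d m f) \<xi> = m \<xi> * fourier_L2 d f \<xi>"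
    by (auto simp: L2_eq_sq_int)
qed

lemma multiplier_op_sq_norm:
  assumes f: "f \<in> sq_int (leb d)" and m: "m \<in> borel_measurable (leb d)" and b: "AE \<xi> in leb d. cmod (m \<xi>) \<le> B"
  shows "sq_norm (leb d) (multiplier_op d m f) = sq_norm (leb d) (\<lambda>\<xi>. m \<xi> * fourier_L2 d f \<xi>)"
proof -
  have "sq_norm (leb d) (multiplier_op d m f) = sq_norm (leb d) (fourier_L2 d (multiplier_op d m f))"
    by (rule fourier_L2_isometry[symmetric, OF multiplier_op_spec(1)[OF f m b]])
  also have "\<dots> = sq_norm (leb d) (\<lambda>\<xi>. m \<xi> * fourier_L2 d f \<xi>)"
    by (rule sq_norm_cong_AE, use multiplier_op_spec(2)[OF f m b] in eventually_elim) simp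
  finally show ?thesis .
qed

text \<open>The two operators are chosen separately, so their difference is tied to the multiplier
  \<open>m - m'\<close> only through the almost everywhere additivity of
  \<open>fourier_L2\<close>.\<close>

lemma multiplier_op_diff_sq_norm:
  assumes f: "f \<in> sq_int (leb d)"
    and m: "m \<in> borel_measurable (leb d)" and b: "AE \<xi> in leb d. cmod (m \<xi>) \<le> B"
    and m': "m' \<in> borel_measurable (leb d)" and b': "AE \<xi> in leb d. cmod (m' \<xi>) \<le> B'"
  shows "sq_norm (leb d) (\<lambda>x. multiplier_op d m f x - multiplier_op d m' f x)
    = sq_norm (leb d) (\<lambda>\<xi>. (m \<xi> - m' \<xi>) * fourier_L2 d f \<xi>)"
proof -
  note s = multiplier_op_spec[OF f m b] multiplier_op_spec[OF f m' b']
  have "sq_norm (leb d) (\<lambda>x. multiplier_op d m f x - multiplier_op d m' f x)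
    = sq_norm (leb d) (fourier_L2 d (\<lambda>x. multiplier_op d m f x - multiplier_op d m' f x))"
    by (rule fourier_L2_isometry[symmetric, OF sq_int_diff[OF s(1) s(3)]])
  also have "\<dots> = sq_norm (leb d) (\<lambda>\<xi>. (m \<xi> - m' \<xi>) * fourier_L2 d f \<xi>)"
    by (rule sq_norm_cong_AE, use s(2,4) fourier_L2_diff[OF s(1,3)] in eventually_elim) (simp add: left_diff_distrib)
  finally show ?thesis .
qed

section \<open>Absolutely continuous functions with bounded derivative\<close>

text \<open>Cousin's lemma gives a tagged division subordinate to a gauge that treats tags in the
  exceptional null set separately; the increment of \<open>f\<close> is then estimated piece by
  piece, without integrating the derivative.\<close>

lemma abs_continuous_bound:
  fixes f :: "real \<Rightarrow> complex"
  assumes rs: "r < s" and ac: "abs_continuous_on r s f" and B: "0 \<le> B"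
    and ae: "AE t in lborel. r \<le> t \<and> t \<le> s \<longrightarrow> (\<exists>D. (f has_vector_derivative D) (at t) \<and> cmod D \<le> B)"
  shows "cmod (f s - f r) \<le> B * (s - r)"
proof (rule field_le_epsilon)
  fix e :: real assume e: "e > 0"
  \<comment> \<open>Intervals tagged in the null set contribute at most \<epsilon>, the others an
    excess of \<open>\<epsilon> * (s - r)\<close>; the normalisation makes these add up to
    \<open>e\<close>.\<close>
  define \<epsilon> where "\<epsilon> = e / (1 + (s - r))"
  have \<epsilon>: "\<epsilon> > 0" using e rs by (simp add: \<epsilon>_def)
  have \<epsilon>e: "\<epsilon> + \<epsilon> * (s - r) = e" 
  proof -
    have "\<epsilon> * (1 + (s - r)) = e" using rs by (simp add: \<epsilon>_def)
    then show ?thesis by (simp only: distrib_left mult_1_right)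
  qed
  obtain \<delta> where \<delta>: "\<delta> > 0" and acd: "\<And>(n::nat) (x::nat \<Rightarrow> real) (y::nat \<Rightarrow> real).
        (\<forall>k<n. r \<le> x k \<and> x k \<le> y k \<and> y k \<le> s) \<Longrightarrow>
        disjoint_family_on (\<lambda>k. {x k<..<y k}) {..<n} \<Longrightarrow>
        (\<Sum>k<n. y k - x k) < \<delta> \<Longrightarrow> (\<Sum>k<n. cmod (f (y k) - f (x k))) < \<epsilon>"
    using ac \<epsilon> unfolding abs_continuous_on_def by meson
  obtain N where N: "N \<in> null_sets lborel" "{t \<in> space lborel. \<not> (r \<le> t \<and> t \<le> s \<longrightarrow> (\<exists>D. (f has_vector_derivative D) (at t) \<and> cmod D \<le> B))} \<subseteq> N"
    using ae unfolding eventually_ae_filter by auto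
  have Nl: "N \<in> sets lebesgue" using N(1) by (auto simp: null_sets_def)
  obtain U where U: "open U" "N \<subseteq> U" "U - N \<in> lmeasurable" "emeasure lebesgue (U - N) < ennreal \<delta>"
    by (rule sets_lebesgue_outer_open[OF Nl \<delta>])
  have UN: "emeasure lborel U < ennreal \<delta>"
  proof -
    have Nb: "N \<in> sets borel" using N(1) by auto
    have Ub: "U \<in> sets borel" using U(1) by auto
    have "emeasure lborel U = emeasure lborel (U - N)"
      using N(1) Ub by (simp add: emeasure_Diff_null_set)
    also have "\<dots> = emeasure lebesgue (U - N)" using Nb Ub by simp
    finally show ?thesis using U(4) by simp
  qed
  have "\<exists>D \<rho>. \<rho> > 0 \<and> cmod D \<le> B \<and> (\<forall>y. \<bar>y - t\<bar> < \<rho> \<longrightarrow> cmod (f y - f t - (y - t) *\<^sub>R D) \<le> \<epsilon> * \<bar>y - t\<bar>)"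
    if t: "t \<notin> N" "r \<le> t" "t \<le> s" for t
  proof -
    obtain D where D: "(f has_vector_derivative D) (at t)" "cmod D \<le> B"
      using N(2) t by auto
    then have "\<forall>e>0. \<exists>\<rho>>0. \<forall>y. \<bar>y - t\<bar> < \<rho> \<longrightarrow> cmod (f y - f t - (y - t) *\<^sub>R D) \<le> e * \<bar>y - t\<bar>"
      unfolding has_vector_derivative_def has_derivative_at_alt by (simp add: real_norm_def)
    then show ?thesis using D(2) \<epsilon> by blast
  qed
  then obtain D \<rho> where D: "\<And>t. t \<notin> N \<Longrightarrow> r \<le> t \<Longrightarrow> t \<le> s \<Longrightarrow> \<rho> t > 0 \<and> cmod (D t) \<le> B \<and> (\<forall>y. \<bar>y - t\<bar> < \<rho> t \<longrightarrow> cmod (f y - f t - (y - t) *\<^sub>R D t) \<le> \<epsilon> * \<bar>y - t\<bar>)"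
    by metis
  \<comment> \<open>The unit ball is a default for the remaining points, which lie outside
    \<open>{r..s}\<close>; it only makes \<gamma> a gauge on the whole line.\<close>
  define \<gamma> where "\<gamma> t = (if t \<in> N then U else if r \<le> t \<and> t \<le> s then ball t (\<rho> t) else ball t 1)" for t
  \<comment> \<open>Intervals of a fine division tagged in \<open>N\<close> have total length below \<open>\<delta>\<close>, so absolute
    continuity controls them; on the other intervals the derivative does.\<close>
  have "gauge \<gamma>" unfolding gauge_def \<gamma>_def using U D by auto
  then obtain p where p: "p tagged_division_of {r..s}" "\<gamma> fine p"
    using fine_division_exists_real by blast
  have fin: "finite p" using p(1) by blast
  have K: "\<exists>u v. k = {u..v} \<and> u \<le> x \<and> x \<le> v \<and> r \<le> u \<and> v \<le> s \<and> k \<subseteq> \<gamma> x" if xk: "(x, k) \<in> p" for x k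
  proof -
    obtain u v where k: "k = cbox u v" using tagged_division_ofD(4)[OF p(1) xk] by blast
    have "x \<in> k" "k \<subseteq> {r..s}" using tagged_division_ofD(2,3)[OF p(1) xk] by auto
    moreover have "k \<subseteq> \<gamma> x" using p(2) xk by (auto simp: fine_def)
    ultimately show ?thesis using k by (intro exI[of _ u] exI[of _ v]) auto
  qed
  let ?L = "\<lambda>q. Inf (snd q)" and ?R = "\<lambda>q. Sup (snd q)"
  have LR: "snd q = {?L q..?R q} \<and> ?L q \<le> fst q \<and> fst q \<le> ?R q \<and> r \<le> ?L q \<and> ?R q \<le> s \<and> {?L q..?R q} \<subseteq> \<gamma> (fst q)" if q: "q \<in> p" for q
  proof -
    obtain x k where xk: "q = (x, k)" by (cases q)
    obtain u v where uv: "k = {u..v} \<and> u \<le> x \<and> x \<le> v \<and> r \<le> u \<and> v \<le> s \<and> k \<subseteq> \<gamma> x" using K q xk by blast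
    then have "Inf k = u" "Sup k = v" by auto
    then show ?thesis using uv xk by auto
  qed
  define p1 where "p1 = {q \<in> p. fst q \<in> N}"
  define p2 where "p2 = {q \<in> p. fst q \<notin> N}"
  have pp: "p = p1 \<union> p2" "p1 \<inter> p2 = {}" "finite p1" "finite p2" using fin by (auto simp: p1_def p2_def)
  have tele: "(\<Sum>q\<in>p. g (?R q) - g (?L q)) = g s - g r" for g :: "real \<Rightarrow> 'b::real_normed_vector"
    using additive_tagged_division_1[of r s p g] p(1) rs by (simp add: case_prod_beta)
  have "cmod (f s - f r) = cmod (\<Sum>q\<in>p. f (?R q) - f (?L q))" by (simp add: tele)
  also have "\<dots> \<le> (\<Sum>q\<in>p. cmod (f (?R q) - f (?L q)))" by (rule norm_sum)
  also have "\<dots> = (\<Sum>q\<in>p1. cmod (f (?R q) - f (?L q))) + (\<Sum>q\<in>p2. cmod (f (?R q) - f (?L q)))"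
    using pp by (simp add: sum.union_disjoint)
  also have "(\<Sum>q\<in>p2. cmod (f (?R q) - f (?L q))) \<le> (\<Sum>q\<in>p2. (B + \<epsilon>) * (?R q - ?L q))"
  proof (rule sum_mono)
    fix q assume "q \<in> p2"
    then have q: "q \<in> p" "fst q \<notin> N" by (auto simp: p2_def)
    let ?t = "fst q"
    note lr = LR[OF q(1)]
    have t: "r \<le> ?t" "?t \<le> s" using lr by auto
    have g: "\<gamma> ?t = ball ?t (\<rho> ?t)" using q t by (simp add: \<gamma>_def)
    have "?L q \<in> {?L q..?R q}" "?R q \<in> {?L q..?R q}" using lr by auto
    moreover have "{?L q..?R q} \<subseteq> ball ?t (\<rho> ?t)" using lr unfolding g[symmetric] by blast
    ultimately have "?L q \<in> ball ?t (\<rho> ?t)" "?R q \<in> ball ?t (\<rho> ?t)" by blast+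
    then have "\<bar>?L q - ?t\<bar> < \<rho> ?t" "\<bar>?R q - ?t\<bar> < \<rho> ?t"
      by (simp_all only: mem_ball dist_real_def abs_minus_commute[of ?t])
    then have 1: "cmod (f (?L q) - f ?t - (?L q - ?t) *\<^sub>R D ?t) \<le> \<epsilon> * \<bar>?L q - ?t\<bar>"
      and 2: "cmod (f (?R q) - f ?t - (?R q - ?t) *\<^sub>R D ?t) \<le> \<epsilon> * \<bar>?R q - ?t\<bar>"
      and 3: "cmod (D ?t) \<le> B" using D[OF q(2) t] by auto
    \<comment> \<open>The tag lies in its interval, so its distances to the two ends add up to the
      length; this is why comparing both end points with the tag costs only a single \<epsilon> per
      unit of length.\<close>
    have "f (?R q) - f (?L q) = (f (?R q) - f ?t - (?R q - ?t) *\<^sub>R D ?t) - (f (?L q) - f ?t - (?L q - ?t) *\<^sub>R D ?t) + (?R q - ?L q) *\<^sub>R D ?t"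
      by (simp add: algebra_simps)
    also have "cmod \<dots> \<le> \<epsilon> * \<bar>?R q - ?t\<bar> + \<epsilon> * \<bar>?L q - ?t\<bar> + (?R q - ?L q) * B"
    proof (rule order_trans[OF norm_triangle_ineq] , rule add_mono)
      show "cmod (f (?R q) - f ?t - (?R q - ?t) *\<^sub>R D ?t - (f (?L q) - f ?t - (?L q - ?t) *\<^sub>R D ?t)) \<le> \<epsilon> * \<bar>?R q - ?t\<bar> + \<epsilon> * \<bar>?L q - ?t\<bar>"
        by (rule order_trans[OF norm_triangle_ineq4]) (intro add_mono 1 2)
      show "cmod ((?R q - ?L q) *\<^sub>R D ?t) \<le> (?R q - ?L q) * B"
        using lr by (simp add: mult_left_mono 3)
    qed
    also have "\<dots> = (B + \<epsilon>) * (?R q - ?L q)" using lr by (simp add: algebra_simps)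
    finally show "cmod (f (?R q) - f (?L q)) \<le> (B + \<epsilon>) * (?R q - ?L q)" .
  qed
  also have "\<dots> \<le> (\<Sum>q\<in>p. (B + \<epsilon>) * (?R q - ?L q))"
    using LR B \<epsilon> by (intro sum_mono2 fin) (fastforce simp: p2_def)+
  also have "\<dots> = (B + \<epsilon>) * (s - r)"
    using tele[of "\<lambda>x. x"] by (simp flip: sum_distrib_left)
  also have "(\<Sum>q\<in>p1. cmod (f (?R q) - f (?L q))) \<le> \<epsilon>"
  proof -
    \<comment> \<open>Absolute continuity is stated for families indexed by initial segments of the
      naturals, hence the enumeration of \<open>p1\<close>.\<close>
    obtain h where h: "bij_betw h {..<card p1} p1"
      using ex_bij_betw_nat_finite[OF pp(3)] by (auto simp: atLeast0LessThan)
    have hp: "h k \<in> p1" if "k < card p1" for k using h that by (auto simp: bij_betw_def)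
    have disj: "disjoint_family_on (\<lambda>q. {?L q<..<?R q}) p1"
      unfolding disjoint_family_on_def
    proof (intro ballI impI)
      fix q q' assume q: "q \<in> p1" "q' \<in> p1" "q \<noteq> q'"
      then have qp: "q \<in> p" "q' \<in> p" by (auto simp: p1_def)
      have "interior (snd q) \<inter> interior (snd q') = {}"
        using tagged_division_ofD(5)[OF p(1), of "fst q" "snd q" "fst q'" "snd q'"] qp q(3) by (auto simp: prod_eq_iff)
      moreover have "interior (snd q) = {?L q<..<?R q}" using LR[OF qp(1)] by (metis interior_atLeastAtMost_real)
      moreover have "interior (snd q') = {?L q'<..<?R q'}" using LR[OF qp(2)] by (metis interior_atLeastAtMost_real)
      ultimately show "{?L q<..<?R q} \<inter> {?L q'<..<?R q'} = {}" by simp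
    qed
    have "ennreal (\<Sum>q\<in>p1. ?R q - ?L q) = (\<Sum>q\<in>p1. ennreal (?R q - ?L q))"
      using LR by (intro sum_ennreal[symmetric]) (fastforce simp: p1_def)
    also have "\<dots> = (\<Sum>q\<in>p1. emeasure lborel {?L q<..<?R q})"
      using LR by (intro sum.cong refl) (fastforce simp: p1_def)
    also have "\<dots> = emeasure lborel (\<Union>q\<in>p1. {?L q<..<?R q})"
      by (rule sum_emeasure[OF _ disj pp(3)]) auto
    also have "\<dots> \<le> emeasure lborel U"
    proof (rule emeasure_mono)
      show "(\<Union>q\<in>p1. {?L q<..<?R q}) \<subseteq> U"
      proof (rule UN_least)
        fix q assume "q \<in> p1"
        then have "{?L q..?R q} \<subseteq> U" using LR[of q] by (auto simp: p1_def \<gamma>_def)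
        then show "{?L q<..<?R q} \<subseteq> U" by (meson greaterThanLessThan_subseteq_atLeastAtMost_iff order.refl subset_trans)
      qed
    qed (use U in auto)
    also have "\<dots> < ennreal \<delta>" by fact
    finally have "(\<Sum>q\<in>p1. ?R q - ?L q) < \<delta>" using ennreal_leI by (meson not_le)
    then have "(\<Sum>k<card p1. ?R (h k) - ?L (h k)) < \<delta>" 
      by (simp only: sum.reindex_bij_betw[OF h, of "\<lambda>q. ?R q - ?L q"])
    moreover have "\<forall>k<card p1. r \<le> ?L (h k) \<and> ?L (h k) \<le> ?R (h k) \<and> ?R (h k) \<le> s"
      using LR hp by (fastforce simp: p1_def)
    moreover have "disjoint_family_on (\<lambda>k. {?L (h k)<..<?R (h k)}) {..<card p1}"
      unfolding disjoint_family_on_def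
    proof (intro ballI impI)
      fix m n assume mn: "m \<in> {..<card p1}" "n \<in> {..<card p1}" "m \<noteq> n"
      then have "h m \<noteq> h n" using h by (auto simp: bij_betw_def inj_on_def)
      then show "{?L (h m)<..<?R (h m)} \<inter> {?L (h n)<..<?R (h n)} = {}"
        using disj hp mn by (simp add: disjoint_family_on_def)
    qed
    ultimately have "(\<Sum>k<card p1. cmod (f (?R (h k)) - f (?L (h k)))) < \<epsilon>"
      by (intro acd)
    then show ?thesis 
      by (simp only: sum.reindex_bij_betw[OF h, of "\<lambda>q. cmod (f (?R q) - f (?L q))"])
  qed
  finally show "cmod (f s - f r) \<le> B * (s - r) + e" using \<epsilon>e by (simp add: algebra_simps)
qed

section \<open>Dilations, measurability and radial derivatives\<close>

lemma space_PM: "space (PM d) = {..<d} \<rightarrow>\<^sub>E UNIV"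
  by (simp add: space_PiM)

lemma space_leb: "space (leb d) = {..<d} \<rightarrow>\<^sub>E UNIV"
  by (simp add: leb_def space_PM)

lemma vscale_space: "vscale d t \<xi> \<in> {..<d} \<rightarrow>\<^sub>E UNIV"
  by (simp add: vscale_def)

lemma vscale_measurable_pair[measurable (raw)]:
  assumes [measurable]: "f \<in> measurable N (PM d)" "g \<in> borel_measurable N"
  shows "(\<lambda>z. vscale d (g z) (f z)) \<in> measurable N (PM d)"
  unfolding vscale_def
proof (rule measurable_restrict)
  fix i assume i: "i \<in> {..<d}"
  have "(\<lambda>z. f z i) \<in> borel_measurable N"
    using measurable_compose[OF assms(1) measurable_component_singleton[OF i]] by simp
  then show "(\<lambda>z. g z * f z i) \<in> measurable N lborel" by simp
qed

lemma lborel_scale: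
  assumes t: "t > 0" and A: "A \<in> sets borel"
  shows "ennreal t * emeasure lborel ((\<lambda>x. t * x) -` A) = emeasure lborel (A :: real set)"
proof -
  have "emeasure lborel A = emeasure (density (distr lborel borel (\<lambda>x. 0 + t * x)) (\<lambda>_. ennreal \<bar>t\<bar>)) A"
    by (subst lborel_real_affine[of t 0]) (use t in auto)
  also have "\<dots> = ennreal t * emeasure lborel ((\<lambda>x. t * x) -` A)"
    using t A by (subst emeasure_density_const) (auto simp: emeasure_distr)
  finally show ?thesis by simp
qed

text \<open>Uniqueness of the product measure: on a box, each of the \<open>d\<close> factors
  \<open>t\<close> is absorbed by one coordinate.\<close>

lemma PM_scale:
  assumes t: "t > 0"
  shows "scale_measure (ennreal t ^ d) (distr (PM d) (PM d) (vscale d t)) = PM d"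
proof (rule lborels.PiM_eqI)
  fix A :: "nat \<Rightarrow> real set" assume A: "\<And>i. i \<in> {..<d} \<Longrightarrow> A i \<in> sets lborel"
  have "vscale d t -` (Pi\<^sub>E {..<d} A) \<inter> space (PM d) = Pi\<^sub>E {..<d} (\<lambda>i. (\<lambda>x. t * x) -` A i)"
    by (auto simp: space_PM vscale_def PiE_def Pi_def)
  moreover have "(\<lambda>x. t * x) -` A i \<in> sets borel" if "i \<in> {..<d}" for i
    using measurable_sets_borel[of "\<lambda>x. t * x" borel "A i"] A[OF that] by simp
  ultimately have "emeasure (scale_measure (ennreal t ^ d) (distr (PM d) (PM d) (vscale d t))) (Pi\<^sub>E {..<d} A)
     = ennreal t ^ d * (\<Prod>i<d. emeasure lborel ((\<lambda>x. t * x) -` A i))"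
    using A by (subst emeasure_scale_measure, subst emeasure_distr)
      (auto intro!: sets_PiM_I_finite vscale_measurable_pair arg_cong2[where f="(*)"] lborels.emeasure_PiM)
  also have "\<dots> = (\<Prod>i<d. ennreal t * emeasure lborel ((\<lambda>x. t * x) -` A i))"
    by (simp add: prod.distrib)
  also have "\<dots> = (\<Prod>i<d. emeasure lborel (A i))"
    using A by (intro prod.cong refl lborel_scale[OF t]) auto
  finally show "emeasure (scale_measure (ennreal t ^ d) (distr (PM d) (PM d) (vscale d t))) (Pi\<^sub>E {..<d} A) = (\<Prod>i<d. emeasure lborel (A i))" .
qed simp_all

lemma null_sets_scale:
  assumes t: "t > 0" and N: "N \<in> null_sets (PM d)"
  shows "vscale d t -` N \<inter> space (PM d) \<in> null_sets (PM d)"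
proof -
  have m: "vscale d t \<in> measurable (PM d) (PM d)" by measurable
  have Ns: "N \<in> sets (PM d)" using N by auto
  have "emeasure (scale_measure (ennreal t ^ d) (distr (PM d) (PM d) (vscale d t))) N = 0"
    using N unfolding PM_scale[OF t] by auto
  then have "ennreal t ^ d * emeasure (PM d) (vscale d t -` N \<inter> space (PM d)) = 0"
    using Ns m by (simp add: emeasure_scale_measure emeasure_distr)
  moreover have "ennreal t ^ d \<noteq> 0" using t by simp
  ultimately have "emeasure (PM d) (vscale d t -` N \<inter> space (PM d)) = 0" by auto
  then show ?thesis using measurable_sets[OF m Ns] by auto
qed

lemma AE_scale:
  assumes t: "t > 0" and P: "AE \<xi> in leb d. P \<xi>"
  shows "AE \<xi> in leb d. P (vscale d t \<xi>)"
proof -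
  have "AE \<xi> in PM d. P \<xi>" using P by (simp only: AE_leb_iff)
  then obtain N where N: "N \<in> null_sets (PM d)" "{\<xi> \<in> space (PM d). \<not> P \<xi>} \<subseteq> N"
    unfolding eventually_ae_filter by auto
  have "{\<xi> \<in> space (PM d). \<not> P (vscale d t \<xi>)} \<subseteq> vscale d t -` N \<inter> space (PM d)"
    using N(2) vscale_space[of d t] unfolding space_PM by blast
  then have "AE \<xi> in PM d. P (vscale d t \<xi>)"
    using null_sets_scale[OF t N(1)] by (rule AE_I'[rotated])
  then show ?thesis by (simp only: AE_leb_iff)
qed

text \<open>For each \<open>t > 0\<close> the \<xi> for which \<open>vscale d t \<xi>\<close> is
  exceptional form a null set, so by Tonelli almost every \<xi> has a null set of exceptional
  \<open>t\<close>. A property of almost every point thereby becomes one of almost every point of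
  almost every ray.\<close>

lemma AE_AE_scale:
  assumes P: "AE \<xi> in leb d. P \<xi>"
  shows "AE \<xi> in leb d. AE t in lborel. 0 < t \<longrightarrow> P (vscale d t \<xi>)"
proof -
  interpret S: sigma_finite_measure "PM d" by (rule sigma_finite_PM)
  interpret PL: pair_sigma_finite "PM d" "lborel :: real measure" ..
  have "AE \<xi> in PM d. P \<xi>" using P by (simp only: AE_leb_iff)
  then obtain N where N: "N \<in> null_sets (PM d)" "{\<xi> \<in> space (PM d). \<not> P \<xi>} \<subseteq> N"
    unfolding eventually_ae_filter by auto
  have Ns[measurable]: "N \<in> sets (PM d)" using N by auto
  let ?g = "\<lambda>\<xi> t. indicator {0<..} t * indicator N (vscale d t \<xi>) :: ennreal"
  have "(\<integral>\<^sup>+\<xi>. (\<integral>\<^sup>+t. ?g \<xi> t \<partial>lborel) \<partial>PM d) = (\<integral>\<^sup>+t. (\<integral>\<^sup>+\<xi>. ?g \<xi> t \<partial>PM d) \<partial>lborel)"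
    by (rule PL.Fubini'[symmetric]) measurable
  also have "\<dots> = (\<integral>\<^sup>+t. 0 \<partial>(lborel :: real measure))"
  proof (rule nn_integral_cong)
    fix t :: real
    show "(\<integral>\<^sup>+\<xi>. ?g \<xi> t \<partial>PM d) = 0"
    proof (cases "t > 0")
      case True
      have "(\<integral>\<^sup>+\<xi>. ?g \<xi> t \<partial>PM d) = (\<integral>\<^sup>+\<xi>. indicator (vscale d t -` N \<inter> space (PM d)) \<xi> \<partial>PM d)"
        by (intro nn_integral_cong) (use True in \<open>auto simp: indicator_def\<close>)
      also have "\<dots> = 0" using null_sets_scale[OF True N(1)] by (subst nn_integral_indicator) auto
      finally show ?thesis .
    qed simp
  qed
  finally have "(\<integral>\<^sup>+\<xi>. (\<integral>\<^sup>+t. ?g \<xi> t \<partial>lborel) \<partial>PM d) = 0" by simp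
  then have "AE \<xi> in PM d. (\<integral>\<^sup>+t. ?g \<xi> t \<partial>lborel) = 0"
    by (subst (asm) nn_integral_0_iff_AE) measurable
  then have "AE \<xi> in PM d. AE t in lborel. 0 < t \<longrightarrow> P (vscale d t \<xi>)"
    using AE_space
  proof eventually_elim
    case (elim \<xi>)
    have "\<xi> \<in> space (PM d)" by fact
    have [measurable]: "(\<lambda>t. vscale d t \<xi>) \<in> measurable lborel (PM d)"
      by (rule vscale_measurable_pair) (use elim(2) in auto)
    have "AE t in lborel. ?g \<xi> t = 0"
      using elim(1) by (subst (asm) nn_integral_0_iff_AE) auto
    then show ?case
    proof eventually_elim
      case (elim t)
      then show ?case using N(2) vscale_space[of d t \<xi>] by (auto simp: space_PM indicator_def split: if_splits)
    qed
  qed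
  then show ?thesis by (simp only: AE_leb_iff)
qed

lemma measurable_leb_cong_AE:
  assumes g[measurable]: "g \<in> borel_measurable (leb d)" and ae: "AE x in leb d. f x = g x"
  shows "f \<in> borel_measurable (leb d)"
proof (rule measurableI)
  fix A :: "'a set" assume A: "A \<in> sets borel"
  show "f -` A \<inter> space (leb d) \<in> sets (leb d)"
    unfolding leb_def
  proof (rule completion.in_sets_AE)
    show "g -` A \<inter> space (leb d) \<in> sets (completion (PM d))"
      using measurable_sets[OF g A] by (simp add: leb_def)
    show "AE x in completion (PM d). (x \<in> g -` A \<inter> space (leb d)) = (x \<in> f -` A \<inter> space (completion (PM d)))"
      using ae unfolding leb_def by eventually_elim auto
  qed auto
qed auto

text \<open>Dilation is Borel measurable, but for sets of the completion one also has to know that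
  null sets pull back to null sets; hence the route through a Borel representative and
  \<open>AE_scale\<close>.\<close>

lemma measurable_leb_scale:
  fixes f :: "(nat \<Rightarrow> real) \<Rightarrow> complex"
  assumes t: "t > 0" and f: "f \<in> borel_measurable (leb d)"
  shows "(\<lambda>\<xi>. f (vscale d t \<xi>)) \<in> borel_measurable (leb d)"
proof -
  obtain g where g[measurable]: "g \<in> borel_measurable (PM d)" and ae: "AE x in PM d. f x = g x"
    using leb_ex_borel_measurable[OF f] by blast
  have ae: "AE x in leb d. f x = g x" using ae by (simp only: AE_leb_iff)
  show ?thesis
  proof (rule measurable_leb_cong_AE)
    show "(\<lambda>\<xi>. g (vscale d t \<xi>)) \<in> borel_measurable (leb d)"
      by (rule measurable_lebI) measurable
    show "AE x in leb d. f (vscale d t x) = g (vscale d t x)" by (rule AE_scale[OF t ae])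
  qed
qed

section \<open>Points of differentiability: continuity, partial derivatives, derivatives along
  rays\<close>

lemma vnorm_le_sum: "vnorm d x \<le> (\<Sum>i<d. \<bar>x i\<bar>)"
  unfolding vnorm_def by (rule L2_set_le_sum_abs)

lemma component_le_vnorm: "i < d \<Longrightarrow> \<bar>x i\<bar> \<le> vnorm d x"
  unfolding vnorm_def using member_le_L2_set[of "{..<d}" i "\<lambda>i. \<bar>x i\<bar>"] by (simp add: L2_set_def)

lemma vnorm_nonneg: "0 \<le> vnorm d x"
  by (simp add: vnorm_def)

lemma vnorm_vscale: "t \<ge> 0 \<Longrightarrow> vnorm d (vscale d t \<xi>) = t * vnorm d \<xi>"
  unfolding vnorm_def L2_set_right_distrib by (intro L2_set_cong) (auto simp: vscale_def)

definition near_linear ::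
    "nat \<Rightarrow> ((nat \<Rightarrow> real) \<Rightarrow> complex) \<Rightarrow> (nat \<Rightarrow> complex) \<Rightarrow> (nat \<Rightarrow> real) \<Rightarrow> real \<Rightarrow> real \<Rightarrow> bool" where
  "near_linear d a v \<xi> \<epsilon> \<delta> \<longleftrightarrow> (\<forall>\<eta>\<in>space (leb d). vnorm d (\<lambda>i. \<eta> i - \<xi> i) < \<delta> \<longrightarrow>
     cmod (a \<eta> - a \<xi> - (\<Sum>i<d. (\<eta> i - \<xi> i) *\<^sub>R v i)) \<le> \<epsilon> * vnorm d (\<lambda>i. \<eta> i - \<xi> i))"

lemma differentiable_pt_iff:
  "differentiable_pt d a \<xi> \<longleftrightarrow> (\<exists>v. \<forall>\<epsilon>>0. \<exists>\<delta>>0. near_linear d a v \<xi> \<epsilon> \<delta>)"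
  by (simp add: differentiable_pt_def near_linear_def)

lemma near_linearD:
  assumes "near_linear d a v \<xi> \<epsilon> \<delta>" "\<eta> \<in> space (leb d)" "vnorm d (\<lambda>i. \<eta> i - \<xi> i) < \<delta>"
  shows "cmod (a \<eta> - a \<xi> - (\<Sum>i<d. (\<eta> i - \<xi> i) *\<^sub>R v i)) \<le> \<epsilon> * vnorm d (\<lambda>i. \<eta> i - \<xi> i)"
  using assms by (simp add: near_linear_def)

text \<open>The differential together with the error bound for \<epsilon> = 1 gives |a \<eta> - a
  \<xi>| \<le> C |\<eta> - \<xi>| near \<xi>.\<close>

lemma differentiable_pt_tendsto:
  assumes D: "differentiable_pt d a \<xi>" and q: "\<And>n. q n \<in> space (leb d)"
    and l: "(\<lambda>n. vnorm d (\<lambda>i. q n i - \<xi> i)) \<longlonglongrightarrow> 0"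
  shows "(\<lambda>n. a (q n)) \<longlonglongrightarrow> a \<xi>"
proof -
  obtain v \<delta> where \<delta>: "\<delta> > 0" and v: "near_linear d a v \<xi> 1 \<delta>"
    using D zero_less_one unfolding differentiable_pt_iff by blast
  define C where "C = 1 + (\<Sum>i<d. cmod (v i))"
  have "(\<lambda>n. a (q n) - a \<xi>) \<longlonglongrightarrow> 0"
  proof (rule Lim_null_comparison)
    show "(\<lambda>n. C * vnorm d (\<lambda>i. q n i - \<xi> i)) \<longlonglongrightarrow> 0"
      using tendsto_mult_left[OF l, of C] by simp
    have "\<forall>\<^sub>F n in sequentially. vnorm d (\<lambda>i. q n i - \<xi> i) < \<delta>"
      using l \<delta> by (rule order_tendstoD)
    then show "\<forall>\<^sub>F n in sequentially. norm (a (q n) - a \<xi>) \<le> C * vnorm d (\<lambda>i. q n i - \<xi> i)"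
    proof eventually_elim
      case (elim n)
      let ?N = "vnorm d (\<lambda>i. q n i - \<xi> i)" and ?S = "\<Sum>i<d. (q n i - \<xi> i) *\<^sub>R v i"
      have "cmod ?S \<le> (\<Sum>i<d. cmod ((q n i - \<xi> i) *\<^sub>R v i))" by (rule norm_sum)
      also have "\<dots> \<le> (\<Sum>i<d. ?N * cmod (v i))"
        using component_le_vnorm[of _ d "\<lambda>i. q n i - \<xi> i"] by (intro sum_mono) (auto intro!: mult_right_mono)
      finally have S: "cmod ?S \<le> ?N * (\<Sum>i<d. cmod (v i))" by (simp add: sum_distrib_left)
      have "cmod (a (q n) - a \<xi>) = cmod ((a (q n) - a \<xi> - ?S) + ?S)" by simp
      also have "\<dots> \<le> 1 * ?N + ?N * (\<Sum>i<d. cmod (v i))"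
        by (rule order_trans[OF norm_triangle_ineq]) (intro add_mono near_linearD[OF v q elim] S)
      finally show ?case by (simp add: C_def algebra_simps)
    qed
  qed
  then show ?thesis by (simp add: LIM_zero_iff)
qed

text \<open>
  A function that is continuous almost everywhere is almost everywhere the limit of its samples at the
  lower corners of the grid cells of side \<open>1 / (n + 1)\<close>; each of these is constant on every cell.
\<close>

definition grid :: "nat \<Rightarrow> nat \<Rightarrow> (nat \<Rightarrow> int) \<Rightarrow> nat \<Rightarrow> real" where
  "grid d n k = (\<lambda>i\<in>{..<d}. of_int (k i) / real (Suc n))"

definition cell :: "nat \<Rightarrow> nat \<Rightarrow> (nat \<Rightarrow> real) \<Rightarrow> nat \<Rightarrow> int" where
  "cell d n \<xi> = (\<lambda>i\<in>{..<d}. \<lfloor>real (Suc n) * \<xi> i\<rfloor>)"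

text \<open>The map factors through a countable discrete set of cells, on which every function is
  measurable, whatever \<open>a\<close> is.\<close>

lemma measurable_grid_cell: "(\<lambda>\<xi>. a (grid d n (cell d n \<xi>))) \<in> borel_measurable (PM d)"
proof -
  let ?K = "{..<d} \<rightarrow>\<^sub>E (UNIV :: int set)"
  have c: "countable ?K" by (rule countable_PiE) auto
  have "cell d n \<in> measurable (PM d) (count_space ?K)"
  proof (subst measurable_count_space_eq_countable[OF c], intro conjI ballI)
    show "cell d n \<in> space (PM d) \<rightarrow> ?K" by (auto simp: cell_def)
    fix k assume k: "k \<in> ?K"
    have "cell d n -` {k} \<inter> space (PM d) = {\<xi> \<in> space (PM d). \<forall>i\<in>{..<d}. \<lfloor>real (Suc n) * \<xi> i\<rfloor> = k i}"
      using k by (auto simp: cell_def fun_eq_iff PiE_def extensional_def)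
    also have "\<dots> \<in> sets (PM d)"
    proof (rule sets.sets_Collect_finite_All)
      fix i assume i: "i \<in> {..<d}"
      have [measurable]: "(\<lambda>\<xi>. \<xi> i) \<in> borel_measurable (PM d)"
        using measurable_component_singleton[OF i, of "\<lambda>_. lborel :: real measure"] by simp
      show "{\<xi> \<in> space (PM d). \<lfloor>real (Suc n) * \<xi> i\<rfloor> = k i} \<in> sets (PM d)" by measurable
    qed (use k in auto)
    finally show "cell d n -` {k} \<inter> space (PM d) \<in> sets (PM d)" .
  qed
  moreover have "(\<lambda>k. a (grid d n k)) \<in> measurable (count_space ?K) borel" by simp
  ultimately show ?thesis by (rule measurable_compose)
qed

text \<open>The theorem asks only for differentiability almost everywhere; measurability of the
  symbol is recovered here from continuity at those points and the measurable grid samples.\<close>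

lemma AE_differentiable_measurable:
  fixes a :: "(nat \<Rightarrow> real) \<Rightarrow> complex"
  assumes "AE \<xi> in leb d. differentiable_pt d a \<xi>"
  shows "a \<in> borel_measurable (leb d)"
proof -
  let ?q = "\<lambda>n \<xi>. grid d n (cell d n \<xi>)"
  define b where "b \<xi> = lim (\<lambda>n. a (?q n \<xi>))" for \<xi>
  have m: "b \<in> borel_measurable (PM d)"
    unfolding b_def by (rule borel_measurable_lim_metric[OF measurable_grid_cell])
  have "AE \<xi> in leb d. a \<xi> = b \<xi>"
    using assms
  proof eventually_elim
    case (elim \<xi>)
    have "(\<lambda>n. a (?q n \<xi>)) \<longlonglongrightarrow> a \<xi>"
    proof (rule differentiable_pt_tendsto[OF elim])
      show "?q n \<xi> \<in> space (leb d)" for n by (simp add: space_leb grid_def)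
      have c: "\<bar>?q n \<xi> i - \<xi> i\<bar> \<le> inverse (real (Suc n))" if "i < d" for n i
      proof -
        have "real (Suc n) * \<bar>?q n \<xi> i - \<xi> i\<bar> = \<bar>real (Suc n) * (?q n \<xi> i - \<xi> i)\<bar>"
          by (simp only: abs_mult abs_of_nat)
        also have "\<dots> = \<bar>of_int \<lfloor>real (Suc n) * \<xi> i\<rfloor> - real (Suc n) * \<xi> i\<bar>"
          using that by (simp add: grid_def cell_def right_diff_distrib)
        also have "\<dots> \<le> 1" by linarith
        finally show ?thesis by (simp add: field_simps)
      qed
      show "(\<lambda>n. vnorm d (\<lambda>i. ?q n \<xi> i - \<xi> i)) \<longlonglongrightarrow> 0"
      proof (rule tendsto_sandwich[OF _ _ tendsto_const])
        have "vnorm d (\<lambda>i. ?q n \<xi> i - \<xi> i) \<le> (\<Sum>i<d. inverse (real (Suc n)))" for n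
          by (rule order_trans[OF vnorm_le_sum]) (intro sum_mono c, auto)
        then show "\<forall>\<^sub>F n in sequentially. vnorm d (\<lambda>i. ?q n \<xi> i - \<xi> i) \<le> (\<Sum>i<d. inverse (real (Suc n)))" by simp
        have "(\<lambda>n. \<Sum>i<d. inverse (real (Suc n))) \<longlonglongrightarrow> (\<Sum>i<d. 0)"
          by (intro tendsto_sum LIMSEQ_inverse_real_of_nat)
        then show "(\<lambda>n. \<Sum>i<d. inverse (real (Suc n))) \<longlonglongrightarrow> 0" by simp
      qed (simp add: vnorm_nonneg)
    qed
    then show ?case by (simp add: b_def limI)
  qed
  then show ?thesis by (rule measurable_leb_cong_AE[OF measurable_lebI[OF m]])
qed

text \<open>This connects \<open>differentiable_pt\<close>, which speaks of some differential
  \<open>v\<close>, to \<open>radial_deriv\<close>, which is built from partial derivatives.\<close>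

lemma differentiable_pt_partial_deriv:
  assumes \<zeta>: "\<zeta> \<in> space (leb d)" and i: "i < d"
    and v: "\<forall>\<epsilon>>0. \<exists>\<delta>>0. near_linear d a v \<zeta> \<epsilon> \<delta>"
  shows "partial_deriv i a \<zeta> = v i"
  unfolding partial_deriv_def
proof (rule vector_derivative_at)
  show "((\<lambda>s. a (\<zeta>(i := s))) has_vector_derivative v i) (at (\<zeta> i))"
    unfolding has_vector_derivative_def has_derivative_at_alt
  proof (intro conjI allI impI)
    show "bounded_linear (\<lambda>x. x *\<^sub>R v i)" by (rule bounded_linear_scaleR_left)
    fix e :: real assume "e > 0"
    then obtain \<delta> where \<delta>: "\<delta> > 0" "near_linear d a v \<zeta> e \<delta>" using v by blast
    have vn: "vnorm d (\<lambda>j. (\<zeta>(i := s)) j - \<zeta> j) = \<bar>s - \<zeta> i\<bar>" for s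
    proof (rule antisym)
      have "vnorm d (\<lambda>j. (\<zeta>(i := s)) j - \<zeta> j) \<le> (\<Sum>j<d. \<bar>(\<zeta>(i := s)) j - \<zeta> j\<bar>)" by (rule vnorm_le_sum)
      also have "\<dots> = (\<Sum>j<d. if j = i then \<bar>s - \<zeta> i\<bar> else 0)" by (intro sum.cong) auto
      also have "\<dots> = \<bar>s - \<zeta> i\<bar>" using i by simp
      finally show "vnorm d (\<lambda>j. (\<zeta>(i := s)) j - \<zeta> j) \<le> \<bar>s - \<zeta> i\<bar>" .
      show "\<bar>s - \<zeta> i\<bar> \<le> vnorm d (\<lambda>j. (\<zeta>(i := s)) j - \<zeta> j)"
        using component_le_vnorm[OF i, of "\<lambda>j. (\<zeta>(i := s)) j - \<zeta> j"] by simp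
    qed
    have sm: "(\<Sum>j<d. ((\<zeta>(i := s)) j - \<zeta> j) *\<^sub>R v j) = (s - \<zeta> i) *\<^sub>R v i" for s
    proof -
      have "(\<Sum>j<d. ((\<zeta>(i := s)) j - \<zeta> j) *\<^sub>R v j) = (\<Sum>j<d. if j = i then (s - \<zeta> i) *\<^sub>R v i else 0)"
        by (intro sum.cong) auto
      then show ?thesis using i by simp
    qed
    have sp: "\<zeta>(i := s) \<in> space (leb d)" for s using \<zeta> i by (auto simp: space_leb PiE_def extensional_def)
    show "\<exists>\<delta>>0. \<forall>s. norm (s - \<zeta> i) < \<delta> \<longrightarrow> norm (a (\<zeta>(i := s)) - a (\<zeta>(i := \<zeta> i)) - (s - \<zeta> i) *\<^sub>R v i) \<le> e * norm (s - \<zeta> i)"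
    proof (intro exI conjI allI impI)
      show "\<delta> > 0" by fact
      fix s assume "norm (s - \<zeta> i) < \<delta>"
      then show "norm (a (\<zeta>(i := s)) - a (\<zeta>(i := \<zeta> i)) - (s - \<zeta> i) *\<^sub>R v i) \<le> e * norm (s - \<zeta> i)"
        using near_linearD[OF \<delta>(2) sp, of s] unfolding vn sm by simp
    qed
  qed
qed

text \<open>Chain rule: the derivative along the ray is the differential applied to \<xi>, while
  \<open>radial_deriv\<close> applies it to the point \<open>vscale d t \<xi>\<close>; hence the
  division by \<open>t\<close>.\<close>

lemma radial_has_derivative:
  assumes t: "t > 0" and D: "differentiable_pt d a (vscale d t \<xi>)"
  shows "((\<lambda>s. a (vscale d s \<xi>)) has_vector_derivative (radial_deriv d a (vscale d t \<xi>) /\<^sub>R t)) (at t)"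
proof -
  let ?\<zeta> = "vscale d t \<xi>"
  have \<zeta>: "vscale d s \<xi> \<in> space (leb d)" for s by (simp add: space_leb vscale_space)
  obtain v where v: "\<forall>\<epsilon>>0. \<exists>\<delta>>0. near_linear d a v ?\<zeta> \<epsilon> \<delta>"
    using D unfolding differentiable_pt_iff ..
  have "radial_deriv d a ?\<zeta> = (\<Sum>i<d. ?\<zeta> i *\<^sub>R v i)"
    unfolding radial_deriv_def by (intro sum.cong refl) (simp add: differentiable_pt_partial_deriv[OF \<zeta> _ v])
  also have "\<dots> = t *\<^sub>R (\<Sum>i<d. \<xi> i *\<^sub>R v i)"
    by (simp add: vscale_def scaleR_sum_right)
  finally have rd: "radial_deriv d a ?\<zeta> /\<^sub>R t = (\<Sum>i<d. \<xi> i *\<^sub>R v i)" using t by simp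
  have vn: "vnorm d (\<lambda>i. vscale d s \<xi> i - ?\<zeta> i) = \<bar>s - t\<bar> * vnorm d \<xi>" for s
  proof -
    have "vnorm d (\<lambda>i. vscale d s \<xi> i - ?\<zeta> i) = L2_set (\<lambda>i. (s - t) * \<xi> i) {..<d}"
      unfolding vnorm_def by (intro L2_set_cong) (auto simp: vscale_def left_diff_distrib)
    also have "\<dots> = L2_set (\<lambda>i. \<bar>s - t\<bar> * \<xi> i) {..<d}"
      unfolding L2_set_def by (simp add: power_mult_distrib)
    finally show ?thesis by (simp add: vnorm_def L2_set_right_distrib)
  qed
  have sm: "(\<Sum>i<d. (vscale d s \<xi> i - ?\<zeta> i) *\<^sub>R v i) = (s - t) *\<^sub>R (\<Sum>i<d. \<xi> i *\<^sub>R v i)" for s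
    by (simp add: vscale_def scaleR_sum_right left_diff_distrib)
  show ?thesis unfolding rd has_vector_derivative_def has_derivative_at_alt
  proof (intro conjI allI impI)
    show "bounded_linear (\<lambda>x. x *\<^sub>R (\<Sum>i<d. \<xi> i *\<^sub>R v i))" by (rule bounded_linear_scaleR_left)
    fix e :: real assume e: "e > 0"
    \<comment> \<open>The added 1 keeps \<open>N\<close> positive when \<xi> = 0.\<close>
    define N where "N = vnorm d \<xi> + 1"
    have N: "N > 0" "vnorm d \<xi> \<le> N" using vnorm_nonneg[of d \<xi>] by (auto simp: N_def)
    have "e / N > 0" using e N by simp
    then obtain \<delta> where \<delta>: "\<delta> > 0" "near_linear d a v ?\<zeta> (e / N) \<delta>" using v by blast
    show "\<exists>\<delta>>0. \<forall>s. norm (s - t) < \<delta> \<longrightarrow> norm (a (vscale d s \<xi>) - a ?\<zeta> - (s - t) *\<^sub>R (\<Sum>i<d. \<xi> i *\<^sub>R v i)) \<le> e * norm (s - t)"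
    proof (intro exI conjI allI impI)
      show "\<delta> / N > 0" using \<delta> N by simp
      fix s assume s: "norm (s - t) < \<delta> / N"
      have "\<bar>s - t\<bar> * vnorm d \<xi> \<le> \<bar>s - t\<bar> * N" using N by (intro mult_left_mono) auto
      also have "\<dots> < \<delta>" using s N by (simp add: field_simps)
      finally have "norm (a (vscale d s \<xi>) - a ?\<zeta> - (s - t) *\<^sub>R (\<Sum>i<d. \<xi> i *\<^sub>R v i)) \<le> (e / N) * (\<bar>s - t\<bar> * vnorm d \<xi>)"
        using near_linearD[OF \<delta>(2) \<zeta>, of s] unfolding vn sm by simp
      also have "\<dots> \<le> (e / N) * (\<bar>s - t\<bar> * N)" using N e by (intro mult_left_mono) auto
      also have "\<dots> = e * norm (s - t)" using N by simp
      finally show "norm (a (vscale d s \<xi>) - a ?\<zeta> - (s - t) *\<^sub>R (\<Sum>i<d. \<xi> i *\<^sub>R v i)) \<le> e * norm (s - t)" .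
    qed
  qed
qed

section \<open>Chaining over dyadic scales\<close>

lemma nn_integral_count_int:
  "(\<integral>\<^sup>+k. f k \<partial>count_space (UNIV :: int set)) = (\<Sum>n. f (int_decode n))"
  unfolding nn_integral_bij_count_space[OF bij_int_decode, symmetric] by (rule nn_integral_count_space_nat)

lemma nn_integral_geometric_int:
  assumes q: "0 \<le> q" "q < (1::real)"
  shows "(\<integral>\<^sup>+k. ennreal (q ^ nat \<bar>k\<bar>) \<partial>count_space (UNIV :: int set)) \<le> ennreal (2 / (1 - q))"
proof -
  have g: "(\<Sum>n. ennreal (q ^ n)) = ennreal (1 / (1 - q))"
    using q by (subst suminf_ennreal2) (auto simp: suminf_geometric summable_geometric)
  have s: "(\<integral>\<^sup>+k. ennreal (q ^ nat \<bar>k\<bar>) * indicator (range h) k \<partial>count_space UNIV) = ennreal (1 / (1 - q))"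
    if h: "inj h" "\<And>n. nat \<bar>h n\<bar> = n" for h :: "nat \<Rightarrow> int"
  proof -
    have "(\<integral>\<^sup>+k. ennreal (q ^ nat \<bar>k\<bar>) * indicator (range h) k \<partial>count_space UNIV) = (\<integral>\<^sup>+k. ennreal (q ^ nat \<bar>k\<bar>) \<partial>count_space (range h))"
      by (simp add: nn_integral_count_space_indicator)
    also have "\<dots> = (\<integral>\<^sup>+n. ennreal (q ^ nat \<bar>h n\<bar>) \<partial>count_space UNIV)"
      using h(1) by (intro nn_integral_bij_count_space[symmetric]) (simp add: bij_betw_def)
    also have "\<dots> = (\<Sum>n. ennreal (q ^ n))"
      by (simp add: nn_integral_count_space_nat h)
    finally show ?thesis by (simp add: g)
  qed
  have "(\<integral>\<^sup>+k. ennreal (q ^ nat \<bar>k\<bar>) \<partial>count_space (UNIV :: int set)) \<le>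
    (\<integral>\<^sup>+k. ennreal (q ^ nat \<bar>k\<bar>) * indicator (range int) k + ennreal (q ^ nat \<bar>k\<bar>) * indicator (range (\<lambda>n. - int n)) k \<partial>count_space UNIV)"
  proof (rule nn_integral_mono)
    fix k :: int
    \<comment> \<open>The two half-lines overlap in 0, which only enlarges the bound.\<close>
    have "k \<in> range int \<or> k \<in> range (\<lambda>n. - int n)" by (cases k rule: int_cases2) auto
    then show "ennreal (q ^ nat \<bar>k\<bar>) \<le> ennreal (q ^ nat \<bar>k\<bar>) * indicator (range int) k + ennreal (q ^ nat \<bar>k\<bar>) * indicator (range (\<lambda>n. - int n)) k"
      by (auto simp: indicator_def)
  qed
  also have "\<dots> = ennreal (1 / (1 - q)) + ennreal (1 / (1 - q))"
    by (subst nn_integral_add) (auto simp: s inj_def)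
  also have "\<dots> = ennreal (2 / (1 - q))" using q by (subst ennreal_plus[symmetric]) auto
  finally show ?thesis .
qed

text \<open>The points have spacing \<open>2^-l\<close>, so about \<open>2^l\<close> of them fall
  where the exponential is of order 1, wherever the centre \<open>- \<rho>\<close> lies.\<close>

lemma nn_integral_exp_abs_int:
  "(\<integral>\<^sup>+k. ennreal (exp (- \<bar>\<rho> + of_int k / 2 ^ l\<bar> / 4)) \<partial>count_space (UNIV :: int set)) \<le> ennreal (32 * 2 ^ l)"
proof -
  define h :: real where "h = 1 / 2 ^ l"
  have h: "0 < h" "h \<le> 1" by (auto simp: h_def)
  \<comment> \<open>The grid point \<open>k0 * h\<close> is the last one not exceeding the centre
    \<open>- \<rho>\<close>. Recentring there leaves an offset below \<open>h \<le> 1\<close>, which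
    costs the factor \<open>exp (1/4) \<le> 2\<close>.\<close>
  define k0 where "k0 = \<lfloor>- \<rho> / h\<rfloor>"
  define q where "q = exp (- h / 4)"
  have q: "0 \<le> q" "q < 1" using h by (auto simp: q_def)
  have "of_int k0 \<le> - \<rho> / h" "- \<rho> / h < of_int k0 + 1" unfolding k0_def by linarith+
  then have k0: "of_int k0 * h \<le> - \<rho>" "- \<rho> < of_int k0 * h + h" using h by (auto simp: field_simps)
  have t: "exp (- \<bar>\<rho> + of_int (k0 + j) / 2 ^ l\<bar> / 4) \<le> 2 * q ^ nat \<bar>j\<bar>" for j
  proof -
    have "\<rho> + of_int (k0 + j) / 2 ^ l = of_int j * h + (\<rho> + of_int k0 * h)" by (simp add: h_def field_simps)
    then have "\<bar>of_int j * h\<bar> - h \<le> \<bar>\<rho> + of_int (k0 + j) / 2 ^ l\<bar>" using k0 by linarith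
    then have "- \<bar>\<rho> + of_int (k0 + j) / 2 ^ l\<bar> / 4 \<le> 1/4 + - (\<bar>of_int j\<bar> * h) / 4"
      using h by (simp add: abs_mult)
    then have "exp (- \<bar>\<rho> + of_int (k0 + j) / 2 ^ l\<bar> / 4) \<le> exp (1/4 + - (\<bar>of_int j\<bar> * h) / 4)" by simp
    also have "\<dots> = exp (1/4) * exp (- (\<bar>of_int j\<bar> * h) / 4)" by (rule exp_add)
    also have "exp (- (\<bar>of_int j\<bar> * h) / 4) = q ^ nat \<bar>j\<bar>"
      unfolding q_def exp_of_nat_mult[symmetric] by simp
    also have "exp (1/4) * q ^ nat \<bar>j\<bar> \<le> 2 * q ^ nat \<bar>j\<bar>"
      using exp_bound[of "1/4"] q by (intro mult_right_mono) (auto simp: power2_eq_square)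
    finally show ?thesis .
  qed
  have "bij (\<lambda>j. k0 + j)" by (rule bij_plus)
  then have "(\<integral>\<^sup>+k. ennreal (exp (- \<bar>\<rho> + of_int k / 2 ^ l\<bar> / 4)) \<partial>count_space (UNIV :: int set))
    = (\<integral>\<^sup>+j. ennreal (exp (- \<bar>\<rho> + of_int (k0 + j) / 2 ^ l\<bar> / 4)) \<partial>count_space (UNIV :: int set))"
    by (rule nn_integral_bij_count_space[symmetric])
  also have "\<dots> \<le> (\<integral>\<^sup>+j. ennreal 2 * ennreal (q ^ nat \<bar>j\<bar>) \<partial>count_space (UNIV :: int set))"
    using q t by (intro nn_integral_mono) (simp add: ennreal_mult[symmetric] del: ennreal_numeral)
  also have "\<dots> = ennreal 2 * (\<integral>\<^sup>+j. ennreal (q ^ nat \<bar>j\<bar>) \<partial>count_space (UNIV :: int set))"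
    by (rule nn_integral_cmult) simp
  also have "\<dots> \<le> ennreal 2 * ennreal (2 / (1 - q))"
    by (intro mult_left_mono nn_integral_geometric_int q) auto
  also have "\<dots> = ennreal (4 / (1 - q))" using q by (subst ennreal_mult[symmetric]) auto
  also have "\<dots> \<le> ennreal (32 * 2 ^ l)"
  proof (rule ennreal_leI)
    \<comment> \<open>Since \<open>(1 + h/4) * (1 - h/8) = 1 + h/8 - h^2/32\<close> is at least 1
      for \<open>h \<le> 1\<close>, it follows that \<open>q \<le> 1 - h/8\<close>, and
      \<open>4 / (1 - q)\<close> is at most \<open>32 / h\<close>.\<close>
    have "1 + h / 4 \<le> exp (h / 4)" by simp
    then have "1 \<le> exp (h/4) * (1 - h / 8)"
    proof -
      have "1 \<le> (1 + h / 4) * (1 - h / 8)" using h by (simp add: field_simps power2_eq_square)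
      also have "\<dots> \<le> exp (h / 4) * (1 - h / 8)" using h by (intro mult_right_mono) auto
      finally show ?thesis .
    qed
    then have "q \<le> 1 - h / 8" by (simp add: q_def exp_minus field_simps)
    then have "h / 8 \<le> 1 - q" by simp
    then have "4 / (1 - q) \<le> 4 / (h / 8)" using h q by (intro divide_left_mono) auto
    also have "\<dots> = 32 * 2 ^ l" by (simp add: h_def)
    finally show "4 / (1 - q) \<le> 32 * 2 ^ l" .
  qed
  finally show ?thesis .
qed

text \<open>
  The exponents are chosen so that the second bound, of order \<open>2\<^sup>-\<^sup>l\<close>, enters with a power larger than
  \<open>1\<close>, which beats the \<open>2\<^sup>l\<close> effective terms of the sum over \<open>k\<close>, and some power of the third is
  left to make that sum converge.
\<close>

lemma square_le_interpolate:
  assumes x: "0 \<le> (x::real)" "x \<le> a" "x \<le> b" "x \<le> c"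
  shows "x\<^sup>2 \<le> sqrt a * b powr (5/4) * c powr (1/4)"
proof (cases "x = 0")
  case False
  then have x0: "x > 0" using x by simp
  have "x\<^sup>2 = x powr (1/2 + 5/4 + 1/4)" using x0 by (simp flip: powr_numeral)
  also have "\<dots> = x powr (1/2) * x powr (5/4) * x powr (1/4)" by (simp only: powr_add)
  also have "\<dots> \<le> a powr (1/2) * b powr (5/4) * c powr (1/4)"
    using x by (intro mult_mono powr_mono2) auto
  also have "a powr (1/2) = sqrt a" using x by (simp add: powr_half_sqrt)
  finally show ?thesis .
qed (use x in simp)

text \<open>L^2 convergence alone gives almost everywhere convergence only along a subsequence. With
  summable squared norms, the sum of the |g n x|^2 has finite integral, hence is finite almost
  everywhere.\<close>

lemma AE_tendsto_0_of_sq_norm: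
  assumes g[measurable]: "\<And>n. g n \<in> borel_measurable M" and s: "(\<Sum>n. sq_norm M (g n)) < \<infinity>"
  shows "AE x in M. (\<lambda>n. g n x) \<longlonglongrightarrow> 0"
proof -
  have "(\<integral>\<^sup>+x. (\<Sum>n. ennreal ((cmod (g n x))\<^sup>2)) \<partial>M) = (\<Sum>n. sq_norm M (g n))"
    unfolding sq_norm_def by (rule nn_integral_suminf) measurable
  then have "AE x in M. (\<Sum>n. ennreal ((cmod (g n x))\<^sup>2)) \<noteq> \<infinity>"
    using s by (intro nn_integral_noteq_infinite) auto
  then show ?thesis
  proof eventually_elim
    case (elim x)
    have "summable (\<lambda>n. (cmod (g n x))\<^sup>2)"
      by (rule summable_suminf_not_top) (use elim in auto)
    then have "(\<lambda>n. (cmod (g n x))\<^sup>2) \<longlonglongrightarrow> 0" by (rule summable_LIMSEQ_zero)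
    then have "(\<lambda>n. sqrt ((cmod (g n x))\<^sup>2)) \<longlonglongrightarrow> sqrt 0" by (rule tendsto_real_sqrt)
    then show ?case by (simp add: tendsto_norm_zero_iff)
  qed
qed

section \<open>Dyadic increments and chaining\<close>

definition dyad :: "nat \<Rightarrow> int \<Rightarrow> real" where
  "dyad l k = exp (of_int k / 2 ^ l)"

lemma dyad_pos: "dyad l k > 0"
  by (simp add: dyad_def)

lemma dyad_Suc_even: "dyad (Suc l) (2 * k) = dyad l k"
  by (simp add: dyad_def)

text \<open>Level 0 records the value and not a difference, so that a chain needs no separate
  starting term and the coarsest level is estimated like all others.\<close>

fun increment :: "(real \<Rightarrow> complex) \<Rightarrow> nat \<Rightarrow> int \<Rightarrow> complex" where
  "increment g 0 k = g (dyad 0 k)"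
| "increment g (Suc l) k = g (dyad (Suc l) (k + 1)) - g (dyad (Suc l) k)"

text \<open>The square of the square function of level \<open>l\<close>. An l^2 sum over
  \<open>k\<close> in place of a supremum commutes with the integral, so that Plancherel's theorem
  can be applied term by term.\<close>

definition variation :: "(real \<Rightarrow> complex) \<Rightarrow> nat \<Rightarrow> ennreal" where
  "variation g l = (\<integral>\<^sup>+k. ennreal ((cmod (increment g l k))\<^sup>2) \<partial>count_space UNIV)"

lemma increment_le_variation: "ennreal ((cmod (increment g l k))\<^sup>2) \<le> variation g l"
  unfolding variation_def by (rule nn_integral_ge_point) simp

text \<open>A point of level \<open>L + 1\<close> is a point of level \<open>L\<close> or the right
  neighbour of one, so descending to level 0 uses at most one increment per level. The sequence
  \<delta> depends on the chain, but its bound by \<open>variation\<close> does not.\<close>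

lemma chaining:
  "\<exists>\<delta>. (\<forall>l. 0 \<le> \<delta> l \<and> ennreal ((\<delta> l)\<^sup>2) \<le> variation g l) \<and> cmod (g (dyad L k)) \<le> (\<Sum>l\<le>L. \<delta> l)"
proof (induction L arbitrary: k)
  case 0
  have "ennreal ((cmod (g (dyad 0 k)))\<^sup>2) \<le> variation g 0" using increment_le_variation[of g 0 k] by simp
  then show ?case by (intro exI[of _ "\<lambda>l. if l = 0 then cmod (g (dyad 0 k)) else 0"]) auto
next
  case (Suc L)
  show ?case
  proof (cases "even k")
    case True
    then obtain j where j: "k = 2 * j" by auto
    obtain \<delta> where \<delta>: "\<And>l. 0 \<le> \<delta> l \<and> ennreal ((\<delta> l)\<^sup>2) \<le> variation g l" "cmod (g (dyad L j)) \<le> (\<Sum>l\<le>L. \<delta> l)"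
      using Suc by blast
    have "cmod (g (dyad (Suc L) k)) \<le> (\<Sum>l\<le>Suc L. \<delta> l)"
      unfolding j dyad_Suc_even using \<delta>(1)[of "Suc L"] \<delta>(2) by simp
    then show ?thesis using \<delta>(1) by blast
  next
    case False
    then obtain j where j: "k = 2 * j + 1" by (auto elim: oddE)
    obtain \<delta> where \<delta>: "\<And>l. 0 \<le> \<delta> l \<and> ennreal ((\<delta> l)\<^sup>2) \<le> variation g l" "cmod (g (dyad L j)) \<le> (\<Sum>l\<le>L. \<delta> l)"
      using Suc by blast
    \<comment> \<open>Only the entry of the new level is set; the lower levels keep the chain that
      ends in \<open>j\<close>.\<close>
    define \<delta>' where "\<delta>' = \<delta>(Suc L := cmod (increment g (Suc L) (2 * j)))"
    have "g (dyad (Suc L) k) = g (dyad L j) + increment g (Suc L) (2 * j)"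
      by (simp add: j dyad_Suc_even)
    also have "cmod \<dots> \<le> (\<Sum>l\<le>L. \<delta> l) + cmod (increment g (Suc L) (2 * j))"
      by (rule order_trans[OF norm_triangle_ineq]) (use \<delta>(2) in simp)
    also have "(\<Sum>l\<le>L. \<delta> l) = (\<Sum>l\<le>L. \<delta>' l)" by (intro sum.cong) (auto simp: \<delta>'_def)
    also have "\<dots> + cmod (increment g (Suc L) (2 * j)) = (\<Sum>l\<le>Suc L. \<delta>' l)" by (simp add: \<delta>'_def)
    finally have "cmod (g (dyad (Suc L) k)) \<le> (\<Sum>l\<le>Suc L. \<delta>' l)" .
    moreover have "0 \<le> \<delta>' l \<and> ennreal ((\<delta>' l)\<^sup>2) \<le> variation g l" for l
      using \<delta>(1) increment_le_variation[of g "Suc L" "2 * j"] by (simp add: \<delta>'_def)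
    ultimately show ?thesis by blast
  qed
qed

text \<open>Cauchy-Schwarz with weights \<open>r ^ l\<close> turns the square of a sum over levels
  into a sum of squares, at the price of a factor \<open>(1 / r\<^sup>2) ^ l\<close> that the decay
  of \<open>variation\<close> has to pay. The right side is free of \<open>L\<close> and
  \<open>k\<close>, so it bounds the supremum as well.\<close>

lemma sup_le_variation:
  assumes r: "0 < r" "r < (1::real)"
  shows "(ennreal (cmod (g (dyad L k))))\<^sup>2 \<le> ennreal (1 / (1 - r\<^sup>2)) * (\<Sum>l. ennreal ((1 / r\<^sup>2) ^ l) * variation g l)"
proof -
  obtain \<delta> where \<delta>: "\<And>l. 0 \<le> \<delta> l \<and> ennreal ((\<delta> l)\<^sup>2) \<le> variation g l" "cmod (g (dyad L k)) \<le> (\<Sum>l\<le>L. \<delta> l)"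
    using chaining by blast
  have r2: "0 < r\<^sup>2" "r\<^sup>2 < 1" using r by (auto simp: power_less_one_iff)
  have "(cmod (g (dyad L k)))\<^sup>2 \<le> (\<Sum>l\<le>L. \<delta> l)\<^sup>2" using \<delta>(2) by (intro power_mono) auto
  also have "(\<Sum>l\<le>L. \<delta> l) = (\<Sum>l\<le>L. r ^ l * (\<delta> l / r ^ l))" using r by simp
  also have "\<dots>\<^sup>2 \<le> (\<Sum>l\<le>L. (r ^ l)\<^sup>2) * (\<Sum>l\<le>L. (\<delta> l / r ^ l)\<^sup>2)" by (rule Cauchy_Schwarz_ineq_sum)
  also have "\<dots> \<le> (1 / (1 - r\<^sup>2)) * (\<Sum>l\<le>L. (1 / r\<^sup>2) ^ l * (\<delta> l)\<^sup>2)"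
  proof (rule mult_mono)
    have "(\<Sum>l\<le>L. (r ^ l)\<^sup>2) = (\<Sum>l\<le>L. (r\<^sup>2) ^ l)" by (simp add: power_mult[symmetric] mult.commute)
    also have "\<dots> \<le> (\<Sum>l. (r\<^sup>2) ^ l)" using r2 by (intro sum_le_suminf) (auto intro: summable_geometric)
    also have "\<dots> = 1 / (1 - r\<^sup>2)" using r2 by (intro suminf_geometric) auto
    finally show "(\<Sum>l\<le>L. (r ^ l)\<^sup>2) \<le> 1 / (1 - r\<^sup>2)" .
    show "(\<Sum>l\<le>L. (\<delta> l / r ^ l)\<^sup>2) \<le> (\<Sum>l\<le>L. (1 / r\<^sup>2) ^ l * (\<delta> l)\<^sup>2)"
      by (simp add: power_divide power_mult[symmetric] mult.commute)
  qed (use r2 in \<open>auto intro: sum_nonneg\<close>)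
  finally have "ennreal ((cmod (g (dyad L k)))\<^sup>2) \<le> ennreal ((1 / (1 - r\<^sup>2)) * (\<Sum>l\<le>L. (1 / r\<^sup>2) ^ l * (\<delta> l)\<^sup>2))"
    by (rule ennreal_leI)
  also have "\<dots> = ennreal (1 / (1 - r\<^sup>2)) * (\<Sum>l\<le>L. ennreal ((1 / r\<^sup>2) ^ l) * ennreal ((\<delta> l)\<^sup>2))"
    using r2 by (subst ennreal_mult) (auto intro!: sum_nonneg simp: sum_ennreal[symmetric] ennreal_mult)
  also have "\<dots> \<le> ennreal (1 / (1 - r\<^sup>2)) * (\<Sum>l\<le>L. ennreal ((1 / r\<^sup>2) ^ l) * variation g l)"
    using \<delta>(1) by (intro mult_left_mono sum_mono) auto
  also have "\<dots> \<le> ennreal (1 / (1 - r\<^sup>2)) * (\<Sum>l. ennreal ((1 / r\<^sup>2) ^ l) * variation g l)"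
    by (intro mult_left_mono sum_le_suminf) auto
  finally show ?thesis by (simp add: ennreal_power)
qed

section \<open>The maximal operator\<close>

text \<open>With \<open>exp \<rho> = \<sigma> * vnorm d \<xi>\<close> this is the smaller of
  \<open>\<sigma> * vnorm d (vscale d (dyad l k) \<xi>)\<close> and its reciprocal: both size bounds
  in one formula.\<close>

abbreviation decay :: "real \<Rightarrow> nat \<Rightarrow> int \<Rightarrow> real" where
  "decay \<rho> l k \<equiv> exp (- \<bar>\<rho> + of_int k / 2 ^ l\<bar>)"

locale symbol =
  fixes J \<sigma> :: real and d :: nat and a :: "(nat \<Rightarrow> real) \<Rightarrow> complex"
  assumes J: "J > 0" and \<sigma>: "\<sigma> > 0"
    and bdd: "bounded (a ` space (leb d))"
    and diff: "AE \<xi> in leb d. differentiable_pt d a \<xi>"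
    and rac: "radially_abs_continuous d a"
    and small: "AE \<xi> in leb d. cmod (a \<xi>) \<le> J * \<sigma> * vnorm d \<xi>"
    and large: "AE \<xi> in leb d. cmod (a \<xi>) \<le> J * (1 / (\<sigma> * vnorm d \<xi>))"
    and rad: "AE \<xi> in leb d. cmod (radial_deriv d a \<xi>) \<le> J"
begin

section \<open>Estimates of the symbol along a ray\<close>

abbreviation dil :: "real \<Rightarrow> (nat \<Rightarrow> real) \<Rightarrow> complex" where
  "dil t \<xi> \<equiv> a (vscale d t \<xi>)"

abbreviation ray :: "(nat \<Rightarrow> real) \<Rightarrow> real \<Rightarrow> complex" where
  "ray \<xi> \<equiv> \<lambda>t. dil t \<xi>"

definition A :: real where "A = enn2real (Linfnorm d a)"

lemma A_nonneg: "0 \<le> A"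
  by (simp add: A_def)

lemma a_measurable: "a \<in> borel_measurable (leb d)"
  by (rule AE_differentiable_measurable[OF diff])

text \<open>Boundedness of \<open>a\<close> makes the essential supremum finite, so nothing is lost
  in passing to the real number \<open>A\<close>.\<close>

lemma a_le_A: "AE \<xi> in leb d. cmod (a \<xi>) \<le> A"
proof -
  have [measurable]: "a \<in> borel_measurable (leb d)" by (rule a_measurable)
  obtain B where B: "\<And>\<xi>. \<xi> \<in> space (leb d) \<Longrightarrow> cmod (a \<xi>) \<le> B"
    using bdd by (auto simp: bounded_iff)
  have "Linfnorm d a \<le> ennreal B"
    unfolding Linfnorm_def by (rule esssup_I) (auto intro!: AE_I2 ennreal_leI B)
  then have fin: "ennreal A = Linfnorm d a"
    unfolding A_def by (intro ennreal_enn2real) (auto simp: less_top[symmetric] top_unique)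
  have "AE \<xi> in leb d. ennreal (cmod (a \<xi>)) \<le> ennreal A"
    unfolding fin Linfnorm_def by (rule esssup_AE)
  then show ?thesis by (simp add: A_nonneg)
qed

lemma dil_measurable: "t > 0 \<Longrightarrow> dil t \<in> borel_measurable (leb d)"
  by (rule measurable_leb_scale[OF _ a_measurable])

lemma dil_le_A: "t > 0 \<Longrightarrow> AE \<xi> in leb d. cmod (dil t \<xi>) \<le> A"
  by (rule AE_scale[OF _ a_le_A])

text \<open>On almost every ray, almost every \<open>t\<close> gives a point where \<open>a\<close>
  is differentiable with the radial bound; the derivative along the ray there is at most
  \<open>J / t\<close>, hence at most \<open>J / r\<close> on \<open>{r..s}\<close>, and absolute
  continuity turns this into a bound on increments. One null set serves all \<open>r\<close> and
  \<open>s\<close>.\<close>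

lemma dil_lipschitz: "AE \<xi> in leb d. \<forall>r s. 0 < r \<and> r \<le> s \<longrightarrow> cmod (dil s \<xi> - dil r \<xi>) \<le> J / r * (s - r)"
proof -
  have "AE \<xi> in leb d. differentiable_pt d a \<xi> \<and> cmod (radial_deriv d a \<xi>) \<le> J"
    using diff rad by eventually_elim auto
  from AE_AE_scale[OF this] rac[unfolded radially_abs_continuous_def]
  show ?thesis
  proof eventually_elim
    case (elim \<xi>)
    show ?case
    proof (intro allI impI)
      fix r s :: real assume rs: "0 < r \<and> r \<le> s"
      show "cmod (dil s \<xi> - dil r \<xi>) \<le> J / r * (s - r)"
      proof (cases "r = s")
        case False
        show ?thesis
        proof (rule abs_continuous_bound)
          show "r < s" using rs False by simp
          then show "abs_continuous_on r s (ray \<xi>)" using elim(2) rs by simp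
          show "0 \<le> J / r" using J rs by simp
          show "AE t in lborel. r \<le> t \<and> t \<le> s \<longrightarrow> (\<exists>D. ((ray \<xi>) has_vector_derivative D) (at t) \<and> cmod D \<le> J / r)"
            using elim(1)
          proof eventually_elim
            case (elim t)
            show ?case
            proof (intro impI exI conjI)
              assume t: "r \<le> t \<and> t \<le> s"
              then have t0: "t > 0" using rs by simp
              then have D: "differentiable_pt d a (vscale d t \<xi>)" "cmod (radial_deriv d a (vscale d t \<xi>)) \<le> J" using elim by auto
              show "((ray \<xi>) has_vector_derivative (radial_deriv d a (vscale d t \<xi>) /\<^sub>R t)) (at t)"
                by (rule radial_has_derivative[OF t0 D(1)])
              have "cmod (radial_deriv d a (vscale d t \<xi>) /\<^sub>R t) = cmod (radial_deriv d a (vscale d t \<xi>)) / t"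
                using t0 by (simp add: divide_inverse mult.commute)
              also have "\<dots> \<le> J / r" using D(2) t t0 rs J by (intro frac_le) auto
              finally show "cmod (radial_deriv d a (vscale d t \<xi>) /\<^sub>R t) \<le> J / r" .
            qed
          qed
        qed
      qed simp
    qed
  qed
qed

text \<open>Only countably many dilations occur, so one null set serves all of them. The sign of
  \<open>\<rho> + of_int k / 2 ^ l\<close> decides which of the two size bounds is used.\<close>

lemma dil_dyad_bounds:
  "AE \<xi> in leb d. \<exists>\<rho>. \<forall>l k. cmod (dil (dyad l k) \<xi>) \<le> J * decay \<rho> l k"
proof -
  have "AE \<xi> in leb d. cmod (a \<xi>) \<le> J * \<sigma> * vnorm d \<xi> \<and> cmod (a \<xi>) \<le> J * (1 / (\<sigma> * vnorm d \<xi>))"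
    using small large by eventually_elim auto
  then have "AE \<xi> in leb d. \<forall>l k. cmod (dil (dyad l k) \<xi>) \<le> J * \<sigma> * vnorm d (vscale d (dyad l k) \<xi>) \<and>
     cmod (dil (dyad l k) \<xi>) \<le> J * (1 / (\<sigma> * vnorm d (vscale d (dyad l k) \<xi>)))"
    by (intro AE_all_countable[THEN iffD2] allI AE_scale[OF dyad_pos])
  then show ?thesis
  proof eventually_elim
    case (elim \<xi>)
    have v: "vnorm d (vscale d (dyad l k) \<xi>) = dyad l k * vnorm d \<xi>" for l k
      using dyad_pos[of l k] by (simp add: vnorm_vscale)
    show ?case
    proof (cases "vnorm d \<xi> = 0")
      case True
      \<comment> \<open>Since \<open>1 / 0 = 0\<close>, the hypotheses force \<open>dil t \<xi> = 0\<close> here.\<close>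
      then show ?thesis using elim J by (intro exI[of _ 0]) (simp add: v)
    next
      case False
      then have n: "vnorm d \<xi> > 0" using vnorm_nonneg[of d \<xi>] by simp
      define \<rho> where "\<rho> = ln (\<sigma> * vnorm d \<xi>)"
      have e: "exp (\<rho> + of_int k / 2 ^ l) = \<sigma> * vnorm d (vscale d (dyad l k) \<xi>)" for l k
        unfolding v exp_add using n \<sigma> by (simp add: \<rho>_def dyad_def)
      have "cmod (dil (dyad l k) \<xi>) \<le> J * decay \<rho> l k" for l k
      proof (cases "\<rho> + of_int k / 2 ^ l \<ge> 0")
        case True
        have "cmod (dil (dyad l k) \<xi>) \<le> J * (1 / exp (\<rho> + of_int k / 2 ^ l))" using elim unfolding e by blast
        moreover have "- \<bar>\<rho> + of_int k / 2 ^ l\<bar> = - (\<rho> + of_int k / 2 ^ l)" using True by simp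
        ultimately show ?thesis by (simp only: exp_minus inverse_eq_divide)
      next
        case False
        have "cmod (dil (dyad l k) \<xi>) \<le> J * \<sigma> * vnorm d (vscale d (dyad l k) \<xi>)" using elim by blast
        then have "cmod (dil (dyad l k) \<xi>) \<le> J * exp (\<rho> + of_int k / 2 ^ l)" unfolding e by (simp add: mult.assoc)
        moreover have "- \<bar>\<rho> + of_int k / 2 ^ l\<bar> = \<rho> + of_int k / 2 ^ l" using False by simp
        ultimately show ?thesis by (simp only:)
      qed
      then show ?thesis by blast
    qed
  qed
qed

lemma exp_minus_1_le: "0 \<le> h \<Longrightarrow> h \<le> 1 \<Longrightarrow> exp h - 1 \<le> 2 * (h :: real)"
  using exp_bound[of h] power_decreasing[of 1 2 h] by simp

text \<open>The Lipschitz constant \<open>J / r\<close> scales like \<open>1 / r\<close>, so only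
  the ratio of the two dilations survives; this is why the points are spaced geometrically.\<close>

lemma dil_ratio:
  assumes L: "\<forall>r s. 0 < r \<and> r \<le> s \<longrightarrow> cmod (dil s \<xi> - dil r \<xi>) \<le> J / r * (s - r)"
    and h: "0 \<le> h" "h \<le> 1"
  shows "cmod (dil (exp (u + h)) \<xi> - dil (exp u) \<xi>) \<le> 2 * J * h"
proof -
  have "cmod (dil (exp (u + h)) \<xi> - dil (exp u) \<xi>) \<le> J / exp u * (exp (u + h) - exp u)"
    using L h by simp
  also have "\<dots> = J * (exp h - 1)" by (simp add: exp_add field_simps)
  also have "\<dots> \<le> J * (2 * h)" using J by (intro mult_left_mono exp_minus_1_le h) auto
  finally show ?thesis by simp
qed

text \<open>The three bounds \<open>2 * A\<close>, \<open>2 * J\<close>, \<open>4 * J\<close> raised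
  to the interpolation exponents, times the 32 from \<open>nn_integral_exp_abs_int\<close>.\<close>

definition M :: real where
  "M = 32 * (sqrt (2 * A) * (2 * J) powr (5/4) * (4 * J) powr (1/4))"

lemma M_nonneg: "0 \<le> M"
  using A_nonneg by (simp add: M_def)

lemma increment_bounds:
  "AE \<xi> in leb d. \<exists>\<rho>. \<forall>l k. cmod (increment (ray \<xi>) l k) \<le> 2 * A \<and>
     cmod (increment (ray \<xi>) l k) \<le> 2 * J / 2 ^ l \<and>
     cmod (increment (ray \<xi>) l k) \<le> 4 * J * decay \<rho> l k"
proof -
  have "AE \<xi> in leb d. \<forall>l k. cmod (dil (dyad l k) \<xi>) \<le> A"
    by (intro AE_all_countable[THEN iffD2] allI dil_le_A dyad_pos)
  with dil_lipschitz dil_dyad_bounds show ?thesis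
  proof eventually_elim
    case (elim \<xi>)
    obtain \<rho> where \<rho>: "\<And>l k. cmod (dil (dyad l k) \<xi>) \<le> J * decay \<rho> l k"
      using elim(2) by blast
    let ?x = "\<lambda>l k. cmod (increment (ray \<xi>) l k)"
    have e: "decay \<rho> l k \<le> 1" for l k by simp
    have "?x l k \<le> 2 * A \<and> ?x l k \<le> 2 * J / 2 ^ l \<and> ?x l k \<le> 4 * J * decay \<rho> l k" for l k
    proof (cases l)
      case 0
      \<comment> \<open>At level 0 the increment is a single value; it satisfies the bounds with the
        constants of the higher levels, the second one because \<open>decay\<close> is at most
        1.\<close>
      have r: "?x l k \<le> J * decay \<rho> l k" using \<rho>[of 0 k] 0 by simp
      have 1: "?x l k \<le> A" using elim(3) 0 by simp
      have "J * decay \<rho> l k \<le> J * 1" using J e by (intro mult_left_mono) auto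
      then have 2: "?x l k \<le> J" using r by linarith
      have "J * decay \<rho> l k \<le> 4 * J * decay \<rho> l k" using J by simp
      with r have 3: "?x l k \<le> 4 * J * decay \<rho> l k" by (rule order_trans)
      have "2 * J / 2 ^ l = 2 * J" using 0 by simp
      then show ?thesis using 1 2 3 A_nonneg J by linarith
    next
      case (Suc m)
      define h :: real where "h = 1 / 2 ^ l"
      have h: "0 \<le> h" "h \<le> 1" by (auto simp: h_def)
      have x: "?x l k = cmod (dil (dyad l (k + 1)) \<xi> - dil (dyad l k) \<xi>)" by (simp add: Suc)
      have d1: "dyad l (k + 1) = exp (of_int k / 2 ^ l + h)" by (simp add: dyad_def h_def add_divide_distrib)
      have 1: "?x l k \<le> A + A"
        unfolding x by (rule order_trans[OF norm_triangle_ineq4]) (intro add_mono elim(3)[rule_format])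
      have 2: "?x l k \<le> 2 * J * h"
        unfolding x d1 unfolding dyad_def by (rule dil_ratio[OF elim(1) h])
      \<comment> \<open>Neighbouring points differ by \<open>h \<le> 1\<close> on the logarithmic
        scale, so their decays differ at most by a factor \<open>exp 1 \<le> 3\<close>; adding the
        left end point gives the constant \<open>4 = 3 + 1\<close>.\<close>
      have "decay \<rho> l (k + 1) \<le> exp (1 + - \<bar>\<rho> + of_int k / 2 ^ l\<bar>)"
      proof -
        have "\<rho> + of_int (k + 1) / 2 ^ l = (\<rho> + of_int k / 2 ^ l) + h" by (simp add: h_def add_divide_distrib)
        then show ?thesis using h by simp
      qed
      also have "\<dots> \<le> 3 * decay \<rho> l k"
        unfolding exp_add using exp_le by (intro mult_right_mono) auto
      finally have "J * decay \<rho> l (k + 1) \<le> J * (3 * decay \<rho> l k)"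
        using J by (intro mult_left_mono) auto
      moreover have "?x l k \<le> J * decay \<rho> l (k + 1) + J * decay \<rho> l k"
        unfolding x by (rule order_trans[OF norm_triangle_ineq4]) (intro add_mono \<rho>)
      ultimately have 3: "?x l k \<le> 4 * J * decay \<rho> l k" by linarith
      show ?thesis using 1 2 3 by (simp add: h_def)
    qed
    then show ?case by blast
  qed
qed

lemma variation_dil:
  "AE \<xi> in leb d. \<forall>l. variation (ray \<xi>) l \<le> ennreal (M * (2 powr (- 1/4)) ^ l)"
  using increment_bounds
proof eventually_elim
  case (elim \<xi>)
  let ?x = "\<lambda>l k. cmod (increment (ray \<xi>) l k)"
  obtain \<rho> where \<rho>: "\<And>l k. ?x l k \<le> 2 * A" "\<And>l k. ?x l k \<le> 2 * J / 2 ^ l"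
    "\<And>l k. ?x l k \<le> 4 * J * decay \<rho> l k" using elim by blast
  show ?case
  proof
    fix l :: nat
    define Q where "Q = sqrt (2 * A) * ((2 * J) powr (5/4) * (2 powr (- (5/4))) ^ l) * (4 * J) powr (1/4)"
    have Q: "0 \<le> Q" using A_nonneg by (simp add: Q_def)
    have p1: "(2 * J / 2 ^ l) powr (5/4) = (2 * J) powr (5/4) * (2 powr (- (5/4))) ^ l"
    proof -
      have "(2 * J / 2 ^ l) powr (5/4) = (2 * J) powr (5/4) / (2 ^ l) powr (5/4)" using J by (simp add: powr_divide)
      also have "(2 ^ l) powr (5/4) = ((2::real) powr (5/4)) ^ l"
        by (simp add: powr_realpow[symmetric] powr_powr mult.commute)
      finally show ?thesis by (simp only: powr_minus power_inverse divide_inverse)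
    qed
    have p2: "(4 * J * decay \<rho> l k) powr (1/4) = (4 * J) powr (1/4) * exp (- \<bar>\<rho> + of_int k / 2 ^ l\<bar> / 4)" for k
      using J by (simp add: powr_mult exp_powr_real)
    have b: "(?x l k)\<^sup>2 \<le> Q * exp (- \<bar>\<rho> + of_int k / 2 ^ l\<bar> / 4)" for k
      using square_le_interpolate[OF norm_ge_zero \<rho>(1) \<rho>(2) \<rho>(3), of l k]
      unfolding p1 p2 Q_def by (simp only: mult.assoc)
    have "variation (ray \<xi>) l \<le> (\<integral>\<^sup>+k. ennreal Q * ennreal (exp (- \<bar>\<rho> + of_int k / 2 ^ l\<bar> / 4)) \<partial>count_space UNIV)"
      unfolding variation_def
      by (intro nn_integral_mono) (use b Q in \<open>simp add: ennreal_mult[symmetric]\<close>)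
    also have "\<dots> = ennreal Q * (\<integral>\<^sup>+k. ennreal (exp (- \<bar>\<rho> + of_int k / 2 ^ l\<bar> / 4)) \<partial>count_space UNIV)"
      by (rule nn_integral_cmult) simp
    also have "\<dots> \<le> ennreal Q * ennreal (32 * 2 ^ l)"
      by (intro mult_left_mono nn_integral_exp_abs_int) auto
    also have "\<dots> = ennreal (Q * (32 * 2 ^ l))" using Q by (subst ennreal_mult) auto
    also have "Q * (32 * 2 ^ l) = M * ((2 powr (- (5/4))) * 2) ^ l"
      by (simp add: Q_def M_def power_mult_distrib)
    also have "(2 powr (- (5/4))) * 2 = (2::real) powr (- 1/4)"
      using powr_add[of "2::real" "- (5/4)" 1] by simp
    finally show "variation (ray \<xi>) l \<le> ennreal (M * (2 powr (- 1/4)) ^ l)" .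
  qed
qed

section \<open>Square functions and the supremum for a fixed \<open>f\<close>\<close>

context
  fixes f :: "(nat \<Rightarrow> real) \<Rightarrow> complex"
  assumes f: "f \<in> sq_int (leb d)"
begin

abbreviation op :: "real \<Rightarrow> (nat \<Rightarrow> real) \<Rightarrow> complex" where
  "op t \<equiv> dilated_op d a t f"

abbreviation orbit :: "(nat \<Rightarrow> real) \<Rightarrow> real \<Rightarrow> complex" where
  "orbit x \<equiv> \<lambda>t. op t x"

lemma op_sq_int: "t > 0 \<Longrightarrow> op t \<in> sq_int (leb d)"
  unfolding dilated_op_def by (rule multiplier_op_spec(1)[OF f dil_measurable dil_le_A])

lemma op_measurable: "t > 0 \<Longrightarrow> op t \<in> borel_measurable (leb d)"
  by (rule sq_intD[OF op_sq_int])

lemma op_diff_sq_norm: "s > 0 \<Longrightarrow> t > 0 \<Longrightarrow>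
  sq_norm (leb d) (\<lambda>x. op s x - op t x) = sq_norm (leb d) (\<lambda>\<xi>. (dil s \<xi> - dil t \<xi>) * fourier_L2 d f \<xi>)"
  unfolding dilated_op_def by (rule multiplier_op_diff_sq_norm[OF f dil_measurable dil_le_A dil_measurable dil_le_A])

lemma increment_op_measurable: "(\<lambda>x. increment (orbit x) l k) \<in> borel_measurable (leb d)"
  using op_measurable[OF dyad_pos] by (cases l) auto

lemma increment_op_sq_norm:
  "sq_norm (leb d) (\<lambda>x. increment (orbit x) l k) = sq_norm (leb d) (\<lambda>\<xi>. increment (ray \<xi>) l k * fourier_L2 d f \<xi>)"
proof (cases l)
  case 0
  then show ?thesis unfolding dilated_op_def
    using multiplier_op_sq_norm[OF f dil_measurable[OF dyad_pos] dil_le_A[OF dyad_pos]] by simp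
next
  case (Suc m)
  then show ?thesis using op_diff_sq_norm[OF dyad_pos dyad_pos] by simp
qed

text \<open>Plancherel turns the sum over \<open>k\<close> of squared norms into the integral of
  |fourier_L2 d f|^2 against the variation of the symbol along the ray. Here a pointwise estimate in
  frequency becomes an estimate for the operators.\<close>

lemma variation_op:
  "(\<integral>\<^sup>+x. variation (orbit x) l \<partial>leb d) \<le> ennreal (M * (2 powr (- 1/4)) ^ l) * sq_norm (leb d) f"
proof -
  let ?F = "fourier_L2 d f" and ?c = "ennreal (M * (2 powr (- 1/4)) ^ l)"
  have [measurable]: "?F \<in> borel_measurable (leb d)" by (rule sq_intD[OF fourier_L2_spec(1)[OF f]])
  have [measurable]: "(\<lambda>x. increment (orbit x) l k) \<in> borel_measurable (leb d)" for k
    by (rule increment_op_measurable)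
  have [measurable]: "(\<lambda>\<xi>. increment (ray \<xi>) l k) \<in> borel_measurable (leb d)" for k
    using dil_measurable[OF dyad_pos] by (cases l) auto
  have "(\<integral>\<^sup>+x. variation (orbit x) l \<partial>leb d) = (\<Sum>n. sq_norm (leb d) (\<lambda>x. increment (orbit x) l (int_decode n)))"
    unfolding variation_def nn_integral_count_int sq_norm_def by (rule nn_integral_suminf) measurable
  also have "\<dots> = (\<Sum>n. \<integral>\<^sup>+\<xi>. ennreal ((cmod (increment (ray \<xi>) l (int_decode n)))\<^sup>2) * ennreal ((cmod (?F \<xi>))\<^sup>2) \<partial>leb d)"
    unfolding increment_op_sq_norm by (simp add: sq_norm_def norm_mult power_mult_distrib ennreal_mult)
  also have "\<dots> = (\<integral>\<^sup>+\<xi>. (\<Sum>n. ennreal ((cmod (increment (ray \<xi>) l (int_decode n)))\<^sup>2) * ennreal ((cmod (?F \<xi>))\<^sup>2)) \<partial>leb d)"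
    by (rule nn_integral_suminf[symmetric]) measurable
  also have "\<dots> = (\<integral>\<^sup>+\<xi>. variation (ray \<xi>) l * ennreal ((cmod (?F \<xi>))\<^sup>2) \<partial>leb d)"
    unfolding variation_def nn_integral_count_int by simp
  also have "\<dots> \<le> (\<integral>\<^sup>+\<xi>. ?c * ennreal ((cmod (?F \<xi>))\<^sup>2) \<partial>leb d)"
    by (rule nn_integral_mono_AE, use variation_dil in eventually_elim) (auto intro!: mult_right_mono)
  also have "\<dots> = ?c * sq_norm (leb d) ?F" unfolding sq_norm_def by (rule nn_integral_cmult) measurable
  finally show ?thesis by (simp add: fourier_L2_isometry[OF f])
qed

text \<open>Countably many dilations make this supremum measurable; it will serve as a version of
  the almost everywhere supremum behind \<open>maximal_op\<close>.\<close>

definition maxf :: "(nat \<Rightarrow> real) \<Rightarrow> ennreal" where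
  "maxf x = (SUP p. ennreal (cmod (op (dyad (fst p) (snd p)) x)))"

lemma op_le_maxf: "ennreal (cmod (op (dyad l k) x)) \<le> maxf x"
  unfolding maxf_def by (rule SUP_upper2[of "(l, k)"]) auto

lemma maxf_measurable: "maxf \<in> borel_measurable (leb d)"
  unfolding maxf_def[abs_def] using op_measurable[OF dyad_pos]
  by (intro borel_measurable_SUP) auto

lemma maxf_sq_integral:
  "(\<integral>\<^sup>+x. (maxf x)\<^sup>2 \<partial>leb d) \<le> ennreal (M / (1 - 2 powr (- 1/8))\<^sup>2) * sq_norm (leb d) f"
proof -
  \<comment> \<open>Chosen so that \<open>r ^ 4 = 2 powr (- 1/4)\<close>, the decay of
    \<open>variation\<close> per level: the weight \<open>(1 / r\<^sup>2) ^ l\<close> uses up half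
    of the exponent and \<open>(r\<^sup>2) ^ l\<close> is left. The Cauchy-Schwarz factor and the
    sum over the levels each contribute \<open>1 / (1 - r\<^sup>2)\<close>.\<close>
  define r :: real where "r = 2 powr (- 1/16)"
  have r: "0 < r" "r < 1" using powr_less_mono[of "- 1/16" 0 "2::real"] by (simp_all add: r_def)
  have r2: "r\<^sup>2 = 2 powr (- 1/8)" by (simp add: r_def power2_eq_square flip: powr_add)
  have r4: "r ^ 4 = 2 powr (- 1/4)" by (simp add: r_def power4_eq_xxxx flip: powr_add)
  have r2b: "0 < r\<^sup>2" "r\<^sup>2 < 1" using r by (auto simp: power_less_one_iff)
  let ?S = "\<lambda>x. ennreal (1 / (1 - r\<^sup>2)) * (\<Sum>l. ennreal ((1 / r\<^sup>2) ^ l) * variation (orbit x) l)"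
  have [measurable]: "(\<lambda>x. variation (orbit x) l) \<in> borel_measurable (leb d)" for l
    unfolding variation_def nn_integral_count_int using increment_op_measurable by measurable
  have pt: "(maxf x)\<^sup>2 \<le> ?S x" for x
  proof (cases "?S x")
    case (real s)
    have "ennreal (cmod (op (dyad l k) x)) \<le> ennreal (sqrt s)" for l k
    proof -
      have "(ennreal (cmod (op (dyad l k) x)))\<^sup>2 \<le> (ennreal (sqrt s))\<^sup>2"
        using sup_le_variation[OF r, of "\<lambda>t. op t x" l k] real by (simp add: ennreal_power)
      then show ?thesis by (simp only: ennreal_sq_le_iff)
    qed
    then have "maxf x \<le> ennreal (sqrt s)" unfolding maxf_def by (intro SUP_least)
    then have "(maxf x)\<^sup>2 \<le> (ennreal (sqrt s))\<^sup>2" by (simp only: ennreal_sq_le_iff)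
    then show ?thesis using real by (simp add: ennreal_power)
  qed simp
  have "(\<integral>\<^sup>+x. (maxf x)\<^sup>2 \<partial>leb d) \<le> (\<integral>\<^sup>+x. ?S x \<partial>leb d)" by (intro nn_integral_mono pt)
  also have "\<dots> = ennreal (1 / (1 - r\<^sup>2)) * (\<integral>\<^sup>+x. (\<Sum>l. ennreal ((1 / r\<^sup>2) ^ l) * variation (orbit x) l) \<partial>leb d)"
    by (rule nn_integral_cmult) measurable
  also have "(\<integral>\<^sup>+x. (\<Sum>l. ennreal ((1 / r\<^sup>2) ^ l) * variation (orbit x) l) \<partial>leb d)
     = (\<Sum>l. \<integral>\<^sup>+x. ennreal ((1 / r\<^sup>2) ^ l) * variation (orbit x) l \<partial>leb d)"
    by (rule nn_integral_suminf) measurable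
  also have "\<dots> \<le> (\<Sum>l. ennreal (M * (r\<^sup>2) ^ l) * sq_norm (leb d) f)"
  proof (rule suminf_le)
    fix l
    have "(\<integral>\<^sup>+x. ennreal ((1 / r\<^sup>2) ^ l) * variation (orbit x) l \<partial>leb d) = ennreal ((1 / r\<^sup>2) ^ l) * (\<integral>\<^sup>+x. variation (orbit x) l \<partial>leb d)"
      by (rule nn_integral_cmult) measurable
    also have "\<dots> \<le> ennreal ((1 / r\<^sup>2) ^ l) * (ennreal (M * (r ^ 4) ^ l) * sq_norm (leb d) f)"
      unfolding r4 by (intro mult_left_mono variation_op) auto
    also have "\<dots> = ennreal ((1 / r\<^sup>2) ^ l * (M * (r ^ 4) ^ l)) * sq_norm (leb d) f"
      using M_nonneg r by (subst ennreal_mult) (auto simp: mult.assoc)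
    also have "(1 / r\<^sup>2) ^ l * (M * (r ^ 4) ^ l) = M * ((1 / r\<^sup>2) * r ^ 4) ^ l"
      by (simp only: power_mult_distrib mult_ac)
    also have "(1 / r\<^sup>2) * r ^ 4 = r\<^sup>2" using r by (simp add: eval_nat_numeral)
    finally show "(\<integral>\<^sup>+x. ennreal ((1 / r\<^sup>2) ^ l) * variation (orbit x) l \<partial>leb d) \<le> ennreal (M * (r\<^sup>2) ^ l) * sq_norm (leb d) f" .
  qed auto
  also have "\<dots> = (\<Sum>l. ennreal (M * (r\<^sup>2) ^ l)) * sq_norm (leb d) f" by (rule ennreal_suminf_multc)
  also have "(\<Sum>l. ennreal (M * (r\<^sup>2) ^ l)) = ennreal (\<Sum>l. M * (r\<^sup>2) ^ l)"
    using M_nonneg r2b by (intro suminf_ennreal2) (auto intro!: summable_mult summable_geometric)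
  also have "(\<Sum>l. M * (r\<^sup>2) ^ l) = M * (1 / (1 - r\<^sup>2))"
    using r2b by (subst suminf_mult) (auto intro: summable_geometric simp: suminf_geometric)
  also have "ennreal (1 / (1 - r\<^sup>2)) * (ennreal (M * (1 / (1 - r\<^sup>2))) * sq_norm (leb d) f) = ennreal (M / (1 - r\<^sup>2)\<^sup>2) * sq_norm (leb d) f"
    unfolding mult.assoc[symmetric] using M_nonneg r2b
    by (subst ennreal_mult[symmetric]) (auto simp: power2_eq_square)
  finally show ?thesis by (simp add: r2 mult_left_mono)
qed

text \<open>Dyadic points approach \<open>t\<close> from below with ratio \<open>exp (h n)\<close>,
  \<open>h n \<le> 1 / 2 ^ n\<close>, so the multipliers differ by at most
  \<open>2 * J / 2 ^ n\<close> and the squared L^2 distances are summable: the operators converge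
  almost everywhere. The null set depends on \<open>t\<close>, as \<open>is_ae_Sup\<close>
  allows.\<close>

lemma op_le_maxf_AE:
  assumes t: "t > 0"
  shows "AE x in leb d. ennreal (cmod (op t x)) \<le> maxf x"
proof -
  define k where "k n = \<lfloor>2 ^ n * ln t\<rfloor>" for n :: nat
  define h where "h n = ln t - of_int (k n) / 2 ^ n" for n
  have h: "0 \<le> h n" "h n \<le> 1 / 2 ^ n" for n
  proof -
    have "of_int (k n) \<le> 2 ^ n * ln t" "2 ^ n * ln t \<le> of_int (k n) + 1" unfolding k_def by linarith+
    then have "of_int (k n) / 2 ^ n \<le> ln t" "ln t \<le> (of_int (k n) + 1) / 2 ^ n"
      by (simp_all add: divide_le_eq le_divide_eq mult.commute)
    then show "0 \<le> h n" "h n \<le> 1 / 2 ^ n" by (simp_all add: h_def add_divide_distrib)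
  qed
  have h1: "h n \<le> 1" for n using order_trans[OF h(2), of n 1] by simp
  let ?F = "fourier_L2 d f"
  have [measurable]: "?F \<in> borel_measurable (leb d)" by (rule sq_intD[OF fourier_L2_spec(1)[OF f]])
  have b: "sq_norm (leb d) (\<lambda>x. op t x - op (dyad n (k n)) x) \<le> ennreal ((2 * J)\<^sup>2 * (1/4) ^ n) * sq_norm (leb d) f" for n
  proof -
    have "sq_norm (leb d) (\<lambda>x. op t x - op (dyad n (k n)) x) = sq_norm (leb d) (\<lambda>\<xi>. (dil t \<xi> - dil (dyad n (k n)) \<xi>) * ?F \<xi>)"
      by (rule op_diff_sq_norm[OF t dyad_pos])
    also have "\<dots> \<le> sq_norm (leb d) (\<lambda>\<xi>. of_real (2 * J * (1 / 2 ^ n)) * ?F \<xi>)"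
    proof (rule sq_norm_mono_AE, use dil_lipschitz in eventually_elim)
      case (elim \<xi>)
      have "cmod (dil (exp (of_int (k n) / 2 ^ n + h n)) \<xi> - dil (exp (of_int (k n) / 2 ^ n)) \<xi>) \<le> 2 * J * h n"
        by (rule dil_ratio[OF elim h(1) h1])
      also have "\<dots> \<le> 2 * J * (1 / 2 ^ n)" using h J by (intro mult_left_mono) auto
      finally have "cmod (dil t \<xi> - dil (dyad n (k n)) \<xi>) \<le> 2 * J * (1 / 2 ^ n)"
        using t by (simp add: h_def dyad_def)
      also have "\<dots> = cmod (of_real (2 * J * (1 / 2 ^ n)))" using J by (simp only: norm_of_real) simp
      finally show "cmod ((dil t \<xi> - dil (dyad n (k n)) \<xi>) * ?F \<xi>) \<le> cmod (of_real (2 * J * (1 / 2 ^ n)) * ?F \<xi>)"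
        unfolding norm_mult by (rule mult_right_mono) simp
    qed
    also have "\<dots> = ennreal ((2 * J * (1 / 2 ^ n))\<^sup>2) * sq_norm (leb d) ?F"
      by (subst sq_norm_scale) (simp_all only: norm_of_real power2_abs, measurable)
    also have "(2 * J * (1 / 2 ^ n))\<^sup>2 = (2 * J)\<^sup>2 * (1/4) ^ n"
      by (simp add: power_mult_distrib power_divide power2_eq_square flip: power_mult_distrib)
    finally show ?thesis by (simp only: fourier_L2_isometry[OF f])
  qed
  have "(\<Sum>n. sq_norm (leb d) (\<lambda>x. op t x - op (dyad n (k n)) x)) \<le> (\<Sum>n. ennreal ((2 * J)\<^sup>2 * (1/4) ^ n) * sq_norm (leb d) f)"
    by (rule suminf_le[OF b]) auto
  also have "\<dots> = (\<Sum>n. ennreal ((2 * J)\<^sup>2 * (1/4) ^ n)) * sq_norm (leb d) f" by (rule ennreal_suminf_multc)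
  also have "\<dots> = ennreal (\<Sum>n. (2 * J)\<^sup>2 * (1/4) ^ n) * sq_norm (leb d) f"
    by (subst suminf_ennreal2) (auto intro!: summable_mult summable_geometric)
  also have "\<dots> < \<infinity>" using sq_int_fin[OF f] by (simp add: ennreal_mult_less_top)
  finally have "AE x in leb d. (\<lambda>n. op t x - op (dyad n (k n)) x) \<longlonglongrightarrow> 0"
    by (intro AE_tendsto_0_of_sq_norm borel_measurable_diff op_measurable dyad_pos t)
  then show ?thesis
  proof eventually_elim
    case (elim x)
    have "(\<lambda>n. op t x - (op t x - op (dyad n (k n)) x)) \<longlonglongrightarrow> op t x - 0"
      by (intro tendsto_diff tendsto_const elim)
    then have "(\<lambda>n. ennreal (cmod (op (dyad n (k n)) x))) \<longlonglongrightarrow> ennreal (cmod (op t x))"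
      by (intro tendsto_ennrealI tendsto_norm) simp
    then show ?case by (rule LIMSEQ_le_const2) (use op_le_maxf in auto)
  qed
qed

text \<open>The choice in \<open>maximal_op\<close> is legitimate because \<open>maxf\<close> itself
  is an almost everywhere supremum; the minimality of the chosen function, tested against
  \<open>maxf\<close>, gives the bound.\<close>

lemma maximal_op_le_maxf: "AE x in leb d. maximal_op d a f x \<le> maxf x"
proof -
  let ?P = "is_ae_Sup (leb d) {0<..} (\<lambda>t x. ennreal (cmod (op t x)))"
  have "?P maxf" unfolding is_ae_Sup_def
  proof (intro conjI ballI impI maxf_measurable)
    show "AE x in leb d. ennreal (cmod (op t x)) \<le> maxf x" if "t \<in> {0<..}" for t
      using that by (intro op_le_maxf_AE) simp
    fix K assume K: "\<forall>t\<in>{0<..}. AE x in leb d. ennreal (cmod (op t x)) \<le> K x"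
    have "AE x in leb d. \<forall>p. ennreal (cmod (op (dyad (fst p) (snd p)) x)) \<le> K x"
      by (intro AE_all_countable[THEN iffD2] allI) (use K dyad_pos in simp)
    then show "AE x in leb d. maxf x \<le> K x"
      by eventually_elim (auto simp: maxf_def intro!: SUP_least)
  qed
  then have "?P (maximal_op d a f)" unfolding maximal_op_def by (rule someI[of ?P])
  then show ?thesis unfolding is_ae_Sup_def using maxf_measurable op_le_maxf_AE by auto
qed

lemma maximal_op_L2norm:
  "L2norm d (maximal_op d a f) \<le> ennreal (sqrt M / (1 - 2 powr (- 1/8))) * L2cnorm d f"
proof -
  have p: "(2::real) powr (- 1/8) < 1" using powr_less_mono[of "- 1/8" 0 "2::real"] by simp
  have "(L2norm d (maximal_op d a f))\<^sup>2 = (\<integral>\<^sup>+x. (maximal_op d a f x)\<^sup>2 \<partial>leb d)" by (rule L2norm_sq)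
  also have "\<dots> \<le> (\<integral>\<^sup>+x. (maxf x)\<^sup>2 \<partial>leb d)"
    by (rule nn_integral_mono_AE, use maximal_op_le_maxf in eventually_elim) (rule power_mono, auto)
  also have "\<dots> \<le> ennreal (M / (1 - 2 powr (- 1/8))\<^sup>2) * sq_norm (leb d) f" by (rule maxf_sq_integral)
  also have "M / (1 - 2 powr (- 1/8))\<^sup>2 = (sqrt M / (1 - 2 powr (- 1/8)))\<^sup>2"
    using M_nonneg by (simp add: power_divide)
  also have "ennreal \<dots> * sq_norm (leb d) f = (ennreal (sqrt M / (1 - 2 powr (- 1/8))) * L2cnorm d f)\<^sup>2"
    unfolding power_mult_distrib L2cnorm_sq using p M_nonneg by (subst ennreal_power) auto
  finally show ?thesis by (simp only: ennreal_sq_le_iff)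
qed

end

text \<open>The factor in front of \<open>A powr (1/4)\<close> is built from \<open>J\<close> and
  numbers only, so the same constant serves every \<open>d\<close>, \<sigma> and
  \<open>a\<close>.\<close>

lemma maximal_op_norm_le:
  "maximal_op_norm d a \<le> ennreal (sqrt (32 * (sqrt 2 * (2 * J) powr (5/4) * (4 * J) powr (1/4))) / (1 - 2 powr (- 1/8)) * A powr (1/4))"
proof -
  have "maximal_op_norm d a \<le> ennreal (sqrt M / (1 - 2 powr (- 1/8)))"
    unfolding maximal_op_norm_def L2_eq_sq_int
    by (rule Inf_lower) (intro CollectI ballI maximal_op_L2norm)
  also have "sqrt M = sqrt (32 * (sqrt 2 * (2 * J) powr (5/4) * (4 * J) powr (1/4))) * A powr (1/4)"
  proof -
    have "sqrt (sqrt A) = A powr (1/4)"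
      using A_nonneg by (simp add: powr_half_sqrt[symmetric] powr_powr)
    moreover have "M = 32 * (sqrt 2 * (2 * J) powr (5/4) * (4 * J) powr (1/4)) * sqrt A"
      by (simp add: M_def real_sqrt_mult)
    ultimately show ?thesis by (simp only: real_sqrt_mult)
  qed
  finally show ?thesis by simp
qed

end

theorem theorem1p8:
  fixes J :: real
  assumes "J > 0"
  shows "\<exists>C>0. \<forall>(d::nat) (\<sigma>::real) (a :: (nat \<Rightarrow> real) \<Rightarrow> complex).
    d \<ge> 1 \<longrightarrow> \<sigma> > 0 \<longrightarrow>
    bounded (a ` space (leb d)) \<longrightarrow>
    (AE \<xi> in leb d. differentiable_pt d a \<xi>) \<longrightarrow>
    radially_abs_continuous d a \<longrightarrow>
    (AE \<xi> in leb d. cmod (a \<xi>) \<le> J * \<sigma> * vnorm d \<xi>) \<longrightarrow>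
    (AE \<xi> in leb d. cmod (a \<xi>) \<le> J * (1 / (\<sigma> * vnorm d \<xi>))) \<longrightarrow>
    (AE \<xi> in leb d. cmod (radial_deriv d a \<xi>) \<le> J) \<longrightarrow>
    maximal_op_norm d a \<le> ennreal (C * enn2real (Linfnorm d a) powr (1/4))"
proof (intro exI conjI allI impI)
  let ?C = "sqrt (32 * (sqrt 2 * (2 * J) powr (5/4) * (4 * J) powr (1/4))) / (1 - 2 powr (- 1/8))"
  have "(2::real) powr (- 1/8) < 1" using powr_less_mono[of "- 1/8" 0 "2::real"] by simp
  then show "?C > 0" using assms by simp
  fix d :: nat and \<sigma> :: real and a :: "(nat \<Rightarrow> real) \<Rightarrow> complex"
  assume "\<sigma> > 0" "bounded (a ` space (leb d))" "AE \<xi> in leb d. differentiable_pt d a \<xi>"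
    "radially_abs_continuous d a" "AE \<xi> in leb d. cmod (a \<xi>) \<le> J * \<sigma> * vnorm d \<xi>"
    "AE \<xi> in leb d. cmod (a \<xi>) \<le> J * (1 / (\<sigma> * vnorm d \<xi>))" "AE \<xi> in leb d. cmod (radial_deriv d a \<xi>) \<le> J"
  then interpret symbol J \<sigma> d a using assms by unfold_locales
  show "maximal_op_norm d a \<le> ennreal (?C * enn2real (Linfnorm d a) powr (1/4))"
    using maximal_op_norm_le by (simp add: A_def)
qed

end
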